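(* $\mathrm{TMC}^s$ restricted to splitjunction-free LTL formulas (formulas not containing $\vee$) is in $\mathrm{PSPACE}$.
   Context: Fix a finite set $AP$. Traces are elements of $(2^{AP})^\omega$, $t[i,\infty)=t(i)t(i+1)\cdots$; teams are sets of traces, $T[i,\infty)=\{t[i,\infty):t\in T\}$. LTL formulas: $\varphi::=p\mid\neg p\mid\varphi\wedge\varphi\mid\varphi\vee\varphi\mid X\varphi\mid F\varphi\mid G\varphi\mid\varphi U\varphi\mid\varphi R\varphi$ ($p\in AP$). Synchronous team semantics: $T\models_s p$ iff $p\in t(0)$ for all $t\in T$; $T\models_s\neg p$ iff $p\notin t(0)$ for all $t\in T$; $\wedge$ conjunctive; $T\models_s\psi\vee\varphi$ iff $T=T_1\cup T_2$ with $T_1\models_s\psi$, $T_2\models_s\varphi$; $T\models_s X\varphi$ iff $T[1,\infty)\models_s\varphi$; $T\models_s F\varphi$ iff $\exists k$: $T[k,\infty)\models_s\varphi$; $T\models_s G\varphi$ iff $\forall k$: $T[k,\infty)\models_s\varphi$; $T\models_s\psi U\varphi$ iff $\exists k$: $T[k,\infty)\models_s\varphi$ and $\forall k'<k$: $T[k',\infty)\models_s\psi$; $T\models_s\psi R\varphi$ iff $\forall k$: $T[k,\infty)\models_s\varphi$ or $\exists k'<k$: $T[k',\infty)\models_s\psi$. A Kripke structure $\mathcal K=(W,R,\eta,w_I)$: finite set $W$, left-total $R\subseteq W\times W$, labelling $\eta:W\to 2^{AP}$, initial world $w_I$; a path is $\pi\in W^\omega$ with $\pi(0)=w_I$ and $(\pi(i),\pi(i+1))\in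 R$; its trace is $\eta(\pi(0))\eta(\pi(1))\cdots$; $T(\mathcal K)$ is the set of traces of all paths. $\mathrm{TMC}^s$: given an LTL formula $\varphi$ and a Kripke structure $\mathcal K$, does $T(\mathcal K)\models_s\varphi$? *)

theory Defs
  imports Main
begin

text \<open>Atomic propositions are natural numbers; a fixed finite set AP of them is
a parameter of the problem.\<close>

datatype ltl =
    Prop nat | NProp nat
  | And ltl ltl | Or ltl ltl
  | Next ltl | Fin ltl | Glob ltl
  | Until ltl ltl | Release ltl ltl

type_synonym trace = "nat \<Rightarrow> nat set"

definition suffix :: "trace \<Rightarrow> nat \<Rightarrow> trace" where
  "suffix t k = (\<lambda>i. t (i + k))"

definition team_suffix :: "trace set \<Rightarrow> nat \<Rightarrow> trace set" where
  "team_suffix T k = (\<lambda>t. suffix t k) ` T"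

primrec sat_s :: "trace set \<Rightarrow> ltl \<Rightarrow> bool" where
  "sat_s T (Prop p) = (\<forall>t\<in>T. p \<in> t 0)"
| "sat_s T (NProp p) = (\<forall>t\<in>T. p \<notin> t 0)"
| "sat_s T (And a b) = (sat_s T a \<and> sat_s T b)"
| "sat_s T (Or a b) = (\<exists>T1 T2. T = T1 \<union> T2 \<and> sat_s T1 a \<and> sat_s T2 b)"
| "sat_s T (Next a) = sat_s (team_suffix T 1) a"
| "sat_s T (Fin a) = (\<exists>k. sat_s (team_suffix T k) a)"
| "sat_s T (Glob a) = (\<forall>k. sat_s (team_suffix T k) a)"
| "sat_s T (Until a b) = (\<exists>k. sat_s (team_suffix T k) b \<and>
                           (\<forall>k'<k. sat_s (team_suffix T k') a))"
| "sat_s T (Release a b) = (\<forall>k. sat_s (team_suffix T k) b \<or>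
                           (\<exists>k'<k. sat_s (team_suffix T k') a))"

primrec disj_free :: "ltl \<Rightarrow> bool" where
  "disj_free (Prop p) = True"
| "disj_free (NProp p) = True"
| "disj_free (And a b) = (disj_free a \<and> disj_free b)"
| "disj_free (Or a b) = False"
| "disj_free (Next a) = disj_free a"
| "disj_free (Fin a) = disj_free a"
| "disj_free (Glob a) = disj_free a"
| "disj_free (Until a b) = (disj_free a \<and> disj_free b)"
| "disj_free (Release a b) = (disj_free a \<and> disj_free b)"

primrec atoms :: "ltl \<Rightarrow> nat set" where
  "atoms (Prop p) = {p}"
| "atoms (NProp p) = {p}"
| "atoms (And a b) = atoms a \<union> atoms b"
| "atoms (Or a b) = atoms a \<union> atoms b"
| "atoms (Next a) = atoms a"
| "atoms (Fin a) = atoms a"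
| "atoms (Glob a) = atoms a"
| "atoms (Until a b) = atoms a \<union> atoms b"
| "atoms (Release a b) = atoms a \<union> atoms b"

text \<open>Worlds are 0..<ks_n; the relation is given by a list of edges; the labelling
of world i is the set of elements of ks_lab ! i; ks_init is the initial world.\<close>

record kripke =
  ks_n :: nat
  ks_edges :: "(nat \<times> nat) list"
  ks_lab :: "nat list list"
  ks_init :: nat

definition wf_kripke :: "nat set \<Rightarrow> kripke \<Rightarrow> bool" where
  "wf_kripke AP K \<longleftrightarrow>
     ks_init K < ks_n K \<and>
     length (ks_lab K) = ks_n K \<and>
     (\<forall>l \<in> set (ks_lab K). set l \<subseteq> AP) \<and>
     (\<forall>(a,b) \<in> set (ks_edges K). a < ks_n K \<and> b < ks_n K) \<and>
     (\<forall>w < ks_n K. \<exists>v. (w, v) \<in> set (ks_edges K))"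

definition is_path :: "kripke \<Rightarrow> (nat \<Rightarrow> nat) \<Rightarrow> bool" where
  "is_path K \<pi> \<longleftrightarrow> \<pi> 0 = ks_init K \<and> (\<forall>i. (\<pi> i, \<pi> (Suc i)) \<in> set (ks_edges K))"

definition traces :: "kripke \<Rightarrow> trace set" where
  "traces K = {(\<lambda>i. set (ks_lab K ! \<pi> i)) | \<pi>. is_path K \<pi>}"

fun enc_nat :: "nat \<Rightarrow> nat list" where
  "enc_nat n = (if n = 0 then [3] else (if n mod 2 = 0 then 1 else 2) # enc_nat (n div 2))"

primrec enc_ltl :: "ltl \<Rightarrow> nat list" where
  "enc_ltl (Prop p) = 4 # enc_nat p"
| "enc_ltl (NProp p) = 5 # enc_nat p"
| "enc_ltl (And a b) = 6 # enc_ltl a @ enc_ltl b"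
| "enc_ltl (Or a b) = 7 # enc_ltl a @ enc_ltl b"
| "enc_ltl (Next a) = 8 # enc_ltl a"
| "enc_ltl (Fin a) = 9 # enc_ltl a"
| "enc_ltl (Glob a) = 10 # enc_ltl a"
| "enc_ltl (Until a b) = 11 # enc_ltl a @ enc_ltl b"
| "enc_ltl (Release a b) = 12 # enc_ltl a @ enc_ltl b"

definition enc_kripke :: "kripke \<Rightarrow> nat list" where
  "enc_kripke K = 13 # enc_nat (ks_n K) @ enc_nat (ks_init K)
     @ concat (map (\<lambda>(a,b). 14 # enc_nat a @ enc_nat b) (ks_edges K))
     @ concat (map (\<lambda>l. 15 # concat (map enc_nat l)) (ks_lab K))"

definition enc_instance :: "ltl \<Rightarrow> kripke \<Rightarrow> nat list" where
  "enc_instance \<phi> K = enc_ltl \<phi> @ enc_kripke K"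

definition instance_alphabet :: "nat set" where
  "instance_alphabet = {1..15}"

definition TMC_s_disjfree :: "nat set \<Rightarrow> nat list set" where
  "TMC_s_disjfree AP = {enc_instance \<phi> K | \<phi> K.
      disj_free \<phi> \<and> atoms \<phi> \<subseteq> AP \<and> wf_kripke AP K \<and> sat_s (traces K) \<phi>}"

text \<open>One-way infinite single tape, cells indexed by nat, symbol 0 is the blank,
states 0..<tm_states, start state 0, tape symbols 0..<tm_syms.\<close>

datatype dir = Left | Right | Stay

record tm =
  tm_states :: nat
  tm_syms :: nat
  tm_delta :: "nat \<Rightarrow> nat \<Rightarrow> nat \<times> nat \<times> dir"
  tm_acc :: nat
  tm_rej :: nat

type_synonym config = "nat \<times> (nat \<Rightarrow> nat) \<times> nat"  (* state, tape, head position *)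

definition wf_tm :: "tm \<Rightarrow> bool" where
  "wf_tm M \<longleftrightarrow> 0 < tm_states M \<and> tm_acc M < tm_states M \<and> tm_rej M < tm_states M \<and>
     tm_acc M \<noteq> tm_rej M \<and> 0 < tm_syms M \<and>
     (\<forall>q < tm_states M. \<forall>s < tm_syms M.
        fst (tm_delta M q s) < tm_states M \<and> fst (snd (tm_delta M q s)) < tm_syms M)"

fun move :: "dir \<Rightarrow> nat \<Rightarrow> nat" where
  "move Left h = h - 1"
| "move Right h = Suc h"
| "move Stay h = h"

definition tm_step :: "tm \<Rightarrow> config \<Rightarrow> config" where
  "tm_step M c = (case c of (q, t, h) \<Rightarrow>
     if q = tm_acc M \<or> q = tm_rej M then (q, t, h)
     else (case tm_delta M q (t h) of (q', s, d) \<Rightarrow> (q', t(h := s), move d h)))"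

definition tm_init :: "nat list \<Rightarrow> config" where
  "tm_init w = (0, (\<lambda>i. if i < length w then w ! i else 0), 0)"

definition tm_run :: "tm \<Rightarrow> nat list \<Rightarrow> nat \<Rightarrow> config" where
  "tm_run M w n = (tm_step M ^^ n) (tm_init w)"

definition in_PSPACE :: "nat set \<Rightarrow> nat list set \<Rightarrow> bool" where
  "in_PSPACE \<Sigma> L \<longleftrightarrow> (\<exists>M c d.
     wf_tm M \<and> \<Sigma> \<subseteq> {1..<tm_syms M} \<and>
     (\<forall>w \<in> lists \<Sigma>.
        (\<exists>n. fst (tm_run M w n) \<in> {tm_acc M, tm_rej M}) \<and>
        ((\<exists>n. fst (tm_run M w n) = tm_acc M) \<longleftrightarrow> w \<in> L) \<and>
        (\<forall>n. snd (snd (tm_run M w n)) \<le> c * length w ^ d + c)))"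

end

(* A team of traces of a Kripke structure enters the semantics of a splitjunction-free formula only
   through the set S(k) of worlds reachable in k steps, so such a formula is evaluated like an
   ordinary LTL formula along the deterministic, eventually periodic sequence S(0), S(1), ...; among
   the first 2^n of the sets from any point on, all of them occur. The truth values of all
   subformulas at time k are determined by S(k) and the truth values at time k + 1, hence can be
   computed backwards in time from a far horizon, storing only one bit per subformula and
   recomputing S(k) when it is needed. A temporal operator must not read unreliable values of its
   arguments; therefore it stays inactive until the arguments have become reliable, and it is
   itself reliable 2^n steps later.

   Time being irrelevant, the Turing machine only has to increment, decrement and test finitely many
   binary counters, one on each track of its tape. While programs over such counters are closed under
   substitution and under primitive recursion with polynomially many bits, which makes the algorithm
   an explicit definition by bounded quantifiers and bounded recursion over positions in the input. *)

theory Submission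
  imports Defs
begin

section \<open>While programs on Turing machines\<close>


text \<open>Without splitjunction a team is never divided, so every team met during evaluation is a
  suffix of the whole team of traces. Computing backwards reconciles two opposite dependencies: the
  sets S(k) unfold forwards and cannot be inverted, while the truth value of an until depends on the
  future. Recomputing S(k) from the initial world costs time only. The bound 2^n comes from
  pigeonhole: there are no more worlds than letters, hence at most 2^|w| sets. In prefix notation
  arguments lie to the right of their operator, so one block of 2^|w| steps per position, plus one,
  makes all subformulas reliable in turn; this is the horizon (|w| + 1) * 2^|w|, a number of
  polynomially many bits. Space is charged by bit length, so loops may run exponentially often:
  sums, searches and even the length of the word are found by counting. A recursion only needs an
  a-priori bound on its intermediate values. The language consists of exact encodings, so any other
  word over the alphabet has to be rejected; a large part of the proof is this syntax check,
  performed for formulas by the evaluation stack itself.\<close>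

datatype cmd = Skip | Inc nat | Dec nat | Seq cmd cmd | While nat cmd

text \<open>The space bound is part of the semantics: an increment that would reach \<open>B\<close>
  has no derivation, nor has a decrement of 0. A derivation also witnesses termination.\<close>

inductive big :: "nat \<Rightarrow> cmd \<Rightarrow> (nat \<Rightarrow> nat) \<Rightarrow> (nat \<Rightarrow> nat) \<Rightarrow> bool" for B where
  big_Skip: "big B Skip s s"
| big_Inc: "Suc (s x) < B \<Longrightarrow> big B (Inc x) s (s(x := Suc (s x)))"
| big_Dec: "s x = Suc v \<Longrightarrow> big B (Dec x) s (s(x := v))"
| big_Seq: "big B c s s1 \<Longrightarrow> big B c' s1 s2 \<Longrightarrow> big B (Seq c c') s s2"
| big_WhileF: "s x = 0 \<Longrightarrow> big B (While x c) s s"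
| big_WhileT: "s x \<noteq> 0 \<Longrightarrow> big B c s s1 \<Longrightarrow> big B (While x c) s1 s2 \<Longrightarrow> big B (While x c) s s2"

lemma big_mono: "big B c s s' \<Longrightarrow> B \<le> B' \<Longrightarrow> big B' c s s'"
  by (induction rule: big.induct) (auto intro: big.intros)

section \<open>Small-step semantics and the finite set of control states\<close>

datatype act = Halt | AInc nat cmd | ADec nat cmd | ATest nat cmd cmd

text \<open>Extracts the next register operation together with the remaining program, so that a
  program can serve as a control state. The first continuation of \<open>ATest\<close> is for a
  nonzero register.\<close>

primrec next_act :: "cmd \<Rightarrow> act" where
  "next_act Skip = Halt"
| "next_act (Inc x) = AInc x Skip"
| "next_act (Dec x) = ADec x Skip"
| "next_act (Seq a b) = (case next_act a of Halt \<Rightarrow> next_act b | AInc x a' \<Rightarrow> AInc x (Seq a' b)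
     | ADec x a' \<Rightarrow> ADec x (Seq a' b) | ATest x a1 a2 \<Rightarrow> ATest x (Seq a1 b) (Seq a2 b))"
| "next_act (While x c) = ATest x (Seq c (While x c)) Skip"

inductive cstep :: "nat \<Rightarrow> cmd \<times> (nat \<Rightarrow> nat) \<Rightarrow> cmd \<times> (nat \<Rightarrow> nat) \<Rightarrow> bool" for B where
  "next_act c = AInc x c' \<Longrightarrow> Suc (s x) < B \<Longrightarrow> cstep B (c, s) (c', s(x := Suc (s x)))"
| "next_act c = ADec x c' \<Longrightarrow> s x = Suc v \<Longrightarrow> cstep B (c, s) (c', s(x := v))"
| "next_act c = ATest x c1 c2 \<Longrightarrow> s x \<noteq> 0 \<Longrightarrow> cstep B (c, s) (c1, s)"
| "next_act c = ATest x c1 c2 \<Longrightarrow> s x = 0 \<Longrightarrow> cstep B (c, s) (c2, s)"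

lemma cstep_Seq1: "cstep B (a, s) (a', s') \<Longrightarrow> cstep B (Seq a b, s) (Seq a' b, s')"
  by (erule cstep.cases) (auto intro: cstep.intros)

lemma csteps_Seq1:
  assumes "(cstep B)\<^sup>*\<^sup>* (a, s) (a', s')"
  shows "(cstep B)\<^sup>*\<^sup>* (Seq a b, s) (Seq a' b, s')"
  using assms
proof (induction "(a, s)" "(a', s')" arbitrary: a' s' rule: rtranclp.induct)
  case (rtrancl_into_rtrancl p)
  then show ?case by (cases p) (auto intro: rtranclp.rtrancl_into_rtrancl cstep_Seq1)
qed simp

lemma cstep_Seq2:
  assumes "next_act a = Halt" "cstep B (b, s) p"
  shows "cstep B (Seq a b, s) p"
  using assms(2,1) by (cases rule: cstep.cases) (auto intro: cstep.intros)

text \<open>The run ends in some program with next action \<open>Halt\<close> rather than in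
  \<open>Skip\<close>, because a finished first component of a \<open>Seq\<close> is dropped only
  when the second one takes a step (\<open>cstep_Seq2\<close>).\<close>

lemma big_csteps:
  "big B c s s' \<Longrightarrow> \<exists>c'. next_act c' = Halt \<and> (cstep B)\<^sup>*\<^sup>* (c, s) (c', s')"
proof (induction rule: big.induct)
  case (big_Skip s)
  then show ?case by (intro exI[of _ Skip]) auto
next
  case (big_Inc s x)
  then show ?case
    by (intro exI[of _ Skip] conjI r_into_rtranclp cstep.intros) auto
next
  case (big_Dec s x)
  then show ?case
    by (intro exI[of _ Skip] conjI r_into_rtranclp cstep.intros) auto
next
  case (big_Seq c s s1 c' s2)
  then obtain a b where a: "next_act a = Halt" "(cstep B)\<^sup>*\<^sup>* (c, s) (a, s1)"
    and b: "next_act b = Halt" "(cstep B)\<^sup>*\<^sup>* (c', s1) (b, s2)" by blast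
  have 1: "(cstep B)\<^sup>*\<^sup>* (Seq c c', s) (Seq a c', s1)" by (rule csteps_Seq1[OF a(2)])
  from b(2) show ?case
  proof (cases rule: converse_rtranclpE)
    case base
    then show ?thesis using 1 a b by (intro exI[of _ "Seq a c'"]) auto
  next
    case (step p)
    then have "cstep B (Seq a c', s1) p" using cstep_Seq2 a(1) by blast
    with 1 step(2) b(1) show ?thesis by (meson converse_rtranclp_into_rtranclp rtranclp_trans)
  qed
next
  case (big_WhileF s x c)
  then have "cstep B (While x c, s) (Skip, s)"
    by (intro cstep.intros(4)) auto
  then show ?case by (intro exI[of _ Skip]) auto
next
  case (big_WhileT s x c s1 s2)
  then obtain a b where a: "next_act a = Halt" "(cstep B)\<^sup>*\<^sup>* (c, s) (a, s1)"
    and b: "next_act b = Halt" "(cstep B)\<^sup>*\<^sup>* (While x c, s1) (b, s2)" by blast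
  let ?w = "While x c"
  have "cstep B (?w, s) (Seq c ?w, s)"
    using big_WhileT by (intro cstep.intros(3)) auto
  then have 1: "(cstep B)\<^sup>*\<^sup>* (?w, s) (Seq a ?w, s1)"
    using csteps_Seq1[OF a(2)] by (meson converse_rtranclp_into_rtranclp)
  from b(2) show ?case
  proof (cases rule: converse_rtranclpE)
    case base
    then show ?thesis using 1 a b by (intro exI[of _ "Seq a ?w"]) auto
  next
    case (step p)
    then have "cstep B (Seq a ?w, s1) p" using cstep_Seq2 a(1) by blast
    with 1 step(2) b(1) show ?thesis by (meson converse_rtranclp_into_rtranclp rtranclp_trans)
  qed
qed

text \<open>A finite set containing everything that can remain of a program, in the manner of the
  partial derivatives of a regular expression. It provides the finitely many machine states.\<close>

primrec residuals :: "cmd \<Rightarrow> cmd set" where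
  "residuals Skip = {Skip}"
| "residuals (Inc x) = {Inc x, Skip}"
| "residuals (Dec x) = {Dec x, Skip}"
| "residuals (Seq a b) = (\<lambda>a'. Seq a' b) ` residuals a \<union> residuals b"
| "residuals (While x c) = {While x c, Skip} \<union> (\<lambda>c'. Seq c' (While x c)) ` residuals c"

lemma finite_residuals: "finite (residuals c)"
  by (induction c) auto

lemma self_residual: "c \<in> residuals c"
  by (induction c) auto

primrec succs :: "act \<Rightarrow> cmd set" where
  "succs Halt = {}"
| "succs (AInc x c) = {c}"
| "succs (ADec x c) = {c}"
| "succs (ATest x c1 c2) = {c1, c2}"

lemma succs_residuals: "c' \<in> residuals c \<Longrightarrow> succs (next_act c') \<subseteq> residuals c"
proof (induction c arbitrary: c')
  case (Seq a b)
  show ?case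
  proof (cases "c' \<in> residuals b")
    case True
    then show ?thesis using Seq.IH(2) by fastforce
  next
    case False
    then obtain a' where a': "c' = Seq a' b" "a' \<in> residuals a" using Seq.prems by auto
    then show ?thesis using Seq.IH(1)[OF a'(2)] Seq.IH(2)[OF self_residual]
      by (cases "next_act a'") auto
  qed
next
  case (While x c)
  show ?case
  proof (cases "c' \<in> {While x c, Skip}")
    case False
    then obtain a' where a': "c' = Seq a' (While x c)" "a' \<in> residuals c" using While by auto
    then show ?thesis using While.IH[OF a'(2)] self_residual[of c]
      by (cases "next_act a'") auto
  qed (use self_residual in auto)
qed auto

primrec regs :: "cmd \<Rightarrow> nat set" where
  "regs Skip = {}"
| "regs (Inc x) = {x}"
| "regs (Dec x) = {x}"
| "regs (Seq a b) = regs a \<union> regs b"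
| "regs (While x c) = insert x (regs c)"

lemma finite_regs: "finite (regs c)"
  by (induction c) auto

primrec act_regs :: "act \<Rightarrow> nat set" where
  "act_regs Halt = {}"
| "act_regs (AInc x c) = {x}"
| "act_regs (ADec x c) = {x}"
| "act_regs (ATest x c1 c2) = {x}"

lemma act_regs_subset: "act_regs (next_act c) \<subseteq> regs c"
  by (induction c) (auto split: act.splits)

lemma regs_residuals: "c' \<in> residuals c \<Longrightarrow> regs c' \<subseteq> regs c"
  by (induction c arbitrary: c') (auto, blast+)

text \<open>\<open>Run c\<close> moves right from cell 0 while performing the next operation of
  \<open>c\<close>; \<open>Back c\<close> brings the head back to cell 0 before \<open>c\<close> is
  run.\<close>

datatype ctl = Begin | Acc | Rej | Run cmd | Back cmd

text \<open>Register \<open>j\<close> is stored in binary, least significant bit at cell 0, on track \<open>j\<close> of the tape,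
  i.e. as the bits number \<open>j\<close> of the tape symbols. Track \<open>K\<close> marks cell 0 and track \<open>Suc K\<close> the
  cells written so far, so that the blank symbol 0 delimits the used part of the tape. The letters
  1 to 15 of the input thereby become four binary numbers without any preprocessing.\<close>

definition cdelta :: "nat \<Rightarrow> nat \<Rightarrow> cmd \<Rightarrow> ctl \<Rightarrow> nat \<Rightarrow> ctl \<times> nat \<times> dir" where
  "cdelta K r c0 q a = (case q of
      Begin \<Rightarrow> (Run c0, set_bit K (set_bit (Suc K) a), Stay)
    | Acc \<Rightarrow> (Acc, a, Stay)
    | Rej \<Rightarrow> (Rej, a, Stay)
    | Back c \<Rightarrow> if bit a K then (Run c, a, Stay) else (Back c, a, Left)
    | Run c \<Rightarrow> (case next_act c of
        AInc x c' \<Rightarrow> if bit a x then (Run c, unset_bit x (set_bit (Suc K) a), Right)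
                     else (Back c', set_bit x (set_bit (Suc K) a), Stay)
      | ADec x c' \<Rightarrow> if bit a x then (Back c', unset_bit x (set_bit (Suc K) a), Stay)
                     else (Run c, set_bit x (set_bit (Suc K) a), Right)
      | ATest x c1 c2 \<Rightarrow> if bit a x then (Back c1, a, Stay)
                         else if a = 0 then (Back c2, a, Stay) else (Run c, a, Right)
      | Halt \<Rightarrow> if bit a r then (Acc, a, Stay)
                else if a = 0 then (Rej, a, Stay) else (Run c, a, Right)))"

section \<open>Simulation on a tape with one track per register\<close>

definition astep :: "('q \<Rightarrow> nat \<Rightarrow> 'q \<times> nat \<times> dir) \<Rightarrow> 'q \<Rightarrow> 'q \<Rightarrow>
    'q \<times> (nat \<Rightarrow> nat) \<times> nat \<Rightarrow> 'q \<times> (nat \<Rightarrow> nat) \<times> nat" where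
  "astep \<delta> qa qr = (\<lambda>(q, t, h). if q = qa \<or> q = qr then (q, t, h)
     else (case \<delta> q (t h) of (q', a, d) \<Rightarrow> (q', t(h := a), move d h)))"

lemma tm_of_abstract:
  fixes \<delta> :: "'q \<Rightarrow> nat \<Rightarrow> 'q \<times> nat \<times> dir"
  assumes Q: "finite Q" "q0 \<in> Q" "qa \<in> Q" "qr \<in> Q" "qa \<noteq> qr"
    and closed: "\<And>q a. q \<in> Q \<Longrightarrow> fst (\<delta> q a) \<in> Q"
    and syms: "\<And>q a. q \<in> Q \<Longrightarrow> a < S \<Longrightarrow> fst (snd (\<delta> q a)) < S" "0 < S"
  obtains M f where "wf_tm M" "tm_syms M = S" "inj_on f Q" "tm_acc M = f qa" "tm_rej M = f qr"
    "\<And>w n. tm_run M w n = apfst f ((astep \<delta> qa qr ^^ n) (apfst (\<lambda>_. q0) (tm_init w)))"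
    "\<And>c n. fst c \<in> Q \<Longrightarrow> fst ((astep \<delta> qa qr ^^ n) c) \<in> Q"
proof -
  obtain g :: "'q \<Rightarrow> nat" where g: "inj_on g Q"
    using finite_imp_inj_to_nat_seg[OF Q(1)] by blast
  \<comment> \<open>\<open>tm_init\<close> starts in state 0, so \<open>q0\<close> is sent to 0 and
    all other states are moved up by one.\<close>
  define f where "f q = (if q = q0 then 0 else Suc (g q))" for q
  have inj: "inj_on f Q" using g by (auto simp: inj_on_def f_def)
  \<comment> \<open>Numbers below the maximal code that code no state get a dummy transition, as
    \<open>wf_tm\<close> quantifies over them too.\<close>
  define M where "M = \<lparr>tm_states = Suc (Max (f ` Q)), tm_syms = S,
    tm_delta = (\<lambda>n a. if n \<in> f ` Q then apfst f (\<delta> (inv_into Q f n) a) else (0, 0, Stay)),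
    tm_acc = f qa, tm_rej = f qr\<rparr>"
  have lt: "f q < Suc (Max (f ` Q))" if "q \<in> Q" for q
    using that Q(1) by (simp add: le_imp_less_Suc)
  have inv: "inv_into Q f n \<in> Q" if "n \<in> f ` Q" for n
    by (meson inv_into_into that)
  have wf: "wf_tm M"
    unfolding wf_tm_def M_def
    using Q syms closed inv lt inj
    by (auto simp: inj_on_eq_iff)
  have step: "tm_step M (apfst f c) = apfst f (astep \<delta> qa qr c)" if "fst c \<in> Q" for c
    using that Q inj unfolding tm_step_def astep_def M_def
    by (cases c) (auto simp: inj_on_eq_iff split: prod.splits)
  have stay: "fst (astep \<delta> qa qr c) \<in> Q" if "fst c \<in> Q" for c
    using that closed[of "fst c" "(fst (snd c)) (snd (snd c))"] unfolding astep_def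
    by (auto split: prod.splits)
  have stays: "fst ((astep \<delta> qa qr ^^ n) c) \<in> Q" if "fst c \<in> Q" for c n
    using that by (induction n) (auto intro: stay)
  have "(tm_step M ^^ n) (apfst f c) = apfst f ((astep \<delta> qa qr ^^ n) c)" if "fst c \<in> Q" for c n
    by (induction n) (auto simp: step stays[OF that])
  moreover have "tm_init w = apfst f (apfst (\<lambda>_. q0) (tm_init w))" for w
    by (simp add: tm_init_def f_def)
  moreover have "fst (apfst (\<lambda>_. q0) (tm_init w)) \<in> Q" for w
    using Q by (simp add: tm_init_def)
  ultimately have "tm_run M w n = apfst f ((astep \<delta> qa qr ^^ n) (apfst (\<lambda>_. q0) (tm_init w)))" for w n
    unfolding tm_run_def by metis
  then show thesis
    using that[of M f] wf inj stays by (auto simp: M_def)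
qed


lemma bit_nonzero: "bit (a::nat) j \<Longrightarrow> a \<noteq> 0"
  by (rule notI) simp

context
  fixes K r :: nat and c0 :: cmd
begin

definition mstep :: "ctl \<times> (nat \<Rightarrow> nat) \<times> nat \<Rightarrow> ctl \<times> (nat \<Rightarrow> nat) \<times> nat" where
  "mstep = astep (cdelta K r c0) Acc Rej"

text \<open>The invariant is established backwards: by \<open>good_step\<close> a configuration
  inherits it from its successor, so each instruction is verified relative to an assumption on its
  continuation.\<close>

definition good :: "nat \<Rightarrow> ctl \<Rightarrow> ctl \<times> (nat \<Rightarrow> nat) \<times> nat \<Rightarrow> bool" where
  "good B v c \<longleftrightarrow> (\<exists>n. fst ((mstep ^^ n) c) = v) \<and> (\<forall>n. snd (snd ((mstep ^^ n) c)) \<le> B)"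

lemma good_step:
  assumes "good B v (mstep (q, t, h))" "h \<le> B"
  shows "good B v (q, t, h)"
proof -
  have eq: "(mstep ^^ Suc n) (q, t, h) = (mstep ^^ n) (mstep (q, t, h))" for n
    by (simp only: funpow_Suc_right comp_apply)
  have "snd (snd ((mstep ^^ n) (q, t, h))) \<le> B" for n
    using assms eq by (cases n) (auto simp: good_def simp del: funpow.simps(2))
  moreover have "\<exists>n. fst ((mstep ^^ n) (q, t, h)) = v"
    using assms(1) eq unfolding good_def by metis
  ultimately show ?thesis by (auto simp: good_def)
qed

lemma good_halt:
  assumes "v \<in> {Acc, Rej}" "h \<le> B"
  shows "good B v (v, t, h)"
proof -
  have "(mstep ^^ n) (v, t, h) = (v, t, h)" for n
    using assms(1) by (induction n) (auto simp: mstep_def astep_def)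
  then show ?thesis using assms(2) by (simp add: good_def)
qed

text \<open>The last conjunct makes the used cells an initial segment within the first
  \<open>B\<close> cells: the first blank ends the search for a set bit, since no register has one
  beyond it.\<close>

definition rep :: "nat \<Rightarrow> (nat \<Rightarrow> nat) \<Rightarrow> (nat \<Rightarrow> nat) \<Rightarrow> bool" where
  "rep B s t \<longleftrightarrow> (\<forall>j<K. \<forall>i. bit (t i) j \<longleftrightarrow> bit (s j) i) \<and> (\<forall>i. bit (t i) K \<longleftrightarrow> i = 0)
     \<and> (\<forall>i. t i \<noteq> 0 \<longrightarrow> i < B \<and> (\<forall>i'<i. t i' \<noteq> 0))"

lemma mstep_Run:
  "mstep (Run c, t, h) = (case cdelta K r c0 (Run c) (t h) of (q', a, d) \<Rightarrow> (q', t(h := a), move d h))"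
  "mstep (Back c, t, h) = (case cdelta K r c0 (Back c) (t h) of (q', a, d) \<Rightarrow> (q', t(h := a), move d h))"
  by (auto simp: mstep_def astep_def)

lemma good_back:
  assumes "rep B s t" "good B v (Run c, t, 0)" "h \<le> B"
  shows "good B v (Back c, t, h)"
  using assms(3)
proof (induction h)
  case 0
  have "bit (t 0) K" using assms(1) by (simp add: rep_def)
  then show ?case using assms(2) by (intro good_step) (simp_all add: mstep_Run cdelta_def)
next
  case (Suc h)
  have "\<not> bit (t (Suc h)) K" using assms(1) by (simp add: rep_def)
  then show ?case using Suc by (intro good_step) (simp_all add: mstep_Run cdelta_def)
qed

text \<open>Writing into cell \<open>h\<close> also raises its mark on track \<open>Suc K\<close>;
  as all cells below \<open>h\<close> are in use, the used part stays an initial segment even when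
  \<open>h\<close> was blank.\<close>

lemma rep_upd:
  assumes "rep B (s(x := v)) t" "h < B" "\<forall>i<h. t i \<noteq> 0" "x < K"
    and "\<And>j. bit a j \<longleftrightarrow> (if j = x then b else j = Suc K \<or> bit (t h) j)"
    and "\<And>i. bit v' i \<longleftrightarrow> (if i = h then b else bit v i)"
  shows "rep B (s(x := v')) (t(h := a))"
proof -
  have "a \<noteq> 0" using assms(4) assms(5)[of "Suc K"] by (intro bit_nonzero[of _ "Suc K"]) simp
  then show ?thesis using assms unfolding rep_def
    by (auto simp: nat_neq_iff split: if_splits)
qed

lemma rep_set:
  assumes "rep B (s(x := v)) t" "h < B" "\<forall>i<h. t i \<noteq> 0" "x < K"
  shows "rep B (s(x := set_bit h v)) (t(h := set_bit x (set_bit (Suc K) (t h))))"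
  using assms by (intro rep_upd[where b = True]) (auto simp: bit_simps)

lemma rep_unset:
  assumes "rep B (s(x := v)) t" "h < B" "\<forall>i<h. t i \<noteq> 0" "x < K"
  shows "rep B (s(x := unset_bit h v)) (t(h := unset_bit x (set_bit (Suc K) (t h))))"
  using assms by (intro rep_upd[where b = False]) (auto simp: bit_simps)

lemma rep_bound:
  assumes "rep B s t" "j < K"
  shows "s j < 2 ^ B"
proof -
  have "i < B" if "bit (s j) i" for i
    using assms that unfolding rep_def by (metis bit_0_eq bot_apply bot_bool_def)
  then have "take_bit B (s j) = s j"
    by (intro bit_eqI) (auto simp: bit_take_bit_iff)
  then show ?thesis by (simp add: take_bit_nat_eq_self_iff)
qed

lemma set_bit_nat_add: "\<not> bit (v::nat) h \<Longrightarrow> set_bit h v = v + 2 ^ h"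
  by (simp add: set_bit_eq)

lemma unset_bit_nat_add:
  assumes "bit (v::nat) h"
  shows "unset_bit h v + 2 ^ h = v"
proof -
  have "set_bit h (unset_bit h v) = v"
    using assms by (intro bit_eqI) (auto simp: bit_simps)
  then show ?thesis
    using set_bit_nat_add[of "unset_bit h v" h] by (simp add: bit_simps)
qed

text \<open>Carry propagation: when the head is at cell \<open>h\<close> the track holds \<open>v = Suc a - 2 ^ h\<close>,
  so that adding 1 to the original value amounts to adding \<open>2 ^ h\<close> to the present one.\<close>

lemma good_inc:
  assumes "next_act c = AInc x c'" "x < K" "Suc a < 2 ^ B"
    and cont: "\<And>t h. rep B (s(x := Suc a)) t \<Longrightarrow> h \<le> B \<Longrightarrow> good B V (Back c', t, h)"
  shows "rep B (s(x := v)) t \<Longrightarrow> v + 2 ^ h = Suc a \<Longrightarrow> \<forall>i<h. t i \<noteq> 0 \<Longrightarrow> good B V (Run c, t, h)"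
proof (induction "B - h" arbitrary: h t v rule: less_induct)
  case less
  have "(2::nat) ^ h < 2 ^ B" using less.prems(2) assms(3) by linarith
  then have h: "h < B" by simp
  let ?a = "set_bit (Suc K) (t h)"
  have bit: "bit (t h) x \<longleftrightarrow> bit v h" using less.prems(1) assms(2) by (auto simp: rep_def)
  show ?case
  proof (cases "bit v h")
    case True
    have r: "rep B (s(x := unset_bit h v)) (t(h := unset_bit x ?a))"
      by (rule rep_unset[OF less.prems(1) h less.prems(3) assms(2)])
    have "unset_bit x ?a \<noteq> 0"
      using assms(2) by (intro bit_nonzero[of _ "Suc K"]) (simp add: bit_simps)
    then have nz: "\<forall>i<Suc h. (t(h := unset_bit x ?a)) i \<noteq> 0"
      using less.prems(3) by (auto simp: less_Suc_eq)
    have "unset_bit h v + 2 ^ Suc h = Suc a"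
      using unset_bit_nat_add[OF True] less.prems(2) by simp
    then have "good B V (Run c, t(h := unset_bit x ?a), Suc h)"
      using h by (intro less.hyps[OF _ r _ nz]) simp_all
    then show ?thesis
      using h True bit assms(1) by (intro good_step) (simp_all add: mstep_Run cdelta_def)
  next
    case False
    have "rep B (s(x := set_bit h v)) (t(h := set_bit x ?a))"
      by (rule rep_set[OF less.prems(1) h less.prems(3) assms(2)])
    then have "rep B (s(x := Suc a)) (t(h := set_bit x ?a))"
      using set_bit_nat_add[OF False] less.prems(2) by simp
    then have "good B V (Back c', t(h := set_bit x ?a), h)"
      using cont h by simp
    then show ?thesis
      using h False bit assms(1) by (intro good_step) (simp_all add: mstep_Run cdelta_def)
  qed
qed

text \<open>Borrow propagation: each zero passed has become a one, so at cell \<open>h\<close> the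
  track holds the result plus 2^h. As this value is below 2^B, the head stays below cell
  \<open>B\<close>.\<close>

lemma good_dec:
  assumes "next_act c = ADec x c'" "x < K"
    and cont: "\<And>t h. rep B (s(x := a)) t \<Longrightarrow> h \<le> B \<Longrightarrow> good B V (Back c', t, h)"
  shows "rep B (s(x := v)) t \<Longrightarrow> v = a + 2 ^ h \<Longrightarrow> \<forall>i<h. t i \<noteq> 0 \<Longrightarrow> good B V (Run c, t, h)"
proof (induction "B - h" arbitrary: h t v rule: less_induct)
  case less
  have "v < 2 ^ B" using rep_bound[OF less.prems(1) assms(2)] by simp
  then have "(2::nat) ^ h < 2 ^ B" using less.prems(2) by linarith
  then have h: "h < B" by simp
  let ?a = "set_bit (Suc K) (t h)"
  have bit: "bit (t h) x \<longleftrightarrow> bit v h" using less.prems(1) assms(2) by (auto simp: rep_def)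
  show ?case
  proof (cases "bit v h")
    case True
    have "rep B (s(x := unset_bit h v)) (t(h := unset_bit x ?a))"
      by (rule rep_unset[OF less.prems(1) h less.prems(3) assms(2)])
    then have "rep B (s(x := a)) (t(h := unset_bit x ?a))"
      using unset_bit_nat_add[OF True] less.prems(2) by simp
    then have "good B V (Back c', t(h := unset_bit x ?a), h)"
      using cont h by simp
    then show ?thesis
      using h True bit assms(1) by (intro good_step) (simp_all add: mstep_Run cdelta_def)
  next
    case False
    have r: "rep B (s(x := set_bit h v)) (t(h := set_bit x ?a))"
      by (rule rep_set[OF less.prems(1) h less.prems(3) assms(2)])
    have "set_bit x ?a \<noteq> 0"
      by (intro bit_nonzero[of _ "Suc K"]) (simp add: bit_simps)
    then have nz: "\<forall>i<Suc h. (t(h := set_bit x ?a)) i \<noteq> 0"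
      using less.prems(3) by (auto simp: less_Suc_eq)
    have "set_bit h v = a + 2 ^ Suc h"
      using set_bit_nat_add[OF False] less.prems(2) by simp
    then have "good B V (Run c, t(h := set_bit x ?a), Suc h)"
      using h by (intro less.hyps[OF _ r _ nz]) simp_all
    then show ?thesis
      using h False bit assms(1) by (intro good_step) (simp_all add: mstep_Run cdelta_def)
  qed
qed

text \<open>The targets \<open>q1\<close> and \<open>q2\<close> are left open so that one argument
  serves both the zero test of a loop and the final inspection of the output register. Set bits only
  occur in used cells, so meeting a blank without having seen one means that the register is
  0.\<close>

lemma good_test:
  assumes r: "rep B s t" "x < K"
    and step: "\<And>h. mstep (Run c, t, h) = (if bit (t h) x then (q1, t, h)
                 else if t h = 0 then (q2, t, h) else (Run c, t, Suc h))"
    and cont1: "\<And>h. s x \<noteq> 0 \<Longrightarrow> h \<le> B \<Longrightarrow> good B V (q1, t, h)"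
    and cont2: "\<And>h. s x = 0 \<Longrightarrow> h \<le> B \<Longrightarrow> good B V (q2, t, h)"
  shows "h \<le> B \<Longrightarrow> \<forall>i<h. \<not> bit (s x) i \<Longrightarrow> good B V (Run c, t, h)"
proof (induction "B - h" arbitrary: h rule: less_induct)
  case less
  have bit: "bit (t i) x \<longleftrightarrow> bit (s x) i" for i using r by (auto simp: rep_def)
  show ?case
  proof (cases "bit (s x) h")
    case True
    then have "s x \<noteq> 0" by (rule bit_nonzero)
    then show ?thesis using less.prems True bit cont1 by (intro good_step) (simp_all add: step)
  next
    case nb: False
    show ?thesis
    proof (cases "t h = 0")
      case True
      then have "t i = 0" if "h \<le> i" for i
        using r(1) that unfolding rep_def by (metis le_neq_implies_less)
      then have "\<not> bit (s x) i" for i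
        using bit[of i] less.prems(2) by (cases "i < h") auto
      then have "s x = 0" by (intro bit_eqI) auto
      then show ?thesis using less.prems True bit cont2 by (intro good_step) (simp_all add: step)
    next
      case False
      then have h: "h < B" using r(1) by (auto simp: rep_def)
      have "good B V (Run c, t, Suc h)"
        using less.hyps[of "Suc h"] less.prems nb h by (auto simp: less_Suc_eq)
      then show ?thesis using h False bit nb by (intro good_step) (simp_all add: step)
    qed
  qed
qed

lemma good_csteps:
  assumes "(cstep (2 ^ B))\<^sup>*\<^sup>* (c, s) (c', s')" "next_act c' = Halt" "r < K" "regs c \<subseteq> {..<K}" "rep B s t"
  shows "good B (if s' r \<noteq> 0 then Acc else Rej) (Run c, t, 0)"
  using assms(1,4,5)
proof (induction "(c, s)" arbitrary: c s t rule: converse_rtranclp_induct)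
  case base
  show ?case
    using assms(2) base(2)
    by (intro good_test[of B s' t r, OF base(2) assms(3)])
       (auto simp: mstep_Run cdelta_def intro!: good_halt)
next
  case (step p)
  have regs: "x < K" if "x \<in> act_regs (next_act c)" for x
    using that act_regs_subset[of c] step.prems(1) by auto
  have succ: "regs c2 \<subseteq> {..<K}" if "c2 \<in> succs (next_act c)" for c2
    using that regs_residuals[of c2 c] succs_residuals[OF self_residual, of c] step.prems(1) by auto
  have run: "good B (if s' r \<noteq> 0 then Acc else Rej) (Back c2, t2, h)"
    if "p = (c2, s2)" "c2 \<in> succs (next_act c)" "rep B s2 t2" "h \<le> B" for c2 s2 t2 h
    using that by (intro good_back[of B s2 t2] step.hyps(3)) (use succ in auto)
  from step.hyps(1) show ?case
  proof (cases rule: cstep.cases)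
    case (1 x c2)
    show ?thesis
      by (intro good_inc[OF 1(2) _ 1(3), where v = "s x" and s = s])
         (use 1 regs step.prems run in auto)
  next
    case (2 x c2 v)
    have "s(x := Suc v) = s" using 2 by auto
    then show ?thesis
      by (intro good_dec[OF 2(2), where v = "s x" and s = s and a = v])
         (use 2 regs step.prems run in auto)
  next
    case (3 x c1 c2)
    show ?thesis
      by (rule good_test[OF step.prems(2), where x = x and ?q1.0 = "Back c1" and ?q2.0 = "Back c2"])
         (use 3 regs step.prems run in \<open>auto simp: mstep_Run cdelta_def\<close>)
  next
    case (4 x c1 c2)
    show ?thesis
      by (rule good_test[OF step.prems(2), where x = x and ?q1.0 = "Back c1" and ?q2.0 = "Back c2"])
         (use 4 regs step.prems run in \<open>auto simp: mstep_Run cdelta_def\<close>)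
  qed
qed

end

section \<open>Input words as initial registers, and the polynomial space bound\<close>

definition plane :: "nat list \<Rightarrow> nat \<Rightarrow> nat" where
  "plane w j = horner_sum of_bool 2 (map (\<lambda>x. bit x j) w)"

definition init_regs :: "nat list \<Rightarrow> nat \<Rightarrow> nat" where
  "init_regs w j = (if j < 4 then plane w j else 0)"

lemma bit_plane: "bit (plane w j) i \<longleftrightarrow> i < length w \<and> bit (w ! i) j"
  by (auto simp: plane_def bit_simps)

lemma bit_letter:
  assumes "x \<in> {1..15::nat}" "4 \<le> j"
  shows "\<not> bit x j"
proof
  assume "bit x j"
  then have "2 ^ j \<le> x" using unset_bit_nat_add by (metis le_add2)
  moreover have "(2::nat) ^ 4 \<le> 2 ^ j" using assms(2) by (intro power_increasing) auto
  ultimately show False using assms(1) by simp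
qed

definition poly_bounded :: "(nat \<Rightarrow> nat) \<Rightarrow> bool" where
  "poly_bounded q \<longleftrightarrow> (\<exists>c d. \<forall>m. q m \<le> c * (m + 1) ^ d)"

lemma set_bit_less:
  assumes "a < 2 ^ n" "j < n"
  shows "set_bit j (a::nat) < 2 ^ n"
proof -
  have "take_bit n (set_bit j a) = set_bit j (take_bit n a)"
    using assms by (simp add: take_bit_set_bit_eq)
  then show ?thesis using assms by (simp add: take_bit_nat_eq_self_iff flip: take_bit_nat_eq_self_iff)
qed

lemma unset_bit_less:
  assumes "a < 2 ^ n"
  shows "unset_bit j (a::nat) < 2 ^ n"
proof (cases "bit a j")
  case True
  then show ?thesis using unset_bit_nat_add[OF True] assms by linarith
next
  case False
  then have "unset_bit j a = a" by (intro bit_eqI) (auto simp: bit_simps)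
  then show ?thesis using assms by simp
qed

theorem PSPACE_of_while:
  assumes q: "poly_bounded q"
    and prog: "\<And>w. w \<in> lists {1..15} \<Longrightarrow> \<exists>s. big (2 ^ q (length w)) c (init_regs w) s \<and> (s r \<noteq> 0 \<longleftrightarrow> w \<in> L)"
  shows "in_PSPACE {1..15} L"
proof -
  define K where "K = Suc (Max (insert r (insert 3 (regs c))))"
  have K: "x < K" if "x \<in> insert r (insert 3 (regs c))" for x
    using that finite_regs[of c] unfolding K_def by (intro le_imp_less_Suc Max_ge) auto
  have "3 < K" by (rule K) simp
  then have "4 \<le> K" by simp
  then have rK: "r < K" "4 \<le> K" "regs c \<subseteq> {..<K}" using K by auto
  \<comment> \<open>One bit for each of the tracks 0 to \<open>Suc K\<close>.\<close>
  define S :: nat where "S = 2 ^ Suc (Suc K)"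
  define Q where "Q = {Begin, Acc, Rej} \<union> Run ` residuals c \<union> Back ` residuals c"
  let ?d = "cdelta K r c"
  have closed: "fst (?d q a) \<in> Q" if q: "q \<in> Q" for q a
  proof -
    have mem: "Run c' \<in> Q" "Back c' \<in> Q" if "c' \<in> residuals c" for c'
      using that by (auto simp: Q_def)
    consider "q \<in> {Begin, Acc, Rej}" | c' where "q = Run c'" "c' \<in> residuals c"
      | c' where "q = Back c'" "c' \<in> residuals c"
      using q by (auto simp: Q_def)
    then show ?thesis
    proof cases
      case 1
      then show ?thesis using mem(1)[OF self_residual] by (auto simp: cdelta_def Q_def)
    next
      case 2
      have "Acc \<in> Q" "Rej \<in> Q" by (auto simp: Q_def)
      moreover have "Run c'' \<in> Q \<and> Back c'' \<in> Q" if "c'' \<in> succs (next_act c')" for c''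
        using succs_residuals[OF 2(2)] that mem by auto
      ultimately show ?thesis using 2 mem by (cases "next_act c'") (auto simp: cdelta_def)
    next
      case 3
      then show ?thesis using mem by (auto simp: cdelta_def)
    qed
  qed
  have syms: "fst (snd (?d q a)) < S" if "q \<in> Q" "a < S" for q a
  proof -
    have "x < K" if "c' \<in> residuals c" "x \<in> act_regs (next_act c')" for c' x
      using that act_regs_subset[of c'] regs_residuals[of c' c] rK by auto
    then have "x < Suc (Suc K)" if "c' \<in> residuals c" "x \<in> act_regs (next_act c')" for c' x
      using that less_SucI by blast
    then show ?thesis
      using that unfolding Q_def cdelta_def S_def
      by (auto simp del: power_Suc split: act.split intro!: set_bit_less unset_bit_less)
  qed
  have "finite Q" "Begin \<in> Q" "Acc \<in> Q" "Rej \<in> Q" "Acc \<noteq> Rej" "0 < S"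
    by (auto simp: Q_def S_def finite_residuals)
  from tm_of_abstract[where \<delta> = ?d, OF this(1-5) closed syms this(6)]
  obtain M f where M: "wf_tm M" "tm_syms M = S" "inj_on f Q" "tm_acc M = f Acc" "tm_rej M = f Rej"
    and run: "\<And>w n. tm_run M w n = apfst f ((astep ?d Acc Rej ^^ n) (apfst (\<lambda>_. Begin) (tm_init w)))"
    and inQ: "\<And>p n. fst p \<in> Q \<Longrightarrow> fst ((astep ?d Acc Rej ^^ n) p) \<in> Q"
    by metis
  \<comment> \<open>Cells for registers of \<open>q n\<close> bits and for the n letters of the
    input; the extra one is cell 0, which is marked even when the input is empty.\<close>
  define B where "B n = q n + n + 1" for n
  have good: "good K r c (B (length w)) (if w \<in> L then Acc else Rej) (apfst (\<lambda>_. Begin) (tm_init w))"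
    if w: "w \<in> lists {1..15}" for w
  proof -
    define t where "t = (\<lambda>i. if i < length w then w ! i else 0)"
    let ?B = "B (length w)" and ?t = "t(0 := set_bit K (set_bit (Suc K) (t 0)))"
    obtain s where s: "big (2 ^ q (length w)) c (init_regs w) s" "s r \<noteq> 0 \<longleftrightarrow> w \<in> L"
      using prog[OF w] by blast
    have "big (2 ^ ?B) c (init_regs w) s"
      by (rule big_mono[OF s(1)], rule power_increasing) (auto simp: B_def)
    then obtain c' where c': "next_act c' = Halt" "(cstep (2 ^ ?B))\<^sup>*\<^sup>* (c, init_regs w) (c', s)"
      using big_csteps by blast
    have letter: "w ! i \<in> {1..15}" if "i < length w" for i
      using w that by (auto simp: in_lists_conv_set)
    have t: "bit (t i) j \<longleftrightarrow> bit (init_regs w j) i" for i j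
      using letter bit_letter[of "w ! i" j] by (auto simp: t_def init_regs_def bit_plane)
    have "?t 0 \<noteq> 0" using bit_nonzero[of "?t 0" K] by (simp add: bit_simps)
    moreover have "t i \<noteq> 0 \<longleftrightarrow> i < length w" for i
      using letter[of i] by (auto simp: t_def)
    ultimately have "rep K ?B (init_regs w) ?t"
      using t rK(2) unfolding rep_def by (auto simp: bit_simps init_regs_def B_def split: if_splits)
    then have "good K r c ?B (if s r \<noteq> 0 then Acc else Rej) (Run c, ?t, 0)"
      by (rule good_csteps[OF c'(2,1) rK(1,3)])
    then have "good K r c ?B (if w \<in> L then Acc else Rej) (Begin, t, 0)"
      using s(2) by (intro good_step) (simp_all add: mstep_def astep_def cdelta_def)
    then show ?thesis by (simp add: tm_init_def t_def)
  qed
  obtain k d where kd: "q n \<le> k * (n + 1) ^ d" for n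
    using q by (auto simp: poly_bounded_def)
  \<comment> \<open>The required bound is in powers of n, not of n + 1: for n > 0 the latter is at
    most 2 * n, and for n = 0 the additive constant suffices. The exponent is raised to
    \<open>Suc d\<close> so that the linear part of \<open>B\<close> is absorbed as well.\<close>
  define e where "e = (k + 1) * 2 ^ Suc d"
  have Bn: "B n \<le> e * n ^ Suc d + e" for n
  proof -
    have "B n \<le> k * (n + 1) ^ d + (n + 1)" using kd[of n] by (simp add: B_def)
    also have "\<dots> \<le> k * (n + 1) ^ Suc d + (n + 1) ^ Suc d"
      by (intro add_mono mult_left_mono power_increasing self_le_power) auto
    also have "\<dots> = (k + 1) * (n + 1) ^ Suc d" by simp
    also have "(n + 1) ^ Suc d \<le> 2 ^ Suc d * n ^ Suc d + 2 ^ Suc d"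
    proof (cases "n = 0")
      case False
      then have "(n + 1) ^ Suc d \<le> (2 * n) ^ Suc d" by (intro power_mono) auto
      then show ?thesis by (simp only: power_mult_distrib trans_le_add1)
    qed simp
    then have "(k + 1) * (n + 1) ^ Suc d \<le> (k + 1) * (2 ^ Suc d * n ^ Suc d + 2 ^ Suc d)"
      by (rule mult_left_mono) simp
    also have "\<dots> = e * n ^ Suc d + e" by (simp only: e_def distrib_left mult.assoc)
    finally show ?thesis .
  qed
  show ?thesis
    unfolding in_PSPACE_def
  proof (rule exI[of _ M], rule exI[of _ e], rule exI[of _ "Suc d"], intro conjI ballI)
    show "wf_tm M" by fact
    have "(2::nat) ^ 6 \<le> S" unfolding S_def using rK(2) by (intro power_increasing) auto
    then show "{1..15} \<subseteq> {1..<tm_syms M}" using M(2) by auto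
    fix w :: "nat list" assume w: "w \<in> lists {1..15}"
    define v where "v = (if w \<in> L then Acc else Rej)"
    let ?p = "\<lambda>n. (astep ?d Acc Rej ^^ n) (apfst (\<lambda>_. Begin) (tm_init w))"
    have inq: "fst (?p n) \<in> Q" for n
      by (rule inQ) (simp add: Q_def tm_init_def)
    have fv: "fst (tm_run M w n) = f q \<longleftrightarrow> fst (?p n) = q" if "q \<in> Q" for n q
      using inq[of n] that M(3) by (auto simp: run inj_on_eq_iff)
    have g: "\<exists>n. fst (?p n) = v" "\<forall>n. snd (snd (?p n)) \<le> B (length w)"
      using good[OF w] unfolding good_def mstep_def v_def by simp_all
    have vQ: "v \<in> Q" "f v \<in> {tm_acc M, tm_rej M}" using M by (auto simp: v_def Q_def)
    then show "\<exists>n. fst (tm_run M w n) \<in> {tm_acc M, tm_rej M}"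
      using g(1) fv by metis
    \<comment> \<open>Halting states are final, so a run that reaches \<open>Rej\<close> never
      visits \<open>Acc\<close>.\<close>
    have stop: "?p (n + m) = ?p n" if "fst (?p n) \<in> {Acc, Rej}" for n m
    proof (induction m)
      case (Suc m)
      have "?p (n + Suc m) = astep ?d Acc Rej (?p (n + m))" by simp
      also have "\<dots> = ?p n" using Suc that by (auto simp: astep_def split: prod.splits)
      finally show ?case .
    qed simp
    have "\<not> (\<exists>n. fst (?p n) = Acc)" if "w \<notin> L"
    proof
      assume "\<exists>n. fst (?p n) = Acc"
      then obtain n where n: "fst (?p n) = Acc" by blast
      obtain n' where "fst (?p n') = v" using g(1) by blast
      then have "fst (?p n') = Rej" using \<open>w \<notin> L\<close> by (simp add: v_def)
      with n stop[of n n'] stop[of n' n] show False by (simp add: add.commute)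
    qed
    moreover have "\<exists>n. fst (?p n) = Acc" if "w \<in> L" using that g(1) by (simp add: v_def)
    moreover have "Acc \<in> Q" by (simp add: Q_def)
    ultimately show "(\<exists>n. fst (tm_run M w n) = tm_acc M) \<longleftrightarrow> w \<in> L"
      using fv M(4) by auto
    show "\<forall>n. snd (snd (tm_run M w n)) \<le> e * length w ^ Suc d + e"
      using g(2) Bn[of "length w"] by (auto simp: run simp del: power_Suc intro: le_trans)
  qed
qed

section \<open>Functions computable in polynomial space\<close>


lemma poly_bounded_const: "poly_bounded (\<lambda>m. a)"
  unfolding poly_bounded_def by (intro exI[of _ a] exI[of _ 0]) simp

lemma poly_bounded_id: "poly_bounded (\<lambda>m. m)"
  unfolding poly_bounded_def by (intro exI[of _ 1]) simp

lemma poly_bounded_add: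
  assumes "poly_bounded p" "poly_bounded q"
  shows "poly_bounded (\<lambda>m. p m + q m)"
proof -
  obtain a b c d where ab: "\<And>m. p m \<le> a * (m + 1) ^ b" and cd: "\<And>m. q m \<le> c * (m + 1) ^ d"
    using assms unfolding poly_bounded_def by blast
  have "p m + q m \<le> (a + c) * (m + 1) ^ (b + d)" for m
  proof -
    have "a * (m + 1) ^ b \<le> a * (m + 1) ^ (b + d)" "c * (m + 1) ^ d \<le> c * (m + 1) ^ (b + d)"
      by (intro mult_left_mono power_increasing; simp)+
    then show ?thesis using ab[of m] cd[of m] unfolding distrib_right by linarith
  qed
  then show ?thesis unfolding poly_bounded_def by blast
qed

lemma poly_bounded_mult:
  assumes "poly_bounded p" "poly_bounded q"
  shows "poly_bounded (\<lambda>m. p m * q m)"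
proof -
  obtain a b c d where ab: "\<And>m. p m \<le> a * (m + 1) ^ b" and cd: "\<And>m. q m \<le> c * (m + 1) ^ d"
    using assms unfolding poly_bounded_def by blast
  have "p m * q m \<le> (a * c) * (m + 1) ^ (b + d)" for m
    using mult_mono[OF ab[of m] cd[of m]] by (simp add: power_add mult_ac)
  then show ?thesis unfolding poly_bounded_def by blast
qed

lemma poly_bounded_compose:
  assumes "poly_bounded p" "poly_bounded q"
  shows "poly_bounded (\<lambda>m. p (q m))"
proof -
  obtain a b c d where ab: "\<And>m. p m \<le> a * (m + 1) ^ b" and cd: "\<And>m. q m \<le> c * (m + 1) ^ d"
    using assms unfolding poly_bounded_def by blast
  have "p (q m) \<le> (a * (c + 1) ^ b) * (m + 1) ^ (d * b)" for m
  proof -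
    have "1 \<le> (m + 1) ^ d" by simp
    then have "q m + 1 \<le> (c + 1) * (m + 1) ^ d" using cd[of m] unfolding distrib_right by linarith
    then have "a * (q m + 1) ^ b \<le> a * ((c + 1) * (m + 1) ^ d) ^ b"
      by (intro mult_left_mono power_mono) auto
    also have "\<dots> = (a * (c + 1) ^ b) * (m + 1) ^ (d * b)"
      by (simp only: power_mult_distrib power_mult mult.assoc)
    finally show ?thesis using ab[of "q m"] by (rule order_trans[rotated])
  qed
  then show ?thesis unfolding poly_bounded_def by blast
qed

lemmas poly_bounded_intros =
  poly_bounded_const poly_bounded_id poly_bounded_add poly_bounded_mult

text \<open>A register exceeds its initial value only through increments, each of which ends below
  the bound. Hence a program that computes a function also bounds its values, which is how
  \<open>psbounded\<close> follows from \<open>pscomp\<close>.\<close>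

lemma big_result: "big B c s s' \<Longrightarrow> s' x \<le> s x \<or> s' x < B"
  by (induction rule: big.induct) auto

lemma big_While_iter:
  assumes "\<And>j. j < n \<Longrightarrow> \<sigma> j x \<noteq> 0 \<and> big B c (\<sigma> j) (\<sigma> (Suc j))" "\<sigma> n x = 0"
  shows "big B (While x c) (\<sigma> 0) (\<sigma> n)"
  using assms
proof (induction n arbitrary: \<sigma>)
  case 0
  then show ?case by (simp add: big_WhileF)
next
  case (Suc n)
  have "big B (While x c) (\<sigma> (Suc 0)) (\<sigma> (Suc n))"
    using Suc.IH[of "\<lambda>j. \<sigma> (Suc j)"] Suc.prems by simp
  then show ?case using Suc.prems(1)[of 0] by (blast intro: big_WhileT)
qed

lemma big_clear: "big B (While x (Dec x)) s (s(x := 0))"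
proof -
  have "big B (While x (Dec x)) ((\<lambda>j. s(x := s x - j)) 0) ((\<lambda>j. s(x := s x - j)) (s x))"
  proof (rule big_While_iter)
    fix j assume "j < s x"
    then show "(s(x := s x - j)) x \<noteq> 0 \<and> big B (Dec x) (s(x := s x - j)) (s(x := s x - Suc j))"
      using big_Dec[of "s(x := s x - j)" x "s x - Suc j" B] by (simp add: Suc_diff_Suc)
  qed simp
  then show ?thesis by simp
qed

lemma big_move:
  assumes "a \<noteq> b" "s a + s b < B"
  shows "big B (While a (Seq (Dec a) (Inc b))) s (s(a := 0, b := s b + s a))"
proof -
  let ?\<sigma> = "\<lambda>j. s(a := s a - j, b := s b + j)"
  have "big B (While a (Seq (Dec a) (Inc b))) (?\<sigma> 0) (?\<sigma> (s a))"
  proof (rule big_While_iter)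
    fix j assume j: "j < s a"
    have "big B (Dec a) (?\<sigma> j) ((?\<sigma> j)(a := s a - Suc j))"
      using j assms by (intro big_Dec) simp
    moreover have "big B (Inc b) ((?\<sigma> j)(a := s a - Suc j)) (?\<sigma> (Suc j))"
      using big_Inc[of "(?\<sigma> j)(a := s a - Suc j)" b B] j assms by (simp add: fun_upd_twist)
    ultimately show "?\<sigma> j a \<noteq> 0 \<and> big B (Seq (Dec a) (Inc b)) (?\<sigma> j) (?\<sigma> (Suc j))"
      using j assms by (auto intro: big_Seq)
  qed (use assms in simp)
  then show ?thesis by simp
qed

text \<open>A counter can only be read by counting it down, so a second copy is made in
  \<open>k\<close> and moved back.\<close>

lemma big_copy:
  assumes "distinct [x, r, k]" "s r = 0" "s k = 0" "s x < B"
  shows "big B (Seq (While x (Seq (Dec x) (Seq (Inc r) (Inc k)))) (While k (Seq (Dec k) (Inc x))))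
    s (s(r := s x))"
proof -
  let ?\<sigma> = "\<lambda>j. s(x := s x - j, r := j, k := j)"
  have "big B (While x (Seq (Dec x) (Seq (Inc r) (Inc k)))) (?\<sigma> 0) (?\<sigma> (s x))"
  proof (rule big_While_iter)
    fix j assume j: "j < s x"
    let ?s1 = "(?\<sigma> j)(x := s x - Suc j)"
    have "big B (Dec x) (?\<sigma> j) ?s1"
      using j assms by (intro big_Dec) simp
    moreover have "big B (Inc r) ?s1 (?s1(r := Suc j))"
      using big_Inc[of ?s1 r B] j assms by simp
    moreover have "big B (Inc k) (?s1(r := Suc j)) (?\<sigma> (Suc j))"
      using big_Inc[of "?s1(r := Suc j)" k B] j assms by (simp add: fun_upd_twist)
    ultimately show "?\<sigma> j x \<noteq> 0 \<and> big B (Seq (Dec x) (Seq (Inc r) (Inc k))) (?\<sigma> j) (?\<sigma> (Suc j))"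
      using j assms by (auto intro: big_Seq)
  qed (use assms in simp)
  moreover have "?\<sigma> 0 = s" using assms by auto
  moreover have "big B (While k (Seq (Dec k) (Inc x))) (?\<sigma> (s x)) (s(r := s x))"
  proof -
    have "(?\<sigma> (s x))(k := 0, x := s x) = s(r := s x)" using assms by (auto simp: fun_eq_iff)
    then show ?thesis using big_move[of k x "?\<sigma> (s x)" B] assms by simp
  qed
  ultimately show ?thesis by (auto intro: big_Seq)
qed

section \<open>Functions given by programs that work for every placement of the registers\<close>

type_synonym env = "nat \<Rightarrow> nat"

abbreviation words :: "nat list set" where
  "words \<equiv> lists {1..15}"

definition computes :: "nat \<Rightarrow> (nat \<Rightarrow> nat) \<Rightarrow> (nat list \<Rightarrow> env \<Rightarrow> nat) \<Rightarrow>
    (nat \<Rightarrow> nat) \<Rightarrow> nat \<Rightarrow> nat \<Rightarrow> cmd \<Rightarrow> bool" where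
  "computes N q F \<rho> r k c \<longleftrightarrow> (\<forall>w\<in>words. \<forall>s m. length w \<le> m \<longrightarrow> (\<forall>j<4. s j = plane w j) \<longrightarrow> s r = 0 \<longrightarrow>
     (\<forall>j\<ge>k. s j = 0) \<longrightarrow> (\<forall>i<N. s (\<rho> i) < 2 ^ m) \<longrightarrow>
     big (2 ^ q m) c s (s(r := F w (\<lambda>i. s (\<rho> i)))))"

definition depends :: "nat \<Rightarrow> (nat list \<Rightarrow> env \<Rightarrow> nat) \<Rightarrow> bool" where
  "depends N F \<longleftrightarrow> (\<forall>w\<in>words. \<forall>e e'. (\<forall>i<N. e i = e' i) \<longrightarrow> F w e = F w e')"

text \<open>The functions computed in polynomial space: \<open>w\<close> is the input word and \<open>e\<close> a list of further
  arguments, which count as part of the input of size \<open>m\<close> if they are below \<open>2 ^ m\<close>. A program finds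
  the arguments in the registers \<open>\<rho> i\<close>, writes its result to \<open>r\<close>, and uses (and cleans up) the
  registers from \<open>k\<close> on as its workspace.\<close>

definition pscomp :: "(nat list \<Rightarrow> env \<Rightarrow> nat) \<Rightarrow> bool" where
  "pscomp F \<longleftrightarrow> (\<exists>N q. poly_bounded q \<and> depends N F \<and>
     (\<forall>\<rho> r k. 4 \<le> r \<longrightarrow> r < k \<longrightarrow> (\<forall>i<N. \<rho> i < k \<and> \<rho> i \<noteq> r) \<longrightarrow> (\<exists>c. computes N q F \<rho> r k c)))"

text \<open>The existence of a program turned into a function of the register placement, so that
  composite programs can name the programs of their parts.\<close>

definition computes_family :: "nat \<Rightarrow> (nat \<Rightarrow> nat) \<Rightarrow> (nat list \<Rightarrow> env \<Rightarrow> nat) \<Rightarrow>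
    ((nat \<Rightarrow> nat) \<Rightarrow> nat \<Rightarrow> nat \<Rightarrow> cmd) \<Rightarrow> bool" where
  "computes_family N q F C \<longleftrightarrow> (\<forall>\<rho> r k. 4 \<le> r \<longrightarrow> r < k \<longrightarrow> (\<forall>i<N. \<rho> i < k \<and> \<rho> i \<noteq> r) \<longrightarrow>
     computes N q F \<rho> r k (C \<rho> r k))"

lemma pscompE:
  assumes "pscomp F"
  obtains N q C where "poly_bounded q" "depends N F" "computes_family N q F C"
proof -
  obtain N q where "poly_bounded q" "depends N F" and
    *: "\<And>\<rho> r k. 4 \<le> r \<Longrightarrow> r < k \<Longrightarrow> (\<forall>i<N. \<rho> i < k \<and> \<rho> i \<noteq> r) \<Longrightarrow> \<exists>c. computes N q F \<rho> r k c"
    using assms unfolding pscomp_def by blast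
  then show thesis
    by (intro that[of q N "\<lambda>\<rho> r k. SOME c. computes N q F \<rho> r k c"])
       (auto simp: computes_family_def intro: someI_ex[OF *])
qed

lemma computes_familyD:
  assumes "computes_family N q F C" "4 \<le> r" "r < k" "\<And>i. i < N \<Longrightarrow> \<rho> i < k \<and> \<rho> i \<noteq> r"
  shows "computes N q F \<rho> r k (C \<rho> r k)"
  using assms unfolding computes_family_def by blast

lemma pscompI:
  assumes "poly_bounded q" "depends N F"
    "\<And>\<rho> r k. 4 \<le> r \<Longrightarrow> r < k \<Longrightarrow> (\<And>i. i < N \<Longrightarrow> \<rho> i < k \<and> \<rho> i \<noteq> r) \<Longrightarrow> \<exists>c. computes N q F \<rho> r k c"
  shows "pscomp F"
  using assms unfolding pscomp_def by blast

lemma computesD: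
  assumes "computes N q F \<rho> r k c" "w \<in> words" "length w \<le> m" "\<And>j. j < 4 \<Longrightarrow> s j = plane w j" "s r = 0"
    "\<And>j. k \<le> j \<Longrightarrow> s j = 0" "\<And>i. i < N \<Longrightarrow> s (\<rho> i) < 2 ^ m" "q m \<le> b" "F w (\<lambda>i. s (\<rho> i)) = v"
  shows "big (2 ^ b) c s (s(r := v))"
  using assms unfolding computes_def
  by (auto intro!: big_mono[of "2 ^ q m" _ _ _ "2 ^ b"])

lemma dependsD:
  "depends N F \<Longrightarrow> w \<in> words \<Longrightarrow> (\<And>i. i < N \<Longrightarrow> e i = e' i) \<Longrightarrow> F w e = F w e'"
  unfolding depends_def by blast

definition psbounded :: "(nat list \<Rightarrow> env \<Rightarrow> nat) \<Rightarrow> bool" where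
  "psbounded F \<longleftrightarrow> (\<exists>N q. poly_bounded q \<and> (\<forall>w\<in>words. \<forall>e m. length w \<le> m \<longrightarrow>
     (\<forall>i<N. e i < 2 ^ m) \<longrightarrow> F w e < 2 ^ q m))"

lemma pscomp_psbounded_aux:
  assumes "poly_bounded q" "depends N F" "computes N q F (\<lambda>i. i + 5) 4 (N + 5) c"
    "w \<in> words" "length w \<le> m" "\<And>i. i < N \<Longrightarrow> e i < 2 ^ m"
  shows "F w e < 2 ^ q m"
proof -
  let ?s = "\<lambda>j. if j < 4 then plane w j else if 5 \<le> j \<and> j < N + 5 then e (j - 5) else 0"
  have "F w (\<lambda>i. ?s (i + 5)) = F w e" by (rule dependsD[OF assms(2,4)]) simp
  then have "big (2 ^ q m) c ?s (?s(4 := F w e))"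
    using assms by (intro computesD[OF assms(3,4,5)]) auto
  from big_result[OF this, of 4] show ?thesis by (auto simp: Suc_le_eq)
qed

lemma pscomp_psbounded:
  assumes "pscomp F"
  shows "psbounded F"
proof -
  obtain N q C where F: "poly_bounded q" "depends N F"
    "computes_family N q F C"
    using pscompE[OF assms] by blast
  have "computes N q F (\<lambda>i. i + 5) 4 (N + 5) (C (\<lambda>i. i + 5) 4 (N + 5))"
    by (rule computes_familyD[OF F(3)]) auto
  from pscomp_psbounded_aux[OF F(1,2) this] show ?thesis
    unfolding psbounded_def using F(1) by blast
qed

lemma pscomp_cong:
  assumes "pscomp F" "\<And>w e. w \<in> words \<Longrightarrow> F w e = G w e"
  shows "pscomp G"
  using assms unfolding pscomp_def depends_def computes_def by simp

lemma pscomp_zero: "pscomp (\<lambda>w e. 0)"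
proof (rule pscompI[of "\<lambda>m. m" 0])
  have "computes 0 (\<lambda>m. m) (\<lambda>w e. 0) \<rho> r k Skip" for \<rho> r k
    unfolding computes_def by (auto simp: fun_upd_idem big_Skip)
  then show "\<exists>c. computes 0 (\<lambda>m. m) (\<lambda>w e. 0) \<rho> r k c" for \<rho> r k by blast
qed (auto simp: depends_def poly_bounded_intros)

lemma pscomp_var: "pscomp (\<lambda>w e. e i)"
proof (rule pscompI[of "\<lambda>m. m" "Suc i"])
  fix \<rho> :: "nat \<Rightarrow> nat" and r k
  assume "4 \<le> r" "r < k" and \<rho>: "\<And>j. j < Suc i \<Longrightarrow> \<rho> j < k \<and> \<rho> j \<noteq> r"
  have "\<rho> i < k \<and> \<rho> i \<noteq> r" by (rule \<rho>) simp
  with \<open>r < k\<close> have "distinct [\<rho> i, r, k]" by auto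
  then show "\<exists>c. computes (Suc i) (\<lambda>m. m) (\<lambda>w e. e i) \<rho> r k c"
    unfolding computes_def using big_copy by (metis lessI order_refl)
qed (auto simp: depends_def poly_bounded_intros)

lemma plane_less: "plane w j < 2 ^ length w"
  by (simp add: plane_def horner_sum_of_bool_2_less[of "map (\<lambda>x. bit x j) w", simplified])

lemma pscomp_plane:
  assumes "j < 4"
  shows "pscomp (\<lambda>w e. plane w j)"
proof (rule pscompI[of "\<lambda>m. m" 0])
  fix \<rho> :: "nat \<Rightarrow> nat" and r k :: nat assume "4 \<le> r" "r < k"
  then have d: "distinct [j, r, k]" using assms by auto
  let ?c = "Seq (While j (Seq (Dec j) (Seq (Inc r) (Inc k)))) (While k (Seq (Dec k) (Inc j)))"
  have "big (2 ^ m) ?c s (s(r := plane w j))"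
    if "length w \<le> m" "\<forall>j<4. s j = plane w j" "s r = 0" "\<forall>j\<ge>k. s j = 0" for w s m
  proof -
    have "plane w j < 2 ^ m"
      using plane_less[of w j] power_increasing[OF that(1), of "2::nat"] by linarith
    moreover have "s j = plane w j" "s k = 0" using that assms by auto
    ultimately show ?thesis using big_copy[OF d, of s "2 ^ m"] that by simp
  qed
  then show "\<exists>c. computes 0 (\<lambda>m. m) (\<lambda>w e. plane w j) \<rho> r k c"
    unfolding computes_def by blast
qed (auto simp: depends_def poly_bounded_intros)

lemma pscomp_rename:
  assumes "pscomp F"
  shows "pscomp (\<lambda>w e. F w (\<lambda>i. e (\<sigma> i)))"
proof -
  obtain N q C where F: "poly_bounded q" "depends N F"
    "computes_family N q F C"
    using pscompE[OF assms] by blast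
  define N' where "N' = Suc (Max (insert 0 (\<sigma> ` {..<N})))"
  have \<sigma>: "\<sigma> i < N'" if "i < N" for i
    unfolding N'_def using that by (intro le_imp_less_Suc Max_ge) auto
  show ?thesis
  proof (rule pscompI[OF F(1), of N'])
    show "depends N' (\<lambda>w e. F w (\<lambda>i. e (\<sigma> i)))"
      using \<sigma> F(2) by (auto simp: depends_def)
    fix \<rho> :: "nat \<Rightarrow> nat" and r k
    assume "4 \<le> r" "r < k" and \<rho>: "\<And>j. j < N' \<Longrightarrow> \<rho> j < k \<and> \<rho> j \<noteq> r"
    then have "computes N q F (\<lambda>i. \<rho> (\<sigma> i)) r k (C (\<lambda>i. \<rho> (\<sigma> i)) r k)"
      by (intro computes_familyD[OF F(3)]) (auto simp: \<sigma>)
    then have "computes N' q (\<lambda>w e. F w (\<lambda>i. e (\<sigma> i))) \<rho> r k (C (\<lambda>i. \<rho> (\<sigma> i)) r k)"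
      unfolding computes_def using \<sigma> by auto
    then show "\<exists>c. computes N' q (\<lambda>w e. F w (\<lambda>i. e (\<sigma> i))) \<rho> r k c" by blast
  qed
qed

lemma pscomp_Suc:
  assumes "pscomp F"
  shows "pscomp (\<lambda>w e. Suc (F w e))"
proof -
  obtain N q C where F: "poly_bounded q" "depends N F"
    "computes_family N q F C"
    using pscompE[OF assms] by blast
  let ?q = "\<lambda>m. q m + 1"
  have less: "F w e < 2 ^ q m" if "w \<in> words" "length w \<le> m" "\<And>i. i < N \<Longrightarrow> e i < 2 ^ m" for w m e
    by (rule pscomp_psbounded_aux[OF F(1,2) computes_familyD[OF F(3)]]) (use that in auto)
  show ?thesis
  proof (rule pscompI[of ?q N])
    fix \<rho> :: "nat \<Rightarrow> nat" and r k
    assume "4 \<le> r" "r < k" and "\<And>j. j < N \<Longrightarrow> \<rho> j < k \<and> \<rho> j \<noteq> r"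
    then have c: "computes N q F \<rho> r k (C \<rho> r k)" by (intro computes_familyD[OF F(3)]) auto
    have "big (2 ^ ?q m) (Seq (C \<rho> r k) (Inc r)) s (s(r := Suc (F w (\<lambda>i. s (\<rho> i)))))"
      if "w \<in> words" "length w \<le> m" "\<forall>j<4. s j = plane w j" "s r = 0" "\<forall>j\<ge>k. s j = 0"
        "\<forall>i<N. s (\<rho> i) < 2 ^ m" for w s m
    proof (rule big_Seq)
      let ?s = "s(r := F w (\<lambda>i. s (\<rho> i)))"
      show "big (2 ^ ?q m) (C \<rho> r k) s ?s"
        using that by (intro computesD[OF c]) auto
      have "F w (\<lambda>i. s (\<rho> i)) < 2 ^ q m" using that by (intro less) auto
      then have "Suc (?s r) < 2 ^ ?q m" by simp
      from big_Inc[of ?s r, OF this] show "big (2 ^ ?q m) (Inc r) ?s (s(r := Suc (F w (\<lambda>i. s (\<rho> i)))))" by simp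
    qed
    then show "\<exists>c. computes N ?q (\<lambda>w e. Suc (F w e)) \<rho> r k c"
      unfolding computes_def by blast
  next
    show "depends N (\<lambda>w e. Suc (F w e))" using F(2) by (auto simp: depends_def)
  qed (intro poly_bounded_intros F(1))
qed

lemma pscomp_let:
  assumes "pscomp F" "pscomp G"
  shows "pscomp (\<lambda>w e. F w (case_nat (G w e) e))"
proof -
  obtain NF qF CF where F: "poly_bounded qF" "depends NF F"
    "computes_family NF qF F CF"
    using pscompE[OF assms(1)] by blast
  obtain NG qG CG where G: "poly_bounded qG" "depends NG G"
    "computes_family NG qG G CG"
    using pscompE[OF assms(2)] by blast
  have Gless: "G w e < 2 ^ qG m" if "w \<in> words" "length w \<le> m" "\<And>i. i < NG \<Longrightarrow> e i < 2 ^ m" for w m e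
    by (rule pscomp_psbounded_aux[OF G(1,2) computes_familyD[OF G(3)]]) (use that in auto)
  \<comment> \<open>The new argument has up to \<open>qG m\<close> bits, so \<open>F\<close> runs
    with size \<open>m + qG m\<close>.\<close>
  let ?q = "\<lambda>m. qG m + qF (m + qG m)"
  let ?N = "NF + NG"
  show ?thesis
  proof (rule pscompI[of ?q ?N])
    show "depends ?N (\<lambda>w e. F w (case_nat (G w e) e))"
      unfolding depends_def
    proof (intro ballI allI impI)
      fix w and e e' :: env assume w: "w \<in> words" and e: "\<forall>i<?N. e i = e' i"
      have "G w e = G w e'" using e by (intro dependsD[OF G(2) w]) auto
      then show "F w (case_nat (G w e) e) = F w (case_nat (G w e') e')"
        using e by (intro dependsD[OF F(2) w]) (auto split: nat.split)
    qed
    fix \<rho> :: "nat \<Rightarrow> nat" and r k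
    assume r: "4 \<le> r" "r < k" and \<rho>: "\<And>j. j < ?N \<Longrightarrow> \<rho> j < k \<and> \<rho> j \<noteq> r"
    have \<rho>': "\<rho> j < k \<and> \<rho> j \<noteq> r \<and> \<rho> j \<noteq> k" if "j < ?N" for j using \<rho>[OF that] by auto
    let ?\<rho> = "case_nat k \<rho>"
    let ?cG = "CG \<rho> k (Suc k)" and ?cF = "CF ?\<rho> r (Suc k)"
    have cG: "computes NG qG G \<rho> k (Suc k) ?cG"
      using r \<rho>' by (intro computes_familyD[OF G(3)]) (auto simp: less_SucI)
    have cF: "computes NF qF F ?\<rho> r (Suc k) ?cF"
      using r \<rho>' by (intro computes_familyD[OF F(3)]) (auto simp: less_SucI split: nat.split)
    have "big (2 ^ ?q m) (Seq ?cG (Seq ?cF (While k (Dec k)))) s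
        (s(r := F w (case_nat (G w (\<lambda>i. s (\<rho> i))) (\<lambda>i. s (\<rho> i)))))"
      if w: "w \<in> words" "length w \<le> m" "\<forall>j<4. s j = plane w j" "s r = 0" "\<forall>j\<ge>k. s j = 0"
        and e: "\<forall>i<?N. s (\<rho> i) < 2 ^ m" for w s m
    proof (intro big_Seq)
      let ?e = "\<lambda>i. s (\<rho> i)"
      let ?g = "G w ?e"
      let ?f = "F w (case_nat ?g ?e)"
      show "big (2 ^ ?q m) ?cG s (s(k := ?g))"
        using w r e by (intro computesD[OF cG]) auto
      have g: "?g < 2 ^ qG m" using w e by (intro Gless) auto
      have m: "(2::nat) ^ qG m \<le> 2 ^ (m + qG m)" "(2::nat) ^ m \<le> 2 ^ (m + qG m)"
        by (auto intro: power_increasing)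
      have e': "s (\<rho> i) < 2 ^ (m + qG m)" if "i < ?N" for i
        using e that m(2) by (auto intro: less_le_trans simp del: power_add)
      show "big (2 ^ ?q m) ?cF (s(k := ?g)) (s(k := ?g, r := ?f))"
      proof (rule computesD[OF cF, of _ "m + qG m"])
        show "F w (\<lambda>i. (s(k := ?g)) (case_nat k \<rho> i)) = ?f"
        proof (rule dependsD[OF F(2) w(1)])
          fix i assume "i < NF"
          then show "(s(k := ?g)) (case_nat k \<rho> i) = case_nat ?g ?e i"
            using \<rho>' by (auto split: nat.split)
        qed
        fix i assume "i < NF"
        then show "(s(k := ?g)) (case_nat k \<rho> i) < 2 ^ (m + qG m)"
          using \<rho>' less_le_trans[OF g m(1)] e' by (auto split: nat.split)
      qed (use w r in auto)
      have "s(r := ?f) = s(k := ?g, r := ?f, k := 0)" using w(5) r by auto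
      then show "big (2 ^ ?q m) (While k (Dec k)) (s(k := ?g, r := ?f)) (s(r := ?f))"
        by (metis big_clear)
    qed
    then show "\<exists>c. computes ?N ?q (\<lambda>w e. F w (case_nat (G w e) e)) \<rho> r k c"
      unfolding computes_def by blast
  qed (intro poly_bounded_intros F(1) G(1) poly_bounded_compose[OF F(1)])
qed

text \<open>The iteration count \<open>D w e\<close> may be exponential: it is merely a counter of
  polynomially many bits. The intermediate values, however, must be bounded in advance by
  \<open>B\<close>, since doubling a number that often would exceed polynomial space.\<close>

lemma pscomp_rec_aux:
  fixes G H D B :: "nat list \<Rightarrow> env \<Rightarrow> nat"
  defines "R \<equiv> \<lambda>w e. rec_nat (G w e) (\<lambda>n y. H w (case_nat n (case_nat y e)))"
  assumes "pscomp G" "pscomp H" "pscomp D" "psbounded B"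
    and le: "\<And>w e n. w \<in> words \<Longrightarrow> n \<le> D w e \<Longrightarrow> R w e n \<le> B w e"
  shows "pscomp (\<lambda>w e. R w e (D w e))"
proof -
  obtain NG qG CG where G: "poly_bounded qG" "depends NG G"
    "computes_family NG qG G CG"
    using pscompE[OF assms(2)] by blast
  obtain NH qH CH where H: "poly_bounded qH" "depends NH H"
    "computes_family NH qH H CH"
    using pscompE[OF assms(3)] by blast
  obtain ND qD CD where D: "poly_bounded qD" "depends ND D"
    "computes_family ND qD D CD"
    using pscompE[OF assms(4)] by blast
  obtain NB qB where B: "poly_bounded qB"
    "\<And>w e m. w \<in> words \<Longrightarrow> length w \<le> m \<Longrightarrow> (\<And>i. i < NB \<Longrightarrow> e i < 2 ^ m) \<Longrightarrow> B w e < 2 ^ qB m"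
    using assms(5) unfolding psbounded_def by blast
  have Dless: "D w e < 2 ^ qD m" if "w \<in> words" "length w \<le> m" "\<And>i. i < ND \<Longrightarrow> e i < 2 ^ m" for w m e
    by (rule pscomp_psbounded_aux[OF D(1,2) computes_familyD[OF D(3)]]) (use that in auto)
  \<comment> \<open>Size for \<open>H\<close>, whose arguments are the old ones, the iteration
    counter and the accumulator. The extra 1 in \<open>q\<close> leaves room for incrementing a
    counter.\<close>
  define m1 where "m1 m = m + qD m + qB m" for m
  define q where "q m = qG m + qD m + qH (m1 m) + m1 m + 1" for m
  let ?N = "NG + NH + ND + NB"
  show ?thesis
  proof (rule pscompI[of q ?N])
    show "poly_bounded q" unfolding q_def m1_def
      by (intro poly_bounded_intros G(1) D(1) B(1) poly_bounded_compose[OF H(1)])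
    show "depends ?N (\<lambda>w e. R w e (D w e))"
      unfolding depends_def
    proof (intro ballI allI impI)
      fix w and e e' :: env assume w: "w \<in> words" and e: "\<forall>i<?N. e i = e' i"
      have "D w e = D w e'" using e by (intro dependsD[OF D(2) w]) auto
      moreover have "R w e n = R w e' n" for n
      proof (induction n)
        case 0
        show ?case unfolding R_def using e by (auto intro: dependsD[OF G(2) w])
      next
        case (Suc n)
        have "H w (case_nat n (case_nat (R w e n) e)) = H w (case_nat n (case_nat (R w e' n) e'))"
          using e Suc by (intro dependsD[OF H(2) w]) (auto split: nat.split)
        then show ?case by (simp add: R_def)
      qed
      ultimately show "R w e (D w e) = R w e' (D w e')" by simp
    qed
    fix \<rho> :: "nat \<Rightarrow> nat" and r k
    assume r: "4 \<le> r" "r < k" and \<rho>: "\<And>j. j < ?N \<Longrightarrow> \<rho> j < k \<and> \<rho> j \<noteq> r"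
    \<comment> \<open>\<open>k\<close> counts the remaining iterations and \<open>?n\<close> the
      completed ones; \<open>?t\<close> receives the result of \<open>H\<close>, which must not
      overwrite the accumulator \<open>r\<close> that it reads.\<close>
    let ?n = "Suc k" and ?t = "Suc (Suc k)" and ?k = "Suc (Suc (Suc k))"
    have \<rho>': "\<rho> j < ?k \<and> \<rho> j \<noteq> r \<and> \<rho> j \<noteq> k \<and> \<rho> j \<noteq> ?n \<and> \<rho> j \<noteq> ?t" if "j < ?N" for j
      using \<rho>[OF that] by auto
    let ?\<rho> = "case_nat ?n (case_nat r \<rho>)"
    let ?cD = "CD \<rho> k ?k" and ?cG = "CG \<rho> r ?k" and ?cH = "CH ?\<rho> ?t ?k"
    have cD: "computes ND qD D \<rho> k ?k ?cD"
      using r \<rho>' by (intro computes_familyD[OF D(3)]) auto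
    have cG: "computes NG qG G \<rho> r ?k ?cG"
      using r \<rho>' by (intro computes_familyD[OF G(3)]) auto
    have cH: "computes NH qH H ?\<rho> ?t ?k ?cH"
      using r \<rho>' by (intro computes_familyD[OF H(3)]) (auto split: nat.split)
    let ?body = "Seq (Dec k) (Seq ?cH (Seq (While r (Dec r))
      (Seq (While ?t (Seq (Dec ?t) (Inc r))) (Inc ?n))))"
    let ?c = "Seq ?cD (Seq ?cG (Seq (While k ?body) (While ?n (Dec ?n))))"
    have "big (2 ^ q m) ?c s (s(r := R w (\<lambda>i. s (\<rho> i)) (D w (\<lambda>i. s (\<rho> i)))))"
      if w: "w \<in> words" "length w \<le> m" "\<forall>j<4. s j = plane w j" "s r = 0" "\<forall>j\<ge>k. s j = 0"
        and e: "\<forall>i<?N. s (\<rho> i) < 2 ^ m" for w s m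
    proof -
      let ?e = "\<lambda>i. s (\<rho> i)"
      let ?D = "D w ?e" and ?R = "R w ?e"
      have D': "?D < 2 ^ qD m" using w e by (intro Dless) auto
      have B': "B w ?e < 2 ^ qB m" using w e by (intro B(2)) auto
      have m: "(2::nat) ^ qD m \<le> 2 ^ m1 m" "(2::nat) ^ m \<le> 2 ^ m1 m" "(2::nat) ^ qB m \<le> 2 ^ m1 m"
        by (auto intro!: power_increasing simp: m1_def)
      have mq: "2 * (2::nat) ^ m1 m \<le> 2 ^ q m"
        unfolding power_Suc[symmetric] by (intro power_increasing) (auto simp: q_def)
      have e': "s (\<rho> i) < 2 ^ m1 m" if "i < ?N" for i
        using e that m(2) by (auto intro: less_le_trans)
      have D1: "j < 2 ^ m1 m" if "j \<le> ?D" for j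
        using that D' m by linarith
      have R1: "?R j < 2 ^ m1 m" if "j \<le> ?D" for j
        using le[OF w(1) that] B' m by linarith
      define \<sigma> where "\<sigma> j = s(k := ?D - j, ?n := j, r := ?R j)" for j
      have 1: "big (2 ^ q m) ?cD s (s(k := ?D))"
        using w r e by (intro computesD[OF cD]) (auto simp: q_def)
      have 2: "big (2 ^ q m) ?cG (s(k := ?D)) (\<sigma> 0)"
      proof -
        have "big (2 ^ q m) ?cG (s(k := ?D)) (s(k := ?D, r := ?R 0))"
        proof (rule computesD[OF cG w(1,2)])
          show "G w (\<lambda>i. (s(k := ?D)) (\<rho> i)) = ?R 0"
            unfolding R_def using \<rho>' by (auto intro!: dependsD[OF G(2) w(1)])
        qed (use w r e \<rho>' in \<open>auto simp: q_def\<close>)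
        moreover have "s(k := ?D, r := ?R 0) = \<sigma> 0"
          unfolding \<sigma>_def using w(5) by (auto simp: fun_eq_iff)
        ultimately show ?thesis by simp
      qed
      have 3: "big (2 ^ q m) (While k ?body) (\<sigma> 0) (\<sigma> ?D)"
      proof (rule big_While_iter)
        fix j assume j: "j < ?D"
        have a: "big (2 ^ q m) (Dec k) (\<sigma> j) ((\<sigma> j)(k := ?D - Suc j))"
          using j r by (intro big_Dec) (auto simp: \<sigma>_def)
        let ?s1 = "(\<sigma> j)(k := ?D - Suc j)"
        let ?s2 = "?s1(?t := ?R (Suc j))"
        have b: "big (2 ^ q m) ?cH ?s1 ?s2"
        proof (rule computesD[OF cH w(1), of "m1 m"])
          have "H w (\<lambda>i. ?s1 (?\<rho> i)) = H w (case_nat j (case_nat (?R j) ?e))"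
            using \<rho>' r by (intro dependsD[OF H(2) w(1)]) (auto simp: \<sigma>_def split: nat.split)
          then show "H w (\<lambda>i. ?s1 (?\<rho> i)) = ?R (Suc j)" by (simp add: R_def)
          fix i assume "i < NH"
          then show "?s1 (?\<rho> i) < 2 ^ m1 m"
            using \<rho>' r D1[of j] R1[of j] j e' by (auto simp: \<sigma>_def split: nat.split)
        qed (use w r in \<open>auto simp: q_def m1_def \<sigma>_def\<close>)
        have c: "big (2 ^ q m) (While r (Dec r)) ?s2 (?s2(r := 0))"
          by (rule big_clear)
        let ?s4 = "?s2(r := ?R (Suc j), ?t := 0)"
        have d: "big (2 ^ q m) (While ?t (Seq (Dec ?t) (Inc r))) (?s2(r := 0)) ?s4"
          using big_move[of ?t r "?s2(r := 0)" "2 ^ q m"] r R1[of "Suc j"] mq j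
          by (auto simp: fun_upd_twist)
        have "Suc (Suc j) < 2 ^ q m" using D1[of "Suc j"] j mq by linarith
        moreover have "?s4 ?n = j" using r by (simp add: \<sigma>_def)
        ultimately have "big (2 ^ q m) (Inc ?n) ?s4 (?s4(?n := Suc j))"
          using big_Inc[of ?s4 ?n "2 ^ q m"] by simp
        moreover have "?s4(?n := Suc j) = \<sigma> (Suc j)"
          unfolding \<sigma>_def using w(5) r by (auto simp: fun_eq_iff)
        ultimately have f: "big (2 ^ q m) (Inc ?n) ?s4 (\<sigma> (Suc j))" by simp
        show "\<sigma> j k \<noteq> 0 \<and> big (2 ^ q m) ?body (\<sigma> j) (\<sigma> (Suc j))"
          using a b c d f j r by (auto intro!: big_Seq simp: \<sigma>_def)
      qed (use r in \<open>auto simp: \<sigma>_def\<close>)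
      have 4: "big (2 ^ q m) (While ?n (Dec ?n)) (\<sigma> ?D) (s(r := ?R ?D))"
      proof -
        have "(\<sigma> ?D)(?n := 0) = s(r := ?R ?D)"
          unfolding \<sigma>_def using w(5) r by (auto simp: fun_eq_iff)
        then show ?thesis by (metis big_clear)
      qed
      show ?thesis using 1 2 3 4 by (blast intro: big_Seq)
    qed
    then show "\<exists>c. computes ?N q (\<lambda>w e. R w e (D w e)) \<rho> r k c"
      unfolding computes_def by blast
  qed
qed

section \<open>Arithmetic and bounded quantifiers\<close>


abbreviation psdec :: "(nat list \<Rightarrow> env \<Rightarrow> bool) \<Rightarrow> bool" where
  "psdec P \<equiv> pscomp (\<lambda>w e. of_bool (P w e))"

text \<open>The form in which let-bindings occur in definitions: under the binder the outer
  variables are shifted by one and the bound value is variable 0.\<close>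

lemma pscomp_bind:
  assumes "pscomp f" "pscomp (\<lambda>w e. K w (\<lambda>i. e (Suc i)) (e 0))"
  shows "pscomp (\<lambda>w e. K w e (f w e))"
  using pscomp_let[OF assms(2,1)] by simp

lemma pscomp_shift: "pscomp f \<Longrightarrow> pscomp (\<lambda>w e. f w (\<lambda>i. e (Suc i)))"
  by (rule pscomp_rename)

lemma pscomp_shift2: "pscomp f \<Longrightarrow> pscomp (\<lambda>w e. f w (\<lambda>i. e (Suc (Suc i))))"
  by (rule pscomp_rename)

lemma pscomp_shift3: "pscomp f \<Longrightarrow> pscomp (\<lambda>w e. f w (\<lambda>i. e (Suc (Suc (Suc i)))))"
  by (rule pscomp_rename)

lemma pscomp_shift4: "pscomp f \<Longrightarrow> pscomp (\<lambda>w e. f w (\<lambda>i. e (Suc (Suc (Suc (Suc i))))))"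
  by (rule pscomp_rename)

lemma pscomp_comp1:
  assumes "pscomp (\<lambda>w e. F w (e 0))" "pscomp f"
  shows "pscomp (\<lambda>w e. F w (f w e))"
  using pscomp_bind[OF assms(2), of "\<lambda>w e x. F w x"] assms(1) by simp

lemma pscomp_comp2:
  assumes "pscomp (\<lambda>w e. F w (e 0) (e 1))" "pscomp f" "pscomp g"
  shows "pscomp (\<lambda>w e. F w (f w e) (g w e))"
  by (rule pscomp_bind[OF assms(2), of "\<lambda>w e x. F w x (g w e)"],
      rule pscomp_bind[OF pscomp_shift[OF assms(3)], of "\<lambda>w e x. F w (e 0) x"])
     (use pscomp_rename[OF assms(1), of "\<lambda>i. 1 - i"] in simp)

lemma pscomp_comp3:
  assumes "pscomp (\<lambda>w e. F w (e 0) (e 1) (e 2))" "pscomp f" "pscomp g" "pscomp h"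
  shows "pscomp (\<lambda>w e. F w (f w e) (g w e) (h w e))"
  by (rule pscomp_bind[OF assms(2), of "\<lambda>w e x. F w x (g w e) (h w e)"],
      rule pscomp_bind[OF pscomp_shift[OF assms(3)], of "\<lambda>w e x. F w (e 0) x (h w (\<lambda>i. e (Suc i)))"],
      rule pscomp_bind[OF pscomp_shift2[OF assms(4)], of "\<lambda>w e x. F w (e (Suc 0)) (e 0) x"])
     (use pscomp_rename[OF assms(1), of "\<lambda>i. 2 - i"] in \<open>simp add: eval_nat_numeral\<close>)

lemma pscomp_comp4:
  assumes "pscomp (\<lambda>w e. F w (e 0) (e 1) (e 2) (e 3))" "pscomp f" "pscomp g" "pscomp h" "pscomp k"
  shows "pscomp (\<lambda>w e. F w (f w e) (g w e) (h w e) (k w e))"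
  by (rule pscomp_bind[OF assms(2), of "\<lambda>w e x. F w x (g w e) (h w e) (k w e)"],
      rule pscomp_bind[OF pscomp_shift[OF assms(3)],
        of "\<lambda>w e x. F w (e 0) x (h w (\<lambda>i. e (Suc i))) (k w (\<lambda>i. e (Suc i)))"],
      rule pscomp_bind[OF pscomp_shift2[OF assms(4)],
        of "\<lambda>w e x. F w (e (Suc 0)) (e 0) x (k w (\<lambda>i. e (Suc (Suc i))))"],
      rule pscomp_bind[OF pscomp_shift3[OF assms(5)], of "\<lambda>w e x. F w (e (Suc (Suc 0))) (e (Suc 0)) (e 0) x"])
     (use pscomp_rename[OF assms(1), of "\<lambda>i. 3 - i"] in \<open>simp add: eval_nat_numeral\<close>)

lemma pscomp_comp5:
  assumes "pscomp (\<lambda>w e. F w (e 0) (e 1) (e 2) (e 3) (e 4))"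
    "pscomp f" "pscomp g" "pscomp h" "pscomp k" "pscomp l"
  shows "pscomp (\<lambda>w e. F w (f w e) (g w e) (h w e) (k w e) (l w e))"
  by (rule pscomp_bind[OF assms(2), of "\<lambda>w e x. F w x (g w e) (h w e) (k w e) (l w e)"],
      rule pscomp_bind[OF pscomp_shift[OF assms(3)],
        of "\<lambda>w e x. F w (e 0) x (h w (\<lambda>i. e (Suc i))) (k w (\<lambda>i. e (Suc i))) (l w (\<lambda>i. e (Suc i)))"],
      rule pscomp_bind[OF pscomp_shift2[OF assms(4)],
        of "\<lambda>w e x. F w (e (Suc 0)) (e 0) x (k w (\<lambda>i. e (Suc (Suc i)))) (l w (\<lambda>i. e (Suc (Suc i))))"],
      rule pscomp_bind[OF pscomp_shift3[OF assms(5)],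
        of "\<lambda>w e x. F w (e (Suc (Suc 0))) (e (Suc 0)) (e 0) x (l w (\<lambda>i. e (Suc (Suc (Suc i)))))"],
      rule pscomp_bind[OF pscomp_shift4[OF assms(6)], of "\<lambda>w e x. F w (e (Suc (Suc (Suc 0)))) (e (Suc (Suc 0))) (e (Suc 0)) (e 0) x"])
     (use pscomp_rename[OF assms(1), of "\<lambda>i. 4 - i"] in \<open>simp add: eval_nat_numeral\<close>)

lemma pscomp_rec:
  assumes "pscomp G" "pscomp (\<lambda>w e. H w (\<lambda>i. e (Suc (Suc i))) (e 0) (e (Suc 0)))" "pscomp D" "psbounded B"
    and "\<And>w e n. w \<in> words \<Longrightarrow> n \<le> D w e \<Longrightarrow> rec_nat (G w e) (H w e) n \<le> B w e"
  shows "pscomp (\<lambda>w e. rec_nat (G w e) (H w e) (D w e))"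
  using pscomp_rec_aux[OF assms(1-4)] assms(5) by simp

lemma pscomp_const: "pscomp (\<lambda>w e. n)"
  by (induction n) (auto intro: pscomp_zero pscomp_Suc)

lemma psbounded_binop:
  assumes "psbounded f" "psbounded g"
    and "\<And>x y m n. x < 2 ^ m \<Longrightarrow> y < 2 ^ n \<Longrightarrow> F x y < (2::nat) ^ (m + n + 1)"
  shows "psbounded (\<lambda>w e. F (f w e) (g w e))"
proof -
  obtain N q where N: "poly_bounded q" "\<forall>w\<in>words. \<forall>e m. length w \<le> m \<longrightarrow>
     (\<forall>i<N. e i < 2 ^ m) \<longrightarrow> f w e < 2 ^ q m"
    using assms(1) unfolding psbounded_def by blast
  obtain N' q' where N': "poly_bounded q'" "\<forall>w\<in>words. \<forall>e m. length w \<le> m \<longrightarrow>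
     (\<forall>i<N'. e i < 2 ^ m) \<longrightarrow> g w e < 2 ^ q' m"
    using assms(2) unfolding psbounded_def by blast
  show ?thesis
    unfolding psbounded_def
  proof (intro exI[of _ "N + N'"] exI[of _ "\<lambda>m. q m + q' m + 1"] conjI ballI allI impI)
    show "poly_bounded (\<lambda>m. q m + q' m + 1)"
      by (intro poly_bounded_intros N(1) N'(1))
    fix w m and e :: env assume "w \<in> words" "length w \<le> m" "\<forall>i<N + N'. e i < 2 ^ m"
    then show "F (f w e) (g w e) < 2 ^ (q m + q' m + 1)"
      by (intro assms(3) N(2)[rule_format] N'(2)[rule_format]) auto
  qed
qed

lemma psbounded_add:
  assumes "psbounded f" "psbounded g"
  shows "psbounded (\<lambda>w e. f w e + g w e)"
proof (rule psbounded_binop[OF assms])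
  fix x y m n :: nat assume "x < 2 ^ m" "y < 2 ^ n"
  moreover have "(2::nat) ^ m \<le> 2 ^ (m + n)" "(2::nat) ^ n \<le> 2 ^ (m + n)"
    by (rule power_increasing; simp)+
  ultimately show "x + y < 2 ^ (m + n + 1)" unfolding Suc_eq_plus1[symmetric] power_Suc by linarith
qed

lemma psbounded_mult:
  assumes "psbounded f" "psbounded g"
  shows "psbounded (\<lambda>w e. f w e * g w e)"
proof (rule psbounded_binop[OF assms])
  fix x y m n :: nat assume "x < 2 ^ m" "y < 2 ^ n"
  then have "x * y < 2 ^ m * 2 ^ n" by (intro mult_strict_mono) auto
  also have "\<dots> \<le> 2 ^ (m + n + 1)" by (simp add: power_add)
  finally show "x * y < 2 ^ (m + n + 1)" .
qed

lemma psbounded_two_power_length: "psbounded (\<lambda>w e. 2 ^ length w)"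
  unfolding psbounded_def
proof (intro exI[of _ 0] exI[of _ "\<lambda>m. m + 1"] conjI ballI allI impI)
  show "poly_bounded (\<lambda>m. m + 1)" by (intro poly_bounded_intros)
  fix w :: "nat list" and m assume "length w \<le> m"
  then show "2 ^ length w < (2::nat) ^ (m + 1)" by (intro power_strict_increasing) auto
qed

text \<open>Syntax-directed closure rules: a function or predicate written with these operations is
  computable in polynomial space by mere traversal of its definition.\<close>

named_theorems ps

lemmas [ps] = pscomp_const pscomp_var pscomp_Suc

section \<open>Arithmetic by bounded recursion\<close>

lemma pscomp_add [ps]:
  assumes "pscomp f" "pscomp g"
  shows "pscomp (\<lambda>w e. f w e + g w e)"
proof -
  have eq: "rec_nat a (\<lambda>n y. Suc y) n = a + n" for a n by (induction n) auto
  have "pscomp (\<lambda>w e. rec_nat (f w e) (\<lambda>n y. Suc y) (g w e))"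
    by (rule pscomp_rec[where B = "\<lambda>w e. f w e + g w e"])
       (auto simp: eq intro: assms ps psbounded_add pscomp_psbounded)
  then show ?thesis by (simp add: eq)
qed

lemma pscomp_pred [ps]:
  assumes "pscomp f"
  shows "pscomp (\<lambda>w e. f w e - 1)"
proof -
  have eq: "rec_nat 0 (\<lambda>n y. n) n = n - 1" for n by (induction n) auto
  have "pscomp (\<lambda>w e. rec_nat 0 (\<lambda>n y. n) (f w e))"
    by (rule pscomp_rec[where B = f])
       (auto simp: eq intro: assms ps pscomp_psbounded)
  then show ?thesis by (simp add: eq)
qed

lemma pscomp_diff [ps]:
  assumes "pscomp f" "pscomp g"
  shows "pscomp (\<lambda>w e. f w e - g w e)"
proof -
  have eq: "rec_nat a (\<lambda>n y. y - 1) n = a - n" for a n :: nat by (induction n) auto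
  have "pscomp (\<lambda>w e. rec_nat (f w e) (\<lambda>n y. y - 1) (g w e))"
    by (rule pscomp_rec[where B = f])
       (simp_all only: eq assms pscomp_psbounded ps diff_le_self)
  then show ?thesis by (simp only: eq)
qed

lemma pscomp_mult [ps]:
  assumes "pscomp f" "pscomp g"
  shows "pscomp (\<lambda>w e. f w e * g w e)"
proof -
  have eq: "rec_nat 0 (\<lambda>n y. y + a) n = n * a" for a n :: nat by (induction n) auto
  have "pscomp (\<lambda>w e. rec_nat 0 (\<lambda>n y. y + g w e) (f w e))"
    by (rule pscomp_rec[where B = "\<lambda>w e. f w e * g w e"])
       (auto simp: eq intro: assms ps psbounded_mult pscomp_psbounded pscomp_shift2[OF assms(2)])
  then show ?thesis by (simp add: eq)
qed

lemma psdec_is_zero: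
  assumes "pscomp f"
  shows "psdec (\<lambda>w e. f w e = 0)"
proof -
  have eq: "1 - x = of_bool (x = 0)" for x :: nat by simp
  have "pscomp (\<lambda>w e. 1 - f w e)" by (intro ps assms)
  then show ?thesis by (simp only: eq)
qed

lemma psdec_not [ps]:
  assumes "psdec P"
  shows "psdec (\<lambda>w e. \<not> P w e)"
  using psdec_is_zero[OF assms] by simp

lemma psdec_conj [ps]:
  assumes "psdec P" "psdec Q"
  shows "psdec (\<lambda>w e. P w e \<and> Q w e)"
  using pscomp_mult[OF assms] by (simp only: of_bool_conj)

lemma psdec_disj [ps]:
  assumes "psdec P" "psdec Q"
  shows "psdec (\<lambda>w e. P w e \<or> Q w e)"
  using psdec_not[OF psdec_conj[OF psdec_not psdec_not]] assms by simp

lemma psdec_imp [ps]: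
  assumes "psdec P" "psdec Q"
  shows "psdec (\<lambda>w e. P w e \<longrightarrow> Q w e)"
  unfolding imp_conv_disj by (intro ps assms)

lemma psdec_le [ps]:
  assumes "pscomp f" "pscomp g"
  shows "psdec (\<lambda>w e. f w e \<le> g w e)"
  using psdec_is_zero[OF pscomp_diff[OF assms]] by simp

lemma psdec_less [ps]:
  assumes "pscomp f" "pscomp g"
  shows "psdec (\<lambda>w e. f w e < g w e)"
  using psdec_le[OF pscomp_Suc assms(2)] assms by (simp add: Suc_le_eq)

lemma psdec_eq [ps]:
  assumes "pscomp f" "pscomp g"
  shows "psdec (\<lambda>w e. f w e = g w e)"
  using psdec_conj[OF psdec_le[OF assms] psdec_le[OF assms(2,1)]] by (simp add: eq_iff)

lemma pscomp_if [ps]: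
  assumes "psdec P" "pscomp f" "pscomp g"
  shows "pscomp (\<lambda>w e. if P w e then f w e else g w e)"
proof -
  have eq: "of_bool b * x + of_bool (\<not> b) * y = (if b then x else y)" for b and x y :: nat by simp
  have "pscomp (\<lambda>w e. of_bool (P w e) * f w e + of_bool (\<not> P w e) * g w e)"
    by (intro ps assms)
  then show ?thesis by (simp only: eq)
qed

text \<open>Exhaustive search, keeping only the current candidate and one bit; hence exponential
  ranges such as \<open>p<2 ^ length w\<close> are affordable.\<close>

lemma psdec_ex [ps]:
  assumes "pscomp b" "psdec (\<lambda>w e. P w (\<lambda>i. e (Suc i)) (e 0))"
  shows "psdec (\<lambda>w e. \<exists>x<b w e. P w e x)"
proof -
  have eq: "rec_nat 0 (\<lambda>n y. if p n then 1 else y) n = of_bool (\<exists>x<n. p x)" for p and n :: nat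
    by (induction n) (auto simp: less_Suc_eq)
  \<comment> \<open>In the recursion step variable 1 is the accumulator, so the outer variables of
    \<open>P\<close> have to skip it.\<close>
  have "psdec (\<lambda>w e. P w (\<lambda>i. e (Suc (Suc i))) (e 0))"
    using pscomp_rename[OF assms(2), of "case_nat 0 (\<lambda>i. Suc (Suc i))"] by simp
  then have "pscomp (\<lambda>w e. rec_nat 0 (\<lambda>n y. if P w e n then 1 else y) (b w e))"
    by (intro pscomp_rec[where B = "\<lambda>w e. 1"] ps assms)
       (auto simp: eq intro!: pscomp_psbounded ps)
  then show ?thesis by (simp only: eq)
qed

lemma psdec_all [ps]:
  assumes "pscomp b" "psdec (\<lambda>w e. P w (\<lambda>i. e (Suc i)) (e 0))"
  shows "psdec (\<lambda>w e. \<forall>x<b w e. P w e x)"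
  using psdec_not[OF psdec_ex[OF assms(1) psdec_not[OF assms(2)]]] by simp

lemma pscomp_count [ps]:
  assumes "pscomp b" "psdec (\<lambda>w e. P w (\<lambda>i. e (Suc i)) (e 0))"
  shows "pscomp (\<lambda>w e. \<Sum>x<b w e. of_bool (P w e x))"
proof -
  have eq: "rec_nat 0 (\<lambda>n y. y + of_bool (p n)) n = (\<Sum>x<n. of_bool (p x))" for p and n :: nat
    by (induction n) auto
  have le: "(\<Sum>x<n. of_bool (p x)) \<le> (n::nat)" for p n
    using sum_mono[of "{..<n}" "\<lambda>x. of_bool (p x)" "\<lambda>_. 1::nat"] by simp
  have "psdec (\<lambda>w e. P w (\<lambda>i. e (Suc (Suc i))) (e 0))"
    using pscomp_rename[OF assms(2), of "case_nat 0 (\<lambda>i. Suc (Suc i))"] by simp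
  then have "pscomp (\<lambda>w e. rec_nat 0 (\<lambda>n y. y + of_bool (P w e n)) (b w e))"
    using le by (intro pscomp_rec[where B = b] ps assms)
       (auto simp: eq intro!: pscomp_psbounded assms intro: le_trans)
  then show ?thesis by (simp only: eq)
qed

lemma psdec_mem [ps]:
  assumes "finite A" "pscomp f"
  shows "psdec (\<lambda>w e. f w e \<in> A)"
  using assms(1)
proof induction
  case empty
  show ?case using pscomp_const[of 0] by simp
next
  case (insert a A)
  then show ?case unfolding insert_iff by (intro ps assms(2))
qed

lemma pscomp_half [ps]:
  assumes "pscomp f"
  shows "pscomp (\<lambda>w e. f w e div 2)"
proof -
  \<comment> \<open>The counter \<open>q\<close> grows by one per iteration as long as 2 * q + 2 <=
    a, and \<open>a\<close> iterations are enough to reach the quotient.\<close>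
  have eq: "rec_nat 0 (\<lambda>n q. if Suc (Suc (2 * q)) \<le> a then Suc q else q) n = min n (a div 2)" for a n :: nat
    by (induction n) auto
  have "pscomp (\<lambda>w e. rec_nat 0 (\<lambda>n q. if Suc (Suc (2 * q)) \<le> f w e then Suc q else q) (f w e))"
    by (intro pscomp_rec[where B = f] ps pscomp_shift2[OF assms] assms)
       (auto simp: eq intro!: pscomp_psbounded assms)
  then show ?thesis by (simp add: eq min_absorb2)
qed

lemma psdec_odd [ps]:
  assumes "pscomp f"
  shows "psdec (\<lambda>w e. odd (f w e))"
proof -
  have eq: "a - 2 * (a div 2) = of_bool (odd a)" for a :: nat
    by (simp only: minus_mult_div_eq_mod of_bool_odd_eq_mod_2)
  have "pscomp (\<lambda>w e. f w e - 2 * (f w e div 2))" by (intro ps assms)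
  then show ?thesis by (simp only: eq)
qed

lemma psdec_even [ps]:
  assumes "pscomp f"
  shows "psdec (\<lambda>w e. even (f w e))"
  using psdec_not[OF psdec_odd[OF assms]] by simp

lemma pscomp_div_power [ps]:
  assumes "pscomp f" "pscomp g"
  shows "pscomp (\<lambda>w e. f w e div 2 ^ g w e)"
proof -
  have eq: "rec_nat a (\<lambda>n y. y div 2) n = a div 2 ^ n" for a n :: nat
    by (induction n) (simp_all only: nat.rec power_Suc2 div_mult2_eq power_0 div_by_1)
  have "pscomp (\<lambda>w e. rec_nat (f w e) (\<lambda>n y. y div 2) (g w e))"
    by (intro pscomp_rec[where B = f] ps assms)
       (auto simp: eq intro!: pscomp_psbounded assms)
  then show ?thesis by (simp add: eq)
qed

lemma psdec_bit [ps]: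
  assumes "pscomp f" "pscomp g"
  shows "psdec (\<lambda>w e. bit (f w e) (g w e))"
  unfolding bit_iff_odd by (intro ps assms)

text \<open>Past the end the value is 0, which is not in the alphabet, so a test for a particular
  letter includes the test that the position lies in the word.\<close>

definition letter :: "nat list \<Rightarrow> nat \<Rightarrow> nat" where
  "letter w i = (if i < length w then w ! i else 0)"

lemma letter_range:
  assumes "w \<in> words" "i < length w"
  shows "letter w i \<in> {1..15}"
proof -
  have "w ! i \<in> {1..15}" using assms nth_mem in_lists_conv_set by blast
  then show ?thesis using assms(2) by (simp add: letter_def)
qed

lemma letter_pos: "w \<in> words \<Longrightarrow> 0 < letter w i \<longleftrightarrow> i < length w"
  using letter_range[of w i] by (cases "i < length w") (auto simp: letter_def)

lemma letter_plane:
  assumes "w \<in> words"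
  shows "letter w i = of_bool (bit (plane w 0) i) + 2 * of_bool (bit (plane w 1) i)
    + 4 * of_bool (bit (plane w 2) i) + 8 * of_bool (bit (plane w 3) i)"
proof -
  have bits: "x = of_bool (bit x 0) + 2 * of_bool (bit x 1) + 4 * of_bool (bit x 2) + 8 * of_bool (bit x 3)"
    if "x < 16" for x :: nat
  proof -
    have "take_bit 4 x = x" using that by (simp add: take_bit_nat_eq_self_iff)
    then show ?thesis
      using horner_sum_bit_eq_take_bit[of x 4] by (simp add: eval_nat_numeral)
  qed
  show ?thesis
  proof (cases "i < length w")
    case True
    then have "w ! i < 16" using letter_range[OF assms True] by (simp add: letter_def)
    from bits[OF this] show ?thesis using True by (simp add: letter_def bit_plane)
  qed (simp add: letter_def bit_plane)
qed

lemma pscomp_letter [ps]: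
  assumes "pscomp f"
  shows "pscomp (\<lambda>w e. letter w (f w e))"
proof (rule pscomp_cong)
  show "pscomp (\<lambda>w e. of_bool (bit (plane w 0) (f w e)) + 2 * of_bool (bit (plane w 1) (f w e))
    + 4 * of_bool (bit (plane w 2) (f w e)) + 8 * of_bool (bit (plane w 3) (f w e)))"
    by (intro ps assms pscomp_plane) simp_all
qed (simp add: letter_plane)

text \<open>The length is not given in a register; it is found by counting nonzero letters below a
  computable bound. The last letter, at position n, is nonzero, so some plane has bit n set, and
  that plane is at least 2^n > n.\<close>

lemma length_le_planes:
  assumes "w \<in> words"
  shows "length w \<le> plane w 0 + plane w 1 + plane w 2 + plane w 3"
proof (cases "length w")
  case (Suc n)
  obtain j where j: "j \<in> {0, 1, 2, 3}" "bit (plane w j) n"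
    using letter_plane[OF assms, of n] letter_pos[OF assms, of n] Suc by fastforce
  have "2 ^ n \<le> plane w j" using unset_bit_nat_add[OF j(2)] by simp
  moreover have "n < (2::nat) ^ n" by (rule less_exp)
  ultimately have "Suc n \<le> plane w j" by linarith
  then show ?thesis unfolding Suc using j(1) by auto
qed simp

lemma pscomp_length [ps]: "pscomp (\<lambda>w e. length w)"
proof (rule pscomp_cong)
  show "pscomp (\<lambda>w e. \<Sum>x<plane w 0 + plane w 1 + plane w 2 + plane w 3. of_bool (letter w x \<noteq> 0))"
    by (intro ps pscomp_plane) simp_all
  fix w and e :: env assume w: "w \<in> words"
  let ?n = "plane w 0 + plane w 1 + plane w 2 + plane w 3"
  have "(\<Sum>x<?n. of_bool (letter w x \<noteq> 0)) = card {x \<in> {..<?n}. letter w x \<noteq> 0}"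
    by (simp only: sum_of_bool_eq finite_lessThan of_nat_id Int_def Collect_mem_eq mem_Collect_eq)
  also have "{x \<in> {..<?n}. letter w x \<noteq> 0} = {..<length w}"
    using length_le_planes[OF w] by (auto simp: letter_pos[OF w])
  finally show "(\<Sum>x<?n. of_bool (letter w x \<noteq> 0)) = length w" by simp
qed

lemma pscomp_two_power_length [ps]: "pscomp (\<lambda>w e. 2 ^ length w)"
proof -
  have eq: "rec_nat 1 (\<lambda>n y. 2 * y) n = (2::nat) ^ n" for n by (induction n) auto
  have "pscomp (\<lambda>w e. rec_nat 1 (\<lambda>n y. 2 * y) (length w))"
    by (intro pscomp_rec[where B = "\<lambda>w e. 2 ^ length w"] ps psbounded_two_power_length)
       (auto simp: eq[simplified] intro: power_increasing)
  then show ?thesis by (simp only: eq)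
qed

text \<open>The data structure of the algorithm: sets of worlds and vectors of truth values are both
  stored as numbers with one bit per position of the word.\<close>

definition bitset :: "nat \<Rightarrow> (nat \<Rightarrow> bool) \<Rightarrow> nat" where
  "bitset n P = horner_sum of_bool 2 (map P [0..<n])"

lemma bit_bitset: "bit (bitset n P) i \<longleftrightarrow> i < n \<and> P i"
  by (auto simp: bitset_def bit_simps)

lemma bitset_less: "bitset n P < 2 ^ n"
  using horner_sum_of_bool_2_less[of "map P [0..<n]"] by (simp add: bitset_def)

lemma pscomp_bitset [ps]:
  assumes "psdec (\<lambda>w e. P w (\<lambda>i. e (Suc i)) (e 0))"
  shows "pscomp (\<lambda>w e. bitset (length w) (P w e))"
proof -
  \<comment> \<open>Horner's scheme from the last position down: after n steps the positions from l
    - n on have been read.\<close>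
  have rec: "rec_nat 0 (\<lambda>n y. of_bool (p (l - Suc n)) + 2 * y) n = horner_sum of_bool (2::nat) (map p [l - n..<l])"
    if "n \<le> l" for p n l
    using that
  proof (induction n)
    case (Suc n)
    then have "[l - Suc n..<l] = (l - Suc n) # [l - n..<l]"
      using upt_conv_Cons[of "l - Suc n" l] by (simp add: Suc_diff_Suc)
    then show ?case using Suc by simp
  qed simp
  have "psdec (\<lambda>w e. P w (\<lambda>i. e (Suc (Suc (Suc i)))) (e 0))"
    using pscomp_rename[OF assms, of "case_nat 0 (\<lambda>i. Suc (Suc (Suc i)))"] by simp
  moreover have "pscomp (\<lambda>w e. length w - Suc (e 0))" by (intro ps)
  ultimately have step: "psdec (\<lambda>w e. P w (\<lambda>i. e (Suc (Suc i))) (length w - Suc (e 0)))"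
    using pscomp_bind[of "\<lambda>w e. length w - Suc (e 0)" "\<lambda>w e x. of_bool (P w (\<lambda>i. e (Suc (Suc i))) x)"]
    by simp
  have "pscomp (\<lambda>w e. rec_nat 0 (\<lambda>n y. of_bool (P w e (length w - Suc n)) + 2 * y) (length w))"
  proof (intro pscomp_rec[where B = "\<lambda>w e. 2 ^ length w"] step ps psbounded_two_power_length)
    fix w :: "nat list" and e :: env and n assume "n \<le> length w"
    then have "(2::nat) ^ n \<le> 2 ^ length w" by (intro power_increasing) auto
    then show "rec_nat 0 (\<lambda>n y. of_bool (P w e (length w - Suc n)) + 2 * y) n \<le> (2::nat) ^ length w"
      using horner_sum_of_bool_2_less[where 'a = nat, of "map (P w e) [length w - n..<length w]"]
        \<open>n \<le> length w\<close> by (simp add: rec del: power_increasing_iff)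
  qed
  then show ?thesis by (simp add: rec bitset_def)
qed

section \<open>The decision procedure\<close>


theorem PSPACE_of_psdec:
  assumes "psdec (\<lambda>w e. w \<in> L)"
  shows "in_PSPACE {1..15} L"
proof -
  obtain N q C where F: "poly_bounded q" "depends N (\<lambda>w e. of_bool (w \<in> L))"
      "computes_family N q (\<lambda>w e. of_bool (w \<in> L)) C"
    using pscompE[OF assms] by blast
  \<comment> \<open>The language depends on the word alone; all arguments are read from register 4,
    which is 0, and the answer goes to register 5.\<close>
  have c: "computes N q (\<lambda>w e. of_bool (w \<in> L)) (\<lambda>_. 4) 5 6 (C (\<lambda>_. 4) 5 6)"
    by (rule computes_familyD[OF F(3)]) auto
  show ?thesis
  proof (rule PSPACE_of_while[OF F(1)])
    fix w :: "nat list" assume w: "w \<in> words"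
    have "big (2 ^ q (length w)) (C (\<lambda>_. 4) 5 6) (init_regs w) ((init_regs w)(5 := of_bool (w \<in> L)))"
      by (rule computesD[OF c w order_refl]) (auto simp: init_regs_def)
    then show "\<exists>s. big (2 ^ q (length w)) (C (\<lambda>_. 4) 5 6) (init_regs w) s \<and> (s 5 \<noteq> 0 \<longleftrightarrow> w \<in> L)"
      by (intro exI conjI) auto
  qed
qed

text \<open>The first letter of \<open>enc_nat d\<close>: the terminator 3 for 0, otherwise the
  parity.\<close>

definition digit :: "nat \<Rightarrow> nat" where
  "digit d = (if d = 0 then 3 else if even d then 1 else 2)"

text \<open>The recursion of \<open>enc_nat\<close> replaced by bounded quantifiers: the letter at
  offset l depends on the quotient of n by 2^l, and the terminator sits at the first quotient 0. The
  resulting factorisation of the word is \<open>num_at_iff\<close>.\<close>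

definition num_at :: "nat list \<Rightarrow> nat \<Rightarrow> nat \<Rightarrow> nat \<Rightarrow> bool" where
  "num_at w i n j \<longleftrightarrow> i < j \<and> j \<le> length w \<and> n div 2 ^ (j - Suc i) = 0 \<and>
     (\<forall>l<j - Suc i. n div 2 ^ l \<noteq> 0) \<and> (\<forall>l<j - i. letter w (i + l) = digit (n div 2 ^ l))"

lemma psdec_num_at [ps]:
  assumes "pscomp f" "pscomp g" "pscomp h"
  shows "psdec (\<lambda>w e. num_at w (f w e) (g w e) (h w e))"
proof -
  have "psdec (\<lambda>w e. num_at w (e 0) (e 1) (e 2))"
    unfolding num_at_def digit_def by (intro ps)
  from pscomp_comp3[of "\<lambda>w i n j. of_bool (num_at w i n j)", OF this assms] show ?thesis .
qed

section \<open>Reading edges and labels off the word\<close>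

definition edge_in :: "nat list \<Rightarrow> nat \<Rightarrow> nat \<Rightarrow> bool" where
  "edge_in w a b \<longleftrightarrow> (\<exists>i<length w. letter w i = 14 \<and>
     (\<exists>j<Suc (length w). \<exists>j'<Suc (length w). num_at w (Suc i) a j \<and> num_at w j b j'))"

lemma psdec_edge_in [ps]:
  assumes "pscomp f" "pscomp g"
  shows "psdec (\<lambda>w e. edge_in w (f w e) (g w e))"
proof -
  have "psdec (\<lambda>w e. edge_in w (e 0) (e 1))" unfolding edge_in_def by (intro ps)
  from pscomp_comp2[of "\<lambda>w i j. of_bool (edge_in w i j)", OF this assms] show ?thesis .
qed

definition seps :: "nat list \<Rightarrow> nat \<Rightarrow> nat" where
  "seps w i = (\<Sum>x<i. of_bool (letter w x = 15))"

lemma pscomp_seps [ps]: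
  assumes "pscomp f"
  shows "pscomp (\<lambda>w e. seps w (f w e))"
proof -
  have "pscomp (\<lambda>w e. seps w (e 0))" unfolding seps_def by (intro ps)
  from pscomp_comp1[of seps, OF this assms] show ?thesis .
qed

text \<open>A number in a label is preceded by the opening 15 or by the terminator 3 of the previous
  number. The label of world \<open>v\<close> follows the (v + 1)-st letter 15; the count also
  excludes terminators in front of the labels.\<close>

definition label_in :: "nat list \<Rightarrow> nat \<Rightarrow> nat \<Rightarrow> bool" where
  "label_in w v p \<longleftrightarrow> (\<exists>i<length w. (letter w i = 15 \<or> letter w i = 3) \<and> seps w (Suc i) = Suc v \<and>
     (\<exists>j<Suc (length w). num_at w (Suc i) p j))"

lemma psdec_label_in [ps]:
  assumes "pscomp f" "pscomp g"
  shows "psdec (\<lambda>w e. label_in w (f w e) (g w e))"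
proof -
  have "psdec (\<lambda>w e. label_in w (e 0) (e 1))" unfolding label_in_def by (intro ps)
  from pscomp_comp2[of "\<lambda>w i j. of_bool (label_in w i j)", OF this assms] show ?thesis .
qed

text \<open>What may follow an opening 15 or a complete number inside the labels. Imposed at each
  such position, this local condition forces the global syntax.\<close>

definition next_label :: "nat set \<Rightarrow> nat list \<Rightarrow> nat \<Rightarrow> bool" where
  "next_label A w j \<longleftrightarrow> j = length w \<or> letter w j = 15 \<or>
     (\<exists>p<2 ^ length w. p \<in> A \<and> (\<exists>j'<Suc (length w). num_at w j p j'))"

lemma psdec_next_label [ps]:
  assumes "finite A" "pscomp f"
  shows "psdec (\<lambda>w e. next_label A w (f w e))"
proof -
  have "psdec (\<lambda>w e. next_label A w (e 0))" unfolding next_label_def by (intro ps assms)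
  from pscomp_comp1[of "\<lambda>w i. of_bool (next_label A w i)", OF this assms(2)] show ?thesis .
qed

text \<open>The part of the word from position \<open>m\<close> on encodes a structure with initial world \<open>ini\<close>. The
  number of worlds is recovered as the number of labels, i.e. of letters 15.\<close>

definition kripke_at :: "nat set \<Rightarrow> nat list \<Rightarrow> nat \<Rightarrow> nat \<Rightarrow> bool" where
  "kripke_at A w m ini \<longleftrightarrow>
     letter w m = 13 \<and> (\<forall>i<m. letter w i \<noteq> 13) \<and> ini < seps w (length w) \<and>
     (\<exists>p1<Suc (length w). \<exists>p2<Suc (length w).
        num_at w (Suc m) (seps w (length w)) p1 \<and> num_at w p1 ini p2 \<and>
        (letter w p2 = 14 \<or> letter w p2 = 15) \<and>
        (\<forall>i<length w. p2 \<le> i \<longrightarrow> letter w i = 14 \<longrightarrow>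
           (\<exists>a<seps w (length w). \<exists>b<seps w (length w). \<exists>j<Suc (length w). \<exists>j'<length w.
              num_at w (Suc i) a j \<and> num_at w j b j' \<and> (letter w j' = 14 \<or> letter w j' = 15))) \<and>
        (\<forall>i<length w. p2 \<le> i \<longrightarrow> letter w i = 15 \<or> letter w i = 3 \<and> 0 < seps w i \<longrightarrow>
           next_label A w (Suc i))) \<and>
     (\<forall>v<seps w (length w). \<exists>u<seps w (length w). edge_in w v u)"

lemma psdec_kripke_at [ps]:
  assumes "finite A" "pscomp f" "pscomp g"
  shows "psdec (\<lambda>w e. kripke_at A w (f w e) (g w e))"
proof -
  have "psdec (\<lambda>w e. kripke_at A w (e 0) (e 1))" unfolding kripke_at_def by (intro ps assms(1))
  from pscomp_comp2[of "\<lambda>w i j. of_bool (kripke_at A w i j)", OF this assms(2,3)] show ?thesis .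
qed

text \<open>In a correct instance the worlds are numbers below \<open>length w\<close>, so a set of
  worlds fits into as many bits as the word has letters.\<close>

definition reach :: "nat list \<Rightarrow> nat \<Rightarrow> nat \<Rightarrow> nat" where
  "reach w ini k = rec_nat (bitset (length w) (\<lambda>b. b = ini))
     (\<lambda>_ S. bitset (length w) (\<lambda>b. \<exists>a<length w. bit S a \<and> edge_in w a b)) k"

lemma pscomp_reach [ps]:
  assumes "pscomp f" "pscomp g"
  shows "pscomp (\<lambda>w e. reach w (f w e) (g w e))"
proof -
  have le: "reach w i k \<le> 2 ^ length w" for w i k
    unfolding reach_def by (cases k) (auto intro: less_imp_le[OF bitset_less])
  have "pscomp (\<lambda>w e. reach w (e 0) (e 1))"
    unfolding reach_def
    by (rule pscomp_rec[where B = "\<lambda>w e. 2 ^ length w"])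
       (intro ps psbounded_two_power_length le[unfolded reach_def])+
  from pscomp_comp2[of reach, OF this assms] show ?thesis .
qed

section \<open>Truth of atoms on a set of worlds\<close>

definition holds_pos :: "nat list \<Rightarrow> nat \<Rightarrow> nat \<Rightarrow> bool" where
  "holds_pos w S p \<longleftrightarrow> (\<forall>v<length w. bit S v \<longrightarrow> label_in w v p)"

definition holds_neg :: "nat list \<Rightarrow> nat \<Rightarrow> nat \<Rightarrow> bool" where
  "holds_neg w S p \<longleftrightarrow> (\<forall>v<length w. bit S v \<longrightarrow> \<not> label_in w v p)"

lemma psdec_holds [ps]:
  assumes "pscomp f" "pscomp g"
  shows "psdec (\<lambda>w e. holds_pos w (f w e) (g w e))" "psdec (\<lambda>w e. holds_neg w (f w e) (g w e))"
proof -
  have "psdec (\<lambda>w e. holds_pos w (e 0) (e 1))" "psdec (\<lambda>w e. holds_neg w (e 0) (e 1))"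
    unfolding holds_pos_def holds_neg_def by (intro ps)+
  from pscomp_comp2[of "\<lambda>w i j. of_bool (holds_pos w i j)", OF this(1) assms]
    pscomp_comp2[of "\<lambda>w i j. of_bool (holds_neg w i j)", OF this(2) assms]
  show "psdec (\<lambda>w e. holds_pos w (f w e) (g w e))" "psdec (\<lambda>w e. holds_neg w (f w e) (g w e))" .
qed

definition is_digit :: "nat \<Rightarrow> bool" where
  "is_digit x \<longleftrightarrow> x = 1 \<or> x = 2 \<or> x = 3"

lemma psdec_is_digit [ps]: "pscomp f \<Longrightarrow> psdec (\<lambda>w e. is_digit (f w e))"
  unfolding is_digit_def by (intro ps)

text \<open>\<open>stack_step\<close> passes over digits without inspecting them, so an atom must
  itself make sure that no further digit follows its number.\<close>

definition atom_at :: "nat set \<Rightarrow> nat list \<Rightarrow> nat \<Rightarrow> bool" where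
  "atom_at A w i \<longleftrightarrow> (\<exists>p<2 ^ length w. p \<in> A \<and>
     (\<exists>j<Suc (length w). num_at w (Suc i) p j \<and> \<not> is_digit (letter w j)))"

definition atom_pos :: "nat list \<Rightarrow> nat \<Rightarrow> nat \<Rightarrow> bool" where
  "atom_pos w S i \<longleftrightarrow> (\<exists>p<2 ^ length w. \<exists>j<Suc (length w). num_at w (Suc i) p j \<and> holds_pos w S p)"

definition atom_neg :: "nat list \<Rightarrow> nat \<Rightarrow> nat \<Rightarrow> bool" where
  "atom_neg w S i \<longleftrightarrow> (\<exists>p<2 ^ length w. \<exists>j<Suc (length w). num_at w (Suc i) p j \<and> holds_neg w S p)"

lemma psdec_atom_at [ps]:
  assumes "finite A" "pscomp f"
  shows "psdec (\<lambda>w e. atom_at A w (f w e))"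
proof -
  have "psdec (\<lambda>w e. atom_at A w (e 0))" unfolding atom_at_def by (intro ps assms(1))
  from pscomp_comp1[of "\<lambda>w i. of_bool (atom_at A w i)", OF this assms(2)] show ?thesis .
qed

lemma psdec_atom [ps]:
  assumes "pscomp f" "pscomp g"
  shows "psdec (\<lambda>w e. atom_pos w (f w e) (g w e))" "psdec (\<lambda>w e. atom_neg w (f w e) (g w e))"
proof -
  have "psdec (\<lambda>w e. atom_pos w (e 0) (e 1))" "psdec (\<lambda>w e. atom_neg w (e 0) (e 1))"
    unfolding atom_pos_def atom_neg_def by (intro ps)+
  from pscomp_comp2[of "\<lambda>w i j. of_bool (atom_pos w i j)", OF this(1) assms]
    pscomp_comp2[of "\<lambda>w i j. of_bool (atom_neg w i j)", OF this(2) assms]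
  show "psdec (\<lambda>w e. atom_pos w (f w e) (g w e))" "psdec (\<lambda>w e. atom_neg w (f w e) (g w e))" .
qed

text \<open>When \<open>r\<close> equals the left-hand side, the later positions have just become
  reliable; the operator then still takes the value of its empty iteration and may consult its own
  previous value only one step later. Hence the strict inequality.\<close>

definition active :: "nat list \<Rightarrow> nat \<Rightarrow> nat \<Rightarrow> bool" where
  "active w r i \<longleftrightarrow> (length w - i) * 2 ^ length w < r"

lemma psdec_active [ps]:
  assumes "pscomp f" "pscomp g"
  shows "psdec (\<lambda>w e. active w (f w e) (g w e))"
  unfolding active_def by (intro ps assms)

text \<open>The prefix notation of a formula is evaluated from right to left on a stack of truth values. The
  stack is a number whose binary digits are the truth values, the top being the least significant
  one, below a leading digit 1 for the bottom of the stack; 0 signals a syntax error. The letter 13, which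
  follows the formula, restarts the evaluation with the empty stack. \<open>S\<close> is the set of worlds at the
  present instant; bit \<open>i\<close> of \<open>V\<close> is the value at the next instant of the subformula at position \<open>i\<close>.\<close>

definition stack_step :: "nat set \<Rightarrow> nat list \<Rightarrow> nat \<Rightarrow> nat \<Rightarrow> nat \<Rightarrow> nat \<Rightarrow> nat \<Rightarrow> nat" where
  "stack_step A w S V r i y =
    (if is_digit (letter w i) then y
     else if letter w i = 13 then 1
     else if y = 0 then 0
     else if letter w i = 4 then (if atom_at A w i then 2 * y + of_bool (atom_pos w S i) else 0)
     else if letter w i = 5 then (if atom_at A w i then 2 * y + of_bool (atom_neg w S i) else 0)
     else if is_digit (letter w (Suc i)) \<or> y < 2 then 0
     else if letter w i = 8 then 2 * (y div 2) + of_bool (bit V (Suc i))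
     else if letter w i = 9 then
       2 * (y div 2) + of_bool (odd y \<or> active w r i \<and> bit V i)
     else if letter w i = 10 then
       2 * (y div 2) + of_bool (odd y \<and> (active w r i \<longrightarrow> bit V i))
     else if y < 4 then 0
     else if letter w i = 6 then 2 * (y div 2 div 2) + of_bool (odd y \<and> odd (y div 2))
     else if letter w i = 11 then 2 * (y div 2 div 2) + of_bool (odd (y div 2) \<or>
       odd y \<and> active w r i \<and> bit V i)
     else if letter w i = 12 then 2 * (y div 2 div 2) + of_bool (odd (y div 2) \<and>
       (odd y \<or> (active w r i \<longrightarrow> bit V i)))
     else 0)"

lemma pscomp_stack_step [ps]:
  assumes "finite A" "pscomp f" "pscomp g" "pscomp h" "pscomp k" "pscomp l"
  shows "pscomp (\<lambda>w e. stack_step A w (f w e) (g w e) (h w e) (k w e) (l w e))"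
proof -
  have "pscomp (\<lambda>w e. stack_step A w (e 0) (e 1) (e 2) (e 3) (e 4))"
    unfolding stack_step_def by (intro ps assms(1))
  from pscomp_comp5[of "stack_step A", OF this assms(2-)] show ?thesis .
qed

definition stack :: "nat set \<Rightarrow> nat list \<Rightarrow> nat \<Rightarrow> nat \<Rightarrow> nat \<Rightarrow> nat \<Rightarrow> nat" where
  "stack A w S V r n = rec_nat 0 (\<lambda>n y. stack_step A w S V r (length w - Suc n) y) n"

text \<open>A letter appends at most one binary digit to the stack.\<close>

lemma stack_less: "stack A w S V r n < 2 ^ n"
proof (induction n)
  case (Suc n)
  have "stack_step A w S V r i y < 2 * m" if "y < m" for i y m
    using that unfolding stack_step_def by (auto simp: of_bool_def)
  then show ?case using Suc by (simp add: stack_def)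
qed (simp add: stack_def)

lemma pscomp_stack [ps]:
  assumes A: "finite A" and "pscomp f" "pscomp g" "pscomp h" "pscomp k"
  shows "pscomp (\<lambda>w e. stack A w (f w e) (g w e) (h w e) (length w - k w e))"
proof -
  have le: "stack A w S V r n \<le> 2 ^ length w" if "n \<le> length w - i" for w S V r n i
  proof -
    have "(2::nat) ^ n \<le> 2 ^ length w" using that by (intro power_increasing) auto
    then show ?thesis using stack_less[of A w S V r n] by linarith
  qed
  have "pscomp (\<lambda>w e. stack A w (e 0) (e 1) (e 2) (length w - e 3))"
    unfolding stack_def
    by (rule pscomp_rec[where B = "\<lambda>w e. 2 ^ length w"])
       (erule le[unfolded stack_def] | intro ps A psbounded_two_power_length)+
  from pscomp_comp4[of "\<lambda>w S V r i. stack A w S V r (length w - i)", OF this assms(2-)] show ?thesis .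
qed

text \<open>\<open>truth_vec A w ini r\<close> holds the truth values of the subformulas at instant
  \<open>horizon w - r\<close>. They are computed backwards in time; a temporal operator at position \<open>i\<close> is started
  with the value of its empty iteration only when its arguments, which are at later positions, have
  become reliable, and becomes reliable itself after another \<open>2 ^ length w\<close> steps.\<close>

definition horizon :: "nat list \<Rightarrow> nat" where
  "horizon w = Suc (length w) * 2 ^ length w"

definition truth_vec :: "nat set \<Rightarrow> nat list \<Rightarrow> nat \<Rightarrow> nat \<Rightarrow> nat" where
  "truth_vec A w ini r = rec_nat 0 (\<lambda>r V. bitset (length w)
     (\<lambda>i. odd (stack A w (reach w ini (horizon w - Suc r)) V (Suc r) (length w - i)))) r"

lemma pscomp_truth_vec [ps]:
  assumes A: "finite A" and "pscomp f" "pscomp g"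
  shows "pscomp (\<lambda>w e. truth_vec A w (f w e) (g w e))"
proof -
  have le: "truth_vec A w i r \<le> 2 ^ length w" for w i r
    unfolding truth_vec_def by (cases r) (auto intro: less_imp_le[OF bitset_less])
  have "pscomp (\<lambda>w e. truth_vec A w (e 0) (e 1))"
    unfolding truth_vec_def horizon_def
    by (rule pscomp_rec[where B = "\<lambda>w e. 2 ^ length w"])
       (rule le[unfolded truth_vec_def horizon_def] | intro ps A psbounded_two_power_length)+
  from pscomp_comp2[of "truth_vec A", OF this assms(2-)] show ?thesis .
qed

text \<open>3 is binary 11, the bottom of the stack and one true value: a single formula precedes
  the letter 13, and it holds at instant 0. As \<open>stack_step\<close> passes over digits, a
  leading digit has to be excluded separately.\<close>

definition accepts :: "nat set \<Rightarrow> nat list \<Rightarrow> bool" where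
  "accepts A w \<longleftrightarrow> (\<exists>m<length w. \<exists>ini<length w. kripke_at A w m ini \<and> \<not> is_digit (letter w 0) \<and>
     stack A w (reach w ini 0) (truth_vec A w ini (horizon w - 1)) (horizon w) (length w - 0) = 3)"

lemma psdec_accepts:
  assumes "finite A"
  shows "psdec (\<lambda>w e. accepts A w)"
  unfolding accepts_def horizon_def by (intro ps assms)

section \<open>Encodings of numbers, edges and labels\<close>


declare enc_nat.simps [simp del]

lemma enc_nat_0: "enc_nat 0 = [3]"
  by (simp add: enc_nat.simps)

lemma enc_nat_pos: "n \<noteq> 0 \<Longrightarrow> enc_nat n = digit n # enc_nat (n div 2)"
  by (subst enc_nat.simps) (simp add: digit_def even_iff_mod_2_eq_zero)

lemma enc_nat_not_Nil [simp]: "enc_nat n \<noteq> []"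
  by (subst enc_nat.simps) simp

lemma enc_nat_induct [case_names zero pos]:
  assumes "P (0::nat)" "\<And>n. n \<noteq> 0 \<Longrightarrow> P (n div 2) \<Longrightarrow> P n"
  shows "P n"
proof (induction n rule: less_induct)
  case (less n)
  then show ?case using assms by (cases "n = 0") auto
qed

lemma enc_nat_nth: "l < length (enc_nat n) \<Longrightarrow> enc_nat n ! l = digit (n div 2 ^ l)"
proof (induction n arbitrary: l rule: enc_nat_induct)
  case zero
  then show ?case by (simp add: enc_nat_0 digit_def)
next
  case (pos n)
  then show ?case by (cases l) (simp_all add: enc_nat_pos div_mult2_eq)
qed

lemma length_enc_nat:
  "length (enc_nat n) = Suc k \<longleftrightarrow> n div 2 ^ k = 0 \<and> (\<forall>l<k. n div 2 ^ l \<noteq> 0)"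
proof (induction n arbitrary: k rule: enc_nat_induct)
  case zero
  then show ?case by (auto simp: enc_nat_0)
next
  case (pos n)
  show ?case
  proof (cases k)
    case 0
    then show ?thesis using pos(1) by (simp add: enc_nat_pos)
  next
    case (Suc k')
    have "(\<forall>l<Suc k'. n div 2 ^ l \<noteq> 0) \<longleftrightarrow> n \<noteq> 0 \<and> (\<forall>l<k'. n div 2 div 2 ^ l \<noteq> 0)"
      by (subst All_less_Suc2) (simp only: power_Suc div_mult2_eq power_0 div_by_1)
    moreover have "length (enc_nat n) = Suc k \<longleftrightarrow> length (enc_nat (n div 2)) = Suc k'"
      using pos(1) Suc by (simp add: enc_nat_pos)
    moreover have "n div 2 ^ k = n div 2 div 2 ^ k'"
      by (simp only: Suc power_Suc div_mult2_eq)
    ultimately show ?thesis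
      using pos(1) pos.IH[of k'] Suc by simp
  qed
qed

lemma enc_nat_less: "n < 2 ^ length (enc_nat n)"
proof -
  obtain k where k: "length (enc_nat n) = Suc k" by (cases "enc_nat n") auto
  then have "n div 2 ^ k = 0" by (simp only: length_enc_nat)
  then have "n < 2 ^ k" by (simp add: div_eq_0_iff)
  then show ?thesis by (simp add: k)
qed

lemma set_enc_nat: "set (enc_nat n) \<subseteq> {1, 2, 3}"
  by (induction n rule: enc_nat_induct) (auto simp: enc_nat_0 enc_nat_pos digit_def)

lemma enc_nat_snoc: "\<exists>ds. enc_nat n = ds @ [3] \<and> 3 \<notin> set ds"
proof (induction n rule: enc_nat_induct)
  case (pos n)
  then obtain ds where "enc_nat (n div 2) = ds @ [3]" "3 \<notin> set ds" by blast
  then show ?case using pos(1) by (intro exI[of _ "digit n # ds"]) (simp add: enc_nat_pos digit_def)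
qed (simp add: enc_nat_0)

lemma enc_nat_append_inject:
  "enc_nat a @ r = enc_nat b @ r' \<Longrightarrow> a = b \<and> r = r'"
proof (induction a arbitrary: b rule: enc_nat_induct)
  case zero
  then show ?case by (cases "b = 0") (auto simp: enc_nat_0 enc_nat_pos digit_def split: if_splits)
next
  case (pos a)
  show ?case
  proof (cases "b = 0")
    case True
    then show ?thesis using pos(1) pos.prems
      by (auto simp: enc_nat_0 enc_nat_pos digit_def split: if_splits)
  next
    case False
    then have *: "digit a = digit b" "enc_nat (a div 2) @ r = enc_nat (b div 2) @ r'"
      using pos(1) pos.prems by (simp_all add: enc_nat_pos)
    have "even a = even b" using *(1) pos(1) False by (auto simp: digit_def split: if_splits)
    moreover have "a div 2 = b div 2" "r = r'" using pos.IH[OF *(2)] by auto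
    ultimately show ?thesis by presburger
  qed
qed

lemma num_at_iff:
  "num_at w i n j \<longleftrightarrow> j = i + length (enc_nat n) \<and> (\<exists>r. drop i w = enc_nat n @ r)"
proof -
  have "(\<exists>r. drop i w = enc_nat n @ r) \<longleftrightarrow>
      i + length (enc_nat n) \<le> length w \<and> (\<forall>l<length (enc_nat n). w ! (i + l) = enc_nat n ! l)"
  proof
    assume "\<exists>r. drop i w = enc_nat n @ r"
    then obtain r where r: "drop i w = enc_nat n @ r" by blast
    from arg_cong[OF r, of length] have len: "length w - i = length (enc_nat n) + length r" by simp
    moreover have "0 < length (enc_nat n)" by simp
    ultimately have le: "i + length (enc_nat n) \<le> length w" by linarith
    have "w ! (i + l) = enc_nat n ! l" if "l < length (enc_nat n)" for l
    proof -
      have "w ! (i + l) = drop i w ! l" using le that by simp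
      also have "\<dots> = enc_nat n ! l" unfolding r by (simp add: nth_append that)
      finally show ?thesis .
    qed
    with le show "i + length (enc_nat n) \<le> length w \<and> (\<forall>l<length (enc_nat n). w ! (i + l) = enc_nat n ! l)"
      by simp
  next
    assume a: "i + length (enc_nat n) \<le> length w \<and> (\<forall>l<length (enc_nat n). w ! (i + l) = enc_nat n ! l)"
    then have "take (length (enc_nat n)) (drop i w) = enc_nat n"
      by (intro nth_equalityI) auto
    then show "\<exists>r. drop i w = enc_nat n @ r" by (metis append_take_drop_id)
  qed
  moreover have "num_at w i n j \<longleftrightarrow> j = i + length (enc_nat n) \<and>
      i + length (enc_nat n) \<le> length w \<and> (\<forall>l<length (enc_nat n). w ! (i + l) = enc_nat n ! l)"
  proof (cases "i < j")
    case True
    then have "length (enc_nat n) = Suc (j - Suc i) \<longleftrightarrow> j = i + length (enc_nat n)" by auto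
    then have "n div 2 ^ (j - Suc i) = 0 \<and> (\<forall>l<j - Suc i. n div 2 ^ l \<noteq> 0) \<longleftrightarrow> j = i + length (enc_nat n)"
      using length_enc_nat[of n "j - Suc i"] by simp
    then show ?thesis
      unfolding num_at_def using True by (auto simp: letter_def enc_nat_nth)
  next
    case False
    then show ?thesis by (auto simp: num_at_def)
  qed
  ultimately show ?thesis by simp
qed

lemma num_atD:
  assumes "num_at w i n j"
  shows "drop i w = enc_nat n @ drop j w" "i < j" "j \<le> length w" "n < 2 ^ length w" "letter w (j - 1) = 3"
proof -
  from assms obtain r where r: "j = i + length (enc_nat n)" "drop i w = enc_nat n @ r"
    by (auto simp: num_at_iff)
  have "drop j w = drop (length (enc_nat n)) (drop i w)" using r(1) by (simp add: add.commute)
  then show "drop i w = enc_nat n @ drop j w" using r(2) by simp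
  show *: "i < j" "j \<le> length w" using assms by (auto simp: num_at_def)
  have "(2::nat) ^ length (enc_nat n) \<le> 2 ^ length w" using r(1) * by (intro power_increasing) auto
  then show "n < 2 ^ length w" using enc_nat_less[of n] by linarith
  have "j - Suc i < j - i" using * by simp
  then have "letter w (i + (j - Suc i)) = digit (n div 2 ^ (j - Suc i))" "n div 2 ^ (j - Suc i) = 0"
    using assms unfolding num_at_def by blast+
  moreover have "i + (j - Suc i) = j - 1" using * by simp
  ultimately show "letter w (j - 1) = 3" by (simp add: digit_def)
qed

lemma drop_letter: "i < length w \<Longrightarrow> drop i w = letter w i # drop (Suc i) w"
  by (simp add: letter_def Cons_nth_drop_Suc)

lemma letter_eq_iff:
  assumes "x \<noteq> 0"
  shows "letter w i = x \<longleftrightarrow> (\<exists>r. drop i w = x # r)"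
proof (cases "i < length w")
  case True
  then show ?thesis using drop_letter[OF True] by auto
next
  case False
  then show ?thesis using assms by (simp add: letter_def)
qed

lemma seps_count: "i \<le> length w \<Longrightarrow> seps w i = count_list (take i w) 15"
proof (induction i)
  case (Suc i)
  then show ?case
    by (simp add: seps_def take_Suc_conv_app_nth letter_def)
qed (simp add: seps_def)

lemma seps_length: "seps w (length w) = count_list w 15"
  by (simp add: seps_count)

lemma seps_mono: "i \<le> j \<Longrightarrow> seps w i \<le> seps w j"
  unfolding seps_def by (intro sum_mono2) auto

lemma edge_in_iff: "edge_in w a b \<longleftrightarrow> (\<exists>pre r. w = pre @ 14 # enc_nat a @ enc_nat b @ r)"
proof
  assume "edge_in w a b"
  then obtain i j j' where *: "i < length w" "letter w i = 14" "num_at w (Suc i) a j" "num_at w j b j'"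
    by (auto simp: edge_in_def)
  have "w = take i w @ 14 # enc_nat a @ enc_nat b @ drop j' w"
    using num_atD(1)[OF *(3)] num_atD(1)[OF *(4)] drop_letter[OF *(1)] *(2)
      append_take_drop_id[of i w] by simp
  then show "\<exists>pre r. w = pre @ 14 # enc_nat a @ enc_nat b @ r" by blast
next
  assume "\<exists>pre r. w = pre @ 14 # enc_nat a @ enc_nat b @ r"
  then obtain pre r where w: "w = pre @ 14 # enc_nat a @ enc_nat b @ r" by blast
  let ?j = "Suc (length pre) + length (enc_nat a)"
  have "num_at w (Suc (length pre)) a ?j" "num_at w ?j b (?j + length (enc_nat b))"
    by (auto simp: num_at_iff w)
  moreover have "letter w (length pre) = 14" by (simp add: w letter_def)
  ultimately show "edge_in w a b"
    unfolding edge_in_def using num_atD(3) by (metis less_Suc_eq_le not_le_imp_less letter_def zero_neq_numeral)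
qed

lemma label_in_iff:
  "label_in w v p \<longleftrightarrow> (\<exists>pre x r. w = pre @ x # enc_nat p @ r \<and> x \<in> {15, 3} \<and>
     count_list (pre @ [x]) 15 = Suc v)"
proof
  assume "label_in w v p"
  then obtain i j where *: "i < length w" "letter w i \<in> {15, 3}" "seps w (Suc i) = Suc v" "num_at w (Suc i) p j"
    by (auto simp: label_in_def)
  have "w = take i w @ letter w i # enc_nat p @ drop j w"
    using num_atD(1)[OF *(4)] drop_letter[OF *(1)] append_take_drop_id[of i w] by simp
  moreover have "take i w @ [letter w i] = take (Suc i) w"
    using *(1) by (simp add: take_Suc_conv_app_nth letter_def)
  ultimately show "\<exists>pre x r. w = pre @ x # enc_nat p @ r \<and> x \<in> {15, 3} \<and>
     count_list (pre @ [x]) 15 = Suc v" using * seps_count[of "Suc i" w] by (metis Suc_leI)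
next
  assume "\<exists>pre x r. w = pre @ x # enc_nat p @ r \<and> x \<in> {15, 3} \<and>
     count_list (pre @ [x]) 15 = Suc v"
  then obtain pre x r where w: "w = pre @ x # enc_nat p @ r" "x \<in> {15, 3}"
    "count_list (pre @ [x]) 15 = Suc v" by blast
  let ?i = "length pre"
  have "num_at w (Suc ?i) p (Suc ?i + length (enc_nat p))" by (auto simp: num_at_iff w)
  moreover have "letter w ?i = x" by (simp add: w letter_def)
  moreover have "seps w (Suc ?i) = Suc v" using w(3) by (simp add: seps_count w(1))
  moreover have "?i < length w" by (simp add: w(1))
  ultimately show "label_in w v p"
    unfolding label_in_def using num_atD(3) w(2) by (metis insertE less_Suc_eq_le singletonD)
qed

abbreviation enc_edges :: "(nat \<times> nat) list \<Rightarrow> nat list" where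
  "enc_edges es \<equiv> concat (map (\<lambda>(a, b). 14 # enc_nat a @ enc_nat b) es)"

abbreviation enc_nats :: "nat list \<Rightarrow> nat list" where
  "enc_nats l \<equiv> concat (map enc_nat l)"

abbreviation enc_labels :: "nat list list \<Rightarrow> nat list" where
  "enc_labels ls \<equiv> concat (map (\<lambda>l. 15 # enc_nats l) ls)"

section \<open>Unique factorisation of encoded edges and labels\<close>

lemma append_eq_split:
  assumes "xs @ ys = pre @ x # suf" "x \<notin> set xs"
  obtains pre' where "pre = xs @ pre'" "ys = pre' @ x # suf"
  using assms by (auto simp: append_eq_append_conv2 append_eq_Cons_conv)

lemma enc_nats_letters: "set (enc_nats l) \<subseteq> {1, 2, 3}"
  using set_enc_nat by fastforce

lemma enc_labels_letters: "set (enc_labels ls) \<subseteq> {1, 2, 3, 15}"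
proof (induction ls)
  case (Cons l ls)
  then show ?case using enc_nats_letters[of l] by auto
qed simp

lemma enc_edges_letters: "set (enc_edges es) \<subseteq> {1, 2, 3, 14}"
proof (induction es)
  case (Cons e es)
  then show ?case using set_enc_nat[of "fst e"] set_enc_nat[of "snd e"] by (auto split: prod.splits)
qed simp

text \<open>Since 14 is no digit, every occurrence of it opens the code of an edge.\<close>

lemma enc_edges_split:
  assumes "enc_edges es @ q = pre @ 14 # suf" "14 \<notin> set q"
  shows "\<exists>a b es2. (a, b) \<in> set es \<and> set es2 \<subseteq> set es \<and> suf = enc_nat a @ enc_nat b @ enc_edges es2 @ q"
  using assms(1)
proof (induction es arbitrary: pre)
  case Nil
  then show ?case using assms(2) by simp
next
  case (Cons ab es)
  obtain a b where ab: "ab = (a, b)" by (cases ab)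
  show ?case
  proof (cases pre)
    case Nil
    then show ?thesis
      using Cons.prems ab by (intro exI[of _ a] exI[of _ b] exI[of _ es]) auto
  next
    case (Cons y pre')
    then have eq: "(enc_nat a @ enc_nat b) @ (enc_edges es @ q) = pre' @ 14 # suf"
      using Cons.prems ab by simp
    have "14 \<notin> set (enc_nat a @ enc_nat b)" using set_enc_nat[of a] set_enc_nat[of b] by auto
    from append_eq_split[OF eq this] obtain pre'' where "enc_edges es @ q = pre'' @ 14 # suf" by blast
    from Cons.IH[OF this] obtain a' b' es2 where "(a', b') \<in> set es" "set es2 \<subseteq> set es"
      "suf = enc_nat a' @ enc_nat b' @ enc_edges es2 @ q" by blast
    then show ?thesis by (intro exI[of _ a'] exI[of _ b'] exI[of _ es2]) auto
  qed
qed

lemma enc_nats_split: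
  assumes "enc_nats l = pre @ 3 # suf"
  shows "\<exists>l1 l2. l = l1 @ l2 \<and> suf = enc_nats l2"
  using assms
proof (induction l arbitrary: pre)
  case (Cons n l)
  obtain ds where ds: "enc_nat n = ds @ [3]" "3 \<notin> set ds" using enc_nat_snoc by blast
  with Cons.prems have "ds @ (3 # enc_nats l) = pre @ 3 # suf" by simp
  from append_eq_split[OF this ds(2)] obtain pre' where p: "3 # enc_nats l = pre' @ 3 # suf" by blast
  show ?case
  proof (cases pre')
    case Nil
    then show ?thesis using p by (intro exI[of _ "[n]"] exI[of _ l]) simp
  next
    case (Cons y pre'')
    then have "enc_nats l = pre'' @ 3 # suf" using p by simp
    from Cons.IH[OF this] obtain l1 l2 where "l = l1 @ l2" "suf = enc_nats l2" by blast
    then show ?thesis by (intro exI[of _ "n # l1"] exI[of _ l2]) simp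
  qed
qed simp

text \<open>The letters 15 and 3 occur exactly at the boundaries between items, so what follows is a
  rest \<open>l2\<close> of one label and then the remaining labels; the number of letters 15 read
  so far identifies that label.\<close>

lemma enc_labels_split:
  assumes "enc_labels ls = pre @ x # suf" "x \<in> {15, 3}"
  shows "\<exists>ls1 l1 l2 ls2. ls = ls1 @ (l1 @ l2) # ls2 \<and> suf = enc_nats l2 @ enc_labels ls2 \<and>
    count_list (pre @ [x]) 15 = Suc (length ls1)"
  using assms(1)
proof (induction ls arbitrary: pre)
  case (Cons l ls)
  have no15: "count_list xs 15 = 0" if "set xs \<subseteq> {1, 2, 3}" for xs :: "nat list"
    using that by (induction xs) auto
  show ?case
  proof (cases pre)
    case Nil
    then show ?thesis using Cons.prems
      by (intro exI[of _ "[]"] exI[of _ "[]"] exI[of _ l] exI[of _ ls]) auto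
  next
    case (Cons y pre')
    then have y: "y = 15" and eq: "enc_nats l @ enc_labels ls = pre' @ x # suf"
      using Cons.prems by auto
    then consider us where "enc_nats l = pre' @ x # us" "suf = us @ enc_labels ls"
      | pre'' where "pre' = enc_nats l @ pre''" "enc_labels ls = pre'' @ x # suf"
      by (auto simp: append_eq_append_conv2 append_eq_Cons_conv Cons_eq_append_conv)
    then show ?thesis
    proof cases
      case 1
      have "set (pre' @ x # us) \<subseteq> {1, 2, 3}" using enc_nats_letters[of l] unfolding 1(1) .
      then have x: "x = 3" "count_list pre' 15 = 0" using assms(2) no15[of pre'] by auto
      from 1(1) x enc_nats_split obtain l1 l2 where "l = l1 @ l2" "us = enc_nats l2" by blast
      then show ?thesis using x y Cons 1(2)
        by (intro exI[of _ "[]"] exI[of _ l1] exI[of _ l2] exI[of _ ls]) simp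
    next
      case 2
      from Cons.IH[OF 2(2)] obtain ls1 l1 l2 ls2 where
        "ls = ls1 @ (l1 @ l2) # ls2" "suf = enc_nats l2 @ enc_labels ls2"
        "count_list (pre'' @ [x]) 15 = Suc (length ls1)" by blast
      then show ?thesis using y Cons 2(1) no15[OF enc_nats_letters[of l]]
        by (intro exI[of _ "l # ls1"] exI[of _ l1] exI[of _ l2] exI[of _ ls2]) simp
    qed
  qed
qed simp

lemma count_enc_labels: "count_list (enc_labels ls) 15 = length ls"
proof (induction ls)
  case (Cons l ls)
  have "15 \<notin> set (enc_nats l)" using enc_nats_letters[of l] by auto
  then have "count_list (enc_nats l) 15 = 0" by (simp add: count_list_0_iff)
  then show ?case using Cons by simp
qed simp

section \<open>Encodings of Kripke structures\<close>


lemma append_eq_cases: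
  assumes "xs @ ys = pre @ x # suf"
  obtains us where "xs = pre @ x # us" "suf = us @ ys" | pre' where "pre = xs @ pre'" "ys = pre' @ x # suf"
  using assms by (auto simp: append_eq_append_conv2 append_eq_Cons_conv)

text \<open>The number of worlds is taken to be the number of labels, and \<open>F\<close> stands
  for the formula part, of which only the range of its letters matters here.\<close>

definition kripke_word :: "nat list \<Rightarrow> nat \<Rightarrow> (nat \<times> nat) list \<Rightarrow> nat list list \<Rightarrow> nat list" where
  "kripke_word F ini es ls = F @ 13 # enc_nat (length ls) @ enc_nat ini @ enc_edges es @ enc_labels ls"

lemma count_list_notin: "x \<notin> set xs \<Longrightarrow> count_list xs x = 0"
  by (simp add: count_list_0_iff)

lemma kripke_word_letters:
  assumes "set F \<subseteq> {1..12}" "x \<in> {14, 15}"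
  shows "x \<notin> set (F @ 13 # enc_nat n @ enc_nat ini)"
    "15 \<notin> set (F @ 13 # enc_nat n @ enc_nat ini @ enc_edges es)"
  using assms set_enc_nat[of n] set_enc_nat[of ini] enc_edges_letters[of es] by fastforce+

lemma seps_kripke_word:
  assumes "set F \<subseteq> {1..12}"
  shows "seps (kripke_word F ini es ls) (length (kripke_word F ini es ls)) = length ls"
proof -
  have eq: "kripke_word F ini es ls =
      (F @ 13 # enc_nat (length ls) @ enc_nat ini @ enc_edges es) @ enc_labels ls"
    by (simp add: kripke_word_def)
  show ?thesis
    unfolding seps_length unfolding eq count_list_append count_enc_labels
    using count_list_notin[OF kripke_word_letters(2)[OF assms, of 15]] by simp
qed

lemma edge_in_kripke_word:
  assumes "set F \<subseteq> {1..12}"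
  shows "edge_in (kripke_word F ini es ls) a b \<longleftrightarrow> (a, b) \<in> set es"
proof
  let ?H = "F @ 13 # enc_nat (length ls) @ enc_nat ini"
  assume "edge_in (kripke_word F ini es ls) a b"
  then obtain pre r where "kripke_word F ini es ls = pre @ 14 # enc_nat a @ enc_nat b @ r"
    by (auto simp: edge_in_iff)
  then have eq: "?H @ enc_edges es @ enc_labels ls = pre @ 14 # enc_nat a @ enc_nat b @ r"
    by (simp add: kripke_word_def)
  have "14 \<notin> set ?H" by (rule kripke_word_letters(1)[OF assms]) simp
  from append_eq_split[OF eq this]
  obtain pre' where p: "enc_edges es @ enc_labels ls = pre' @ 14 # enc_nat a @ enc_nat b @ r" by blast
  have "14 \<notin> set (enc_labels ls)" by (intro notI) (drule subsetD[OF enc_labels_letters], simp)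
  from enc_edges_split[OF p this] obtain a' b' es2 where *: "(a', b') \<in> set es"
    "enc_nat a @ enc_nat b @ r = enc_nat a' @ enc_nat b' @ enc_edges es2 @ enc_labels ls" by blast
  from enc_nat_append_inject[OF *(2)] have "a = a'"
    "enc_nat b @ r = enc_nat b' @ enc_edges es2 @ enc_labels ls" by blast+
  moreover from enc_nat_append_inject[OF this(2)] have "b = b'" by blast
  ultimately show "(a, b) \<in> set es" using *(1) by simp
next
  assume "(a, b) \<in> set es"
  then obtain es1 es2 where es: "es = es1 @ (a, b) # es2" by (meson split_list)
  have "kripke_word F ini es ls = (F @ 13 # enc_nat (length ls) @ enc_nat ini @ enc_edges es1)
      @ 14 # enc_nat a @ enc_nat b @ enc_edges es2 @ enc_labels ls"
    by (simp add: kripke_word_def es)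
  then show "edge_in (kripke_word F ini es ls) a b" unfolding edge_in_iff by blast
qed

lemma label_in_kripke_word:
  assumes "set F \<subseteq> {1..12}"
  shows "label_in (kripke_word F ini es ls) v p \<longleftrightarrow> v < length ls \<and> p \<in> set (ls ! v)"
proof
  let ?G = "F @ 13 # enc_nat (length ls) @ enc_nat ini @ enc_edges es"
  have G: "15 \<notin> set ?G" by (rule kripke_word_letters(2)[OF assms, of 15]) simp
  have w: "kripke_word F ini es ls = ?G @ enc_labels ls" by (simp add: kripke_word_def)
  {
    assume "label_in (kripke_word F ini es ls) v p"
    then obtain pre x r where *: "?G @ enc_labels ls = pre @ x # enc_nat p @ r" "x \<in> {15, 3}"
      "count_list (pre @ [x]) 15 = Suc v"
      unfolding label_in_iff w by blast
    \<comment> \<open>An occurrence inside \<open>?G\<close> would have no letter 15 up to and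
      including \<open>x\<close>, against the count.\<close>
    obtain pre' where p: "enc_labels ls = pre' @ x # enc_nat p @ r" "pre = ?G @ pre'"
      using *(1)
    proof (cases rule: append_eq_cases)
      case (1 us)
      then have "set (pre @ [x]) \<subseteq> set ?G" by (metis Un_upper1 append.assoc append_Cons append_Nil set_append)
      then have "15 \<notin> set (pre @ [x])" using G by blast
      then show ?thesis using *(3) count_list_notin by fastforce
    next
      case (2 pre')
      show ?thesis by (rule that[OF 2(2,1)])
    qed
    from enc_labels_split[OF p(1) *(2)] obtain ls1 l1 l2 ls2 where
      s: "ls = ls1 @ (l1 @ l2) # ls2" "enc_nat p @ r = enc_nats l2 @ enc_labels ls2"
        "count_list (pre' @ [x]) 15 = Suc (length ls1)" by blast
    have v: "v = length ls1" using *(3) s(3) count_list_notin[OF G] p(2) by (simp only: count_list_append)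
    \<comment> \<open>If \<open>l2\<close> were empty, the first digit of \<open>enc_nat p\<close>
      would have to be the opening 15 of the next label or lie past the end.\<close>
    have "p \<in> set l2"
    proof (cases l2)
      case Nil
      obtain c cs where c: "enc_nat p = c # cs" "c \<in> {1, 2, 3}"
        using set_enc_nat[of p] by (cases "enc_nat p") auto
      have "enc_labels ls2 = c # cs @ r" using s(2) Nil c(1) by simp
      then show ?thesis using c(2) by (cases ls2) auto
    next
      case (Cons p' l2')
      then have "enc_nat p @ r = enc_nat p' @ enc_nats l2' @ enc_labels ls2" using s(2) by simp
      from enc_nat_append_inject[OF this] show ?thesis using Cons by simp
    qed
    then show "v < length ls \<and> p \<in> set (ls ! v)" using v s(1) by simp
  }
  {
    assume v: "v < length ls \<and> p \<in> set (ls ! v)"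
    then obtain l1 l2 where l: "ls ! v = l1 @ p # l2" by (meson split_list)
    define ls1 ls2 where "ls1 = take v ls" "ls2 = drop (Suc v) ls"
    have ls: "ls = ls1 @ (l1 @ p # l2) # ls2" "length ls1 = v"
      using v id_take_nth_drop[of v ls] by (auto simp: ls1_ls2_def l)
    have no15: "count_list (enc_nats l1) 15 = 0" using enc_nats_letters[of l1] by (auto simp: count_list_0_iff)
    \<comment> \<open>The letter in front of \<open>p\<close> is the opening 15 or the terminator of
      the number before it.\<close>
    obtain pre x where px: "15 # enc_nats l1 = pre @ [x]" "x \<in> {15, 3}"
    proof (cases l1 rule: rev_cases)
      case Nil
      then show ?thesis using that[of "[]" 15] by simp
    next
      case (snoc l1' q)
      then show ?thesis using enc_nat_snoc[of q] that by fastforce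
    qed
    have "?G @ enc_labels ls = (?G @ enc_labels ls1 @ pre) @ x # enc_nat p @ enc_nats l2 @ enc_labels ls2"
      using px(1) by (subst (2) ls(1)) simp
    moreover have "count_list ((?G @ enc_labels ls1 @ pre) @ [x]) 15 = Suc v"
      using count_list_notin[OF G] px(1)[symmetric] no15 ls(2)
      by (simp only: append.assoc count_list_append count_enc_labels) simp
    ultimately show "label_in (kripke_word F ini es ls) v p"
      unfolding label_in_iff w using px(2) by blast
  }
qed

definition wf_parts :: "nat set \<Rightarrow> nat \<Rightarrow> (nat \<times> nat) list \<Rightarrow> nat list list \<Rightarrow> bool" where
  "wf_parts A ini es ls \<longleftrightarrow> ini < length ls \<and> (\<forall>l\<in>set ls. set l \<subseteq> A) \<and>
     (\<forall>(a, b)\<in>set es. a < length ls \<and> b < length ls) \<and> (\<forall>v<length ls. \<exists>u. (v, u) \<in> set es)"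

lemma kripke_at_kripke_word:
  assumes F: "set F \<subseteq> {1..12}" and wf: "wf_parts A ini es ls"
  shows "kripke_at A (kripke_word F ini es ls) (length F) ini"
proof -
  define w where "w = kripke_word F ini es ls"
  define m where "m = length F"
  define n where "n = length ls"
  have seps: "seps w (length w) = n" unfolding w_def n_def by (rule seps_kripke_word[OF F])
  have w: "w = F @ 13 # enc_nat n @ enc_nat ini @ enc_edges es @ enc_labels ls"
    by (simp add: w_def n_def kripke_word_def)
  define p1 where "p1 = Suc m + length (enc_nat n)"
  define p2 where "p2 = p1 + length (enc_nat ini)"
  have dm: "drop (Suc m) w = enc_nat n @ enc_nat ini @ enc_edges es @ enc_labels ls"
    by (simp add: w m_def)
  have num1: "num_at w (Suc m) n p1" using dm by (auto simp: num_at_iff p1_def)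
  have d1: "drop p1 w = enc_nat ini @ enc_edges es @ enc_labels ls"
    using num_atD(1)[OF num1] dm by simp
  have num2: "num_at w p1 ini p2" using d1 by (auto simp: num_at_iff p2_def)
  have d2: "drop p2 w = enc_edges es @ enc_labels ls"
    using num_atD(1)[OF num2] d1 by simp
  have ls0: "ls \<noteq> []" using wf by (auto simp: wf_parts_def)
  have start: "letter w j = 14 \<or> letter w j = 15" "j < length w"
    if "drop j w = enc_edges es' @ enc_labels ls" for j es'
  proof -
    have "\<exists>x r. enc_edges es' @ enc_labels ls = x # r \<and> (x = 14 \<or> x = 15)"
      using ls0 by (cases es'; cases ls) (auto split: prod.splits)
    then show "letter w j = 14 \<or> letter w j = 15" "j < length w"
      using that letter_eq_iff[of 14 w j] letter_eq_iff[of 15 w j] by (auto simp: letter_def split: if_splits)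
  qed
  have edges: "\<exists>a<n. \<exists>b<n. \<exists>j<Suc (length w). \<exists>j'<length w.
      num_at w (Suc i) a j \<and> num_at w j b j' \<and> (letter w j' = 14 \<or> letter w j' = 15)"
    if i: "i < length w" "p2 \<le> i" "letter w i = 14" for i
  proof -
    have "enc_edges es @ enc_labels ls = take (i - p2) (drop p2 w) @ drop i w"
    proof -
      have "drop (i - p2) (drop p2 w) = drop i w" using i(2) by simp
      then show ?thesis using append_take_drop_id[of "i - p2" "drop p2 w"] d2 by metis
    qed
    then have s: "enc_edges es @ enc_labels ls = take (i - p2) (drop p2 w) @ 14 # drop (Suc i) w"
      using drop_letter[OF i(1)] i(3) by simp
    have "14 \<notin> set (enc_labels ls)" by (intro notI) (drule subsetD[OF enc_labels_letters], simp)
    from enc_edges_split[OF s this] obtain a b es2 where *: "(a, b) \<in> set es"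
      "drop (Suc i) w = enc_nat a @ enc_nat b @ enc_edges es2 @ enc_labels ls" by blast
    define j where "j = Suc i + length (enc_nat a)"
    define j' where "j' = j + length (enc_nat b)"
    have n1: "num_at w (Suc i) a j" using * by (auto simp: num_at_iff j_def)
    have d: "drop j w = enc_nat b @ enc_edges es2 @ enc_labels ls" using num_atD(1)[OF n1] *(2) by simp
    have n2: "num_at w j b j'" using d by (auto simp: num_at_iff j'_def)
    have "drop j' w = enc_edges es2 @ enc_labels ls" using num_atD(1)[OF n2] d by simp
    from start[OF this] have "letter w j' = 14 \<or> letter w j' = 15" "j' < length w" .
    moreover have "a < n" "b < n" using wf *(1) by (auto simp: wf_parts_def n_def)
    moreover have "j < Suc (length w)" using num_atD(3)[OF n1] by simp
    ultimately show ?thesis using n1 n2 by blast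
  qed
  define G where "G = F @ 13 # enc_nat n @ enc_nat ini @ enc_edges es"
  have wG: "w = G @ enc_labels ls" by (simp add: w G_def)
  have G: "15 \<notin> set G" unfolding G_def by (rule kripke_word_letters(2)[OF F, of 15]) simp
  have labels: "next_label A w (Suc i)"
    if i: "i < length w" "letter w i = 15 \<or> letter w i = 3 \<and> 0 < seps w i" for i
  proof -
    \<comment> \<open>Terminators also occur before the labels, but no 15 precedes them, so the
      condition on \<open>seps\<close> keeps \<open>i\<close> in the label part.\<close>
    have "length G \<le> i"
    proof (rule ccontr)
      assume "\<not> length G \<le> i"
      then have lt: "i < length G" by simp
      then have "letter w i \<in> set G" by (simp add: wG letter_def nth_append)
      moreover have "take i w = take i G" using lt by (simp add: wG)
      then have "15 \<notin> set (take i w)" using G in_set_takeD by metis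
      then have "seps w i = 0" using i(1) by (simp add: seps_count count_list_0_iff)
      ultimately show False using i(2) G by auto
    qed
    then have "enc_labels ls = take (i - length G) (enc_labels ls) @ drop i w"
      by (simp add: wG)
    then have s: "enc_labels ls = take (i - length G) (enc_labels ls) @ letter w i # drop (Suc i) w"
      unfolding drop_letter[OF i(1)] .
    have "letter w i \<in> {15, 3}" using i(2) by auto
    from enc_labels_split[OF s this] obtain ls1 l1 l2 ls2 where
      *: "ls = ls1 @ (l1 @ l2) # ls2" "drop (Suc i) w = enc_nats l2 @ enc_labels ls2" by blast
    show ?thesis
    proof (cases l2)
      case (Cons p l2')
      then have "num_at w (Suc i) p (Suc i + length (enc_nat p))" using * by (auto simp: num_at_iff)
      moreover have "p \<in> A" using wf *(1) Cons by (auto simp: wf_parts_def)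
      ultimately show ?thesis unfolding next_label_def using num_atD(3,4) less_Suc_eq_le by meson
    next
      case Nil
      show ?thesis
      proof (cases ls2)
        case Nil
        then have "length w \<le> Suc i" using * \<open>l2 = []\<close> by simp
        then show ?thesis using i(1) by (simp add: next_label_def)
      next
        case (Cons l ls')
        then have "\<exists>r. drop (Suc i) w = 15 # r" using * \<open>l2 = []\<close> by simp
        then have "letter w (Suc i) = 15" using letter_eq_iff[of 15] by simp
        then show ?thesis by (simp add: next_label_def)
      qed
    qed
  qed
  have total: "\<exists>u<n. edge_in w v u" if "v < n" for v
    using wf that edge_in_kripke_word[OF F] by (fastforce simp: wf_parts_def w_def n_def)
  have "letter w m = 13" by (simp add: w m_def letter_def)
  moreover have "letter w i \<noteq> 13" if "i < m" for i
  proof -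
    have "letter w i \<in> set F" using that by (simp add: w m_def letter_def nth_append)
    then show ?thesis using F by auto
  qed
  moreover have "ini < n" using wf by (simp add: wf_parts_def n_def)
  moreover have "p1 < Suc (length w)" "p2 < Suc (length w)" using num_atD(3) num1 num2 by fastforce+
  ultimately show ?thesis
    unfolding kripke_at_def w_def[symmetric] m_def[symmetric] seps
    using num1 num2 start[OF d2] edges labels total by blast
qed

text \<open>Local conditions chain into a parse: each item read ends in 15 or 3, where
  \<open>nl\<close> applies again. Positivity of \<open>seps\<close> is inherited by all later
  positions and makes the terminators trigger \<open>nl\<close>.\<close>

lemma parse_labels:
  assumes nl: "\<And>i. i < length w \<Longrightarrow> p \<le> i \<Longrightarrow> letter w i = 15 \<or> letter w i = 3 \<and> 0 < seps w i \<Longrightarrow>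
      next_label A w (Suc i)"
  shows "p \<le> j \<Longrightarrow> j \<le> length w \<Longrightarrow> 0 < seps w j \<Longrightarrow> next_label A w j \<Longrightarrow>
    \<exists>l ls. drop j w = enc_nats l @ enc_labels ls \<and> set l \<subseteq> A \<and> (\<forall>l\<in>set ls. set l \<subseteq> A)"
proof (induction "length w - j" arbitrary: j rule: less_induct)
  case less
  from less.prems(4) consider "j = length w" | "letter w j = 15"
    | q j' where "q \<in> A" "num_at w j q j'"
    by (auto simp: next_label_def)
  then show ?case
  proof cases
    case 1
    then show ?thesis by (intro exI[of _ "[]"]) simp
  next
    case 2
    then have j: "j < length w" by (auto simp: letter_def split: if_splits)
    have "\<exists>l ls. drop (Suc j) w = enc_nats l @ enc_labels ls \<and> set l \<subseteq> A \<and> (\<forall>l\<in>set ls. set l \<subseteq> A)"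
      using less.prems j 2 nl[OF j] seps_mono[of j "Suc j" w] by (intro less.hyps) auto
    then obtain l ls where "drop (Suc j) w = enc_nats l @ enc_labels ls" "set l \<subseteq> A"
      "\<forall>l\<in>set ls. set l \<subseteq> A" by blast
    then show ?thesis
      using drop_letter[OF j] 2 by (intro exI[of _ "[]"] exI[of _ "l # ls"]) auto
  next
    case 3
    note n = num_atD[OF 3(2)]
    have "0 < seps w (j' - 1)" "0 < seps w j'"
      using less.prems(3) seps_mono[of j "j' - 1" w] seps_mono[of j j' w] n(2) by linarith+
    moreover from this have "next_label A w j'"
      using nl[of "j' - 1"] n less.prems by simp
    ultimately have "\<exists>l ls. drop j' w = enc_nats l @ enc_labels ls \<and> set l \<subseteq> A \<and> (\<forall>l\<in>set ls. set l \<subseteq> A)"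
      using less.prems n by (intro less.hyps) auto
    then obtain l ls where "drop j' w = enc_nats l @ enc_labels ls" "set l \<subseteq> A"
      "\<forall>l\<in>set ls. set l \<subseteq> A" by blast
    then show ?thesis
      using n(1) 3(1) by (intro exI[of _ "q # l"] exI[of _ ls]) auto
  qed
qed

text \<open>Edges are followed one by one until the first 15; from there \<open>parse_labels\<close>
  takes over, and \<open>next_label\<close> admits no further 14.\<close>

lemma parse_edges:
  assumes nl: "\<And>i. i < length w \<Longrightarrow> p \<le> i \<Longrightarrow> letter w i = 15 \<or> letter w i = 3 \<and> 0 < seps w i \<Longrightarrow>
      next_label A w (Suc i)"
    and ne: "\<And>i. i < length w \<Longrightarrow> p \<le> i \<Longrightarrow> letter w i = 14 \<Longrightarrow>
      \<exists>a<n. \<exists>b<n. \<exists>j<Suc (length w). \<exists>j'<length w.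
        num_at w (Suc i) a j \<and> num_at w j b j' \<and> (letter w j' = 14 \<or> letter w j' = 15)"
  shows "p \<le> j \<Longrightarrow> letter w j = 14 \<or> letter w j = 15 \<Longrightarrow>
    \<exists>es ls. drop j w = enc_edges es @ enc_labels ls \<and> (\<forall>(a, b)\<in>set es. a < n \<and> b < n) \<and> (\<forall>l\<in>set ls. set l \<subseteq> A)"
proof (induction "length w - j" arbitrary: j rule: less_induct)
  case less
  have j: "j < length w" using less.prems(2) by (auto simp: letter_def split: if_splits)
  show ?case
  proof (cases "letter w j = 14")
    case True
    from ne[OF j less.prems(1) True] obtain a b j1 j2 where *: "a < n" "b < n" "j2 < length w"
      "num_at w (Suc j) a j1" "num_at w j1 b j2" "letter w j2 = 14 \<or> letter w j2 = 15" by blast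
    note n1 = num_atD[OF *(4)] and n2 = num_atD[OF *(5)]
    have "\<exists>es ls. drop j2 w = enc_edges es @ enc_labels ls \<and> (\<forall>(a, b)\<in>set es. a < n \<and> b < n) \<and> (\<forall>l\<in>set ls. set l \<subseteq> A)"
      using less.prems * n1(2) n2(2) by (intro less.hyps) auto
    then obtain es ls where "drop j2 w = enc_edges es @ enc_labels ls"
      "\<forall>(a, b)\<in>set es. a < n \<and> b < n" "\<forall>l\<in>set ls. set l \<subseteq> A" by blast
    then show ?thesis
      using n1(1) n2(1) drop_letter[OF j] True *(1,2)
      by (intro exI[of _ "(a, b) # es"] exI[of _ ls]) auto
  next
    case False
    then have 15: "letter w j = 15" using less.prems(2) by simp
    have "0 < seps w (Suc j)" using 15 by (simp add: seps_def)
    moreover have "next_label A w (Suc j)" using nl[OF j less.prems(1)] 15 by simp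
    ultimately obtain l ls where "drop (Suc j) w = enc_nats l @ enc_labels ls" "set l \<subseteq> A"
      "\<forall>l\<in>set ls. set l \<subseteq> A"
      using parse_labels[OF nl, of p "Suc j"] j less.prems(1) by auto
    then show ?thesis
      using drop_letter[OF j] 15 by (intro exI[of _ "[]"] exI[of _ "l # ls"]) auto
  qed
qed

lemma kripke_at_parse:
  assumes k: "kripke_at A w m ini" and F: "set (take m w) \<subseteq> {1..12}"
  shows "\<exists>es ls. w = kripke_word (take m w) ini es ls \<and> wf_parts A ini es ls"
proof -
  define n where "n = seps w (length w)"
  obtain p1 p2 where *: "num_at w (Suc m) n p1" "num_at w p1 ini p2"
      "letter w p2 = 14 \<or> letter w p2 = 15"
    and ne: "\<And>i. i < length w \<Longrightarrow> p2 \<le> i \<Longrightarrow> letter w i = 14 \<Longrightarrow>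
      \<exists>a<n. \<exists>b<n. \<exists>j<Suc (length w). \<exists>j'<length w.
        num_at w (Suc i) a j \<and> num_at w j b j' \<and> (letter w j' = 14 \<or> letter w j' = 15)"
    and nl: "\<And>i. i < length w \<Longrightarrow> p2 \<le> i \<Longrightarrow> letter w i = 15 \<or> letter w i = 3 \<and> 0 < seps w i \<Longrightarrow>
      next_label A w (Suc i)"
    and ini: "letter w m = 13" "ini < n" and total: "\<forall>v<n. \<exists>u<n. edge_in w v u"
    using k unfolding kripke_at_def n_def by blast
  obtain es ls where d: "drop p2 w = enc_edges es @ enc_labels ls"
    "\<forall>(a, b)\<in>set es. a < n \<and> b < n" "\<forall>l\<in>set ls. set l \<subseteq> A"
    using parse_edges[OF nl ne order_refl *(3)] by blast
  have m: "m < length w" using ini(1) by (auto simp: letter_def split: if_splits)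
  have w: "w = take m w @ 13 # enc_nat n @ enc_nat ini @ enc_edges es @ enc_labels ls"
    using append_take_drop_id[of m w] drop_letter[OF m] ini(1) num_atD(1)[OF *(1)] num_atD(1)[OF *(2)] d(1)
    by simp
  have "15 \<notin> set (take m w @ 13 # enc_nat n @ enc_nat ini @ enc_edges es)"
    by (rule kripke_word_letters(2)[OF F, of 15]) simp
  then have "count_list (take m w @ 13 # enc_nat n @ enc_nat ini @ enc_edges es) 15 = 0"
    by (rule count_list_notin)
  moreover have "n = count_list w 15" by (simp add: n_def seps_length)
  moreover have "w = (take m w @ 13 # enc_nat n @ enc_nat ini @ enc_edges es) @ enc_labels ls"
    using w by simp
  \<comment> \<open>\<open>n\<close> was defined as the number of letters 15, all of which lie in
    the parsed labels.\<close>
  ultimately have n: "n = length ls" by (metis add_0 count_enc_labels count_list_append)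
  then have w': "w = kripke_word (take m w) ini es ls" using w by (simp add: kripke_word_def)
  have "\<forall>v<n. \<exists>u. (v, u) \<in> set es"
    using total edge_in_kripke_word[OF F, of ini es ls] w' by metis
  then have "wf_parts A ini es ls" using d(2,3) ini(2) by (simp add: wf_parts_def n)
  with w' show ?thesis by blast
qed

section \<open>Splitjunction-free formulas on the set of worlds reachable in \<open>k\<close> steps\<close>

definition worlds :: "kripke \<Rightarrow> nat \<Rightarrow> nat set" where
  "worlds K k = {\<pi> k | \<pi>. is_path K \<pi>}"

text \<open>Paths are infinite, so a step from a reachable world counts only if it can be continued;
  left-totality provides a successor function \<open>f\<close>, which is iterated from
  \<open>b\<close>.\<close>

lemma path_extend:
  assumes "wf_kripke A K" "a \<in> worlds K k" "(a, b) \<in> set (ks_edges K)"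
  shows "b \<in> worlds K (Suc k)"
proof -
  obtain \<pi> where \<pi>: "is_path K \<pi>" "\<pi> k = a" using assms(2) by (auto simp: worlds_def)
  obtain f where f: "\<And>v. v < ks_n K \<Longrightarrow> (v, f v) \<in> set (ks_edges K)"
    using assms(1) unfolding wf_kripke_def by metis
  have lt: "v < ks_n K" if "(u, v) \<in> set (ks_edges K)" for u v
    using assms(1) that by (auto simp: wf_kripke_def)
  define \<pi>' where "\<pi>' i = (if i \<le> k then \<pi> i else (f ^^ (i - Suc k)) b)" for i
  have fb: "(f ^^ i) b < ks_n K" for i
    by (induction i) (auto intro: lt[OF assms(3)] lt[OF f])
  have "(\<pi>' i, \<pi>' (Suc i)) \<in> set (ks_edges K)" for i
  proof (cases "i < k")
    case True
    then show ?thesis using \<pi>(1) by (simp add: \<pi>'_def is_path_def)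
  next
    case False
    then consider "i = k" | j where "i = Suc k + j"
      by (metis add_Suc less_iff_Suc_add nat_neq_iff)
    then show ?thesis
    proof cases
      case 1
      then show ?thesis using \<pi>(2) assms(3) by (simp add: \<pi>'_def)
    next
      case 2
      then show ?thesis using f[OF fb[of j]] by (simp add: \<pi>'_def Suc_diff_le)
    qed
  qed
  then have "is_path K \<pi>'" using \<pi>(1) by (simp add: is_path_def \<pi>'_def)
  moreover have "\<pi>' (Suc k) = b" by (simp add: \<pi>'_def)
  ultimately show ?thesis by (auto simp: worlds_def)
qed

lemma path_exists:
  assumes "wf_kripke A K"
  shows "\<exists>\<pi>. is_path K \<pi>"
proof -
  obtain f where f: "\<And>v. v < ks_n K \<Longrightarrow> (v, f v) \<in> set (ks_edges K)"
    using assms unfolding wf_kripke_def by metis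
  have "(f ^^ i) (ks_init K) < ks_n K" for i
    using assms f by (induction i) (fastforce simp: wf_kripke_def)+
  then have "is_path K (\<lambda>i. (f ^^ i) (ks_init K))" using f by (simp add: is_path_def)
  then show ?thesis by blast
qed

lemma worlds_0:
  assumes "wf_kripke A K"
  shows "worlds K 0 = {ks_init K}"
proof -
  obtain \<pi> where \<pi>: "is_path K \<pi>" using path_exists[OF assms] by blast
  then have "\<pi> 0 \<in> worlds K 0" unfolding worlds_def by blast
  then show ?thesis using \<pi> by (auto simp: worlds_def is_path_def)
qed

lemma worlds_Suc:
  assumes "wf_kripke A K"
  shows "worlds K (Suc k) = {b. \<exists>a\<in>worlds K k. (a, b) \<in> set (ks_edges K)}"
proof
  show "{b. \<exists>a\<in>worlds K k. (a, b) \<in> set (ks_edges K)} \<subseteq> worlds K (Suc k)"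
    using path_extend[OF assms] by blast
qed (auto simp: worlds_def is_path_def)

lemma worlds_subset: "wf_kripke A K \<Longrightarrow> worlds K k \<subseteq> {..<ks_n K}"
  by (induction k) (auto simp: worlds_0 worlds_Suc, auto simp: wf_kripke_def)

lemma worlds_shift:
  assumes "wf_kripke A K" "worlds K k = worlds K k'"
  shows "worlds K (k + j) = worlds K (k' + j)"
  by (induction j) (simp_all add: assms(2) worlds_Suc[OF assms(1)])

text \<open>The worlds reachable in \<open>k\<close>, \<open>k + 1\<close>, ... steps form an eventually periodic sequence of subsets of
  an \<open>n\<close>-element set, so the first \<open>2 ^ n\<close> of them are all.\<close>

lemma worlds_horizon:
  assumes "wf_kripke A K" "ks_n K \<le> l"
  shows "\<exists>j0<2 ^ l. j0 \<le> j \<and> worlds K (k + j) = worlds K (k + j0)"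
proof -
  \<comment> \<open>Before the first occurrence no set can repeat: the repetition could be cut out,
    giving a still earlier occurrence.\<close>
  define j0 where "j0 = (LEAST i. worlds K (k + j) = worlds K (k + i))"
  have j0: "worlds K (k + j) = worlds K (k + j0)" unfolding j0_def by (rule LeastI[of _ j]) simp
  have least: "worlds K (k + i) \<noteq> worlds K (k + j0)" if "i < j0" for i
    using not_less_Least[of i "\<lambda>i. worlds K (k + j) = worlds K (k + i)", folded j0_def] that j0 by metis
  have "worlds K (k + a) \<noteq> worlds K (k + b)" if "a < b" "b \<le> j0" for a b
  proof
    assume "worlds K (k + a) = worlds K (k + b)"
    from worlds_shift[OF assms(1) this, of "j0 - b"]
    have "worlds K (k + (a + (j0 - b))) = worlds K (k + j0)" using that by (simp add: add.assoc)
    moreover have "a + (j0 - b) < j0" using that by simp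
    ultimately show False using least by blast
  qed
  then have "inj_on (\<lambda>i. worlds K (k + i)) {..j0}"
    by (intro linorder_inj_onI) auto
  then have "card {..j0} \<le> card (Pow {..<ks_n K})"
    by (rule card_inj_on_le) (use worlds_subset[OF assms(1)] in auto)
  then have "j0 < 2 ^ ks_n K" by (simp add: card_Pow)
  also have "\<dots> \<le> (2::nat) ^ l" using assms(2) by (rule power_increasing) simp
  finally have "j0 < 2 ^ l" .
  moreover have "j0 \<le> j" unfolding j0_def by (rule Least_le) simp
  ultimately show ?thesis using j0 by blast
qed

definition tsat :: "kripke \<Rightarrow> nat \<Rightarrow> ltl \<Rightarrow> bool" where
  "tsat K k \<phi> \<longleftrightarrow> sat_s (team_suffix (traces K) k) \<phi>"

lemma team_suffix_add: "team_suffix (team_suffix T i) j = team_suffix T (i + j)"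
  by (auto simp: team_suffix_def suffix_def image_image add_ac)

lemma tsat_Prop:
  "tsat K k (Prop p) \<longleftrightarrow> (\<forall>v\<in>worlds K k. p \<in> set (ks_lab K ! v))"
  "tsat K k (NProp p) \<longleftrightarrow> (\<forall>v\<in>worlds K k. p \<notin> set (ks_lab K ! v))"
  by (auto simp: tsat_def team_suffix_def suffix_def traces_def worlds_def)

text \<open>Each of these operators passes on suffixes of the whole team, so satisfaction becomes a
  property of the instant. The parts of a split are in general not of this form, which is why
  \<open>Or\<close> has no equation.\<close>

lemma tsat_simps:
  "tsat K k (And a b) \<longleftrightarrow> tsat K k a \<and> tsat K k b"
  "tsat K k (Next a) \<longleftrightarrow> tsat K (Suc k) a"
  "tsat K k (Fin a) \<longleftrightarrow> (\<exists>j. tsat K (k + j) a)"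
  "tsat K k (Glob a) \<longleftrightarrow> (\<forall>j. tsat K (k + j) a)"
  "tsat K k (Until a b) \<longleftrightarrow> (\<exists>j. tsat K (k + j) b \<and> (\<forall>j'<j. tsat K (k + j') a))"
  "tsat K k (Release a b) \<longleftrightarrow> (\<forall>j. tsat K (k + j) b \<or> (\<exists>j'<j. tsat K (k + j') a))"
  by (simp_all add: tsat_def team_suffix_add)

lemma tsat_worlds:
  assumes wf: "wf_kripke A K"
  shows "disj_free \<phi> \<Longrightarrow> worlds K k = worlds K k' \<Longrightarrow> tsat K k \<phi> \<longleftrightarrow> tsat K k' \<phi>"
proof (induction \<phi> arbitrary: k k')
  case (Next a)
  have "tsat K (Suc k) a = tsat K (Suc k') a"
    by (rule Next.IH) (use Next.prems worlds_shift[OF wf, of k k' 1] in simp_all)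
  then show ?case by (simp add: tsat_simps)
next
  case (Fin a)
  have "tsat K (k + j) a = tsat K (k' + j) a" for j
    by (rule Fin.IH) (use Fin.prems worlds_shift[OF wf, of k k' j] in simp_all)
  then show ?case by (simp add: tsat_simps)
next
  case (Glob a)
  have "tsat K (k + j) a = tsat K (k' + j) a" for j
    by (rule Glob.IH) (use Glob.prems worlds_shift[OF wf, of k k' j] in simp_all)
  then show ?case by (simp add: tsat_simps)
next
  case (Until a b)
  have "tsat K (k + j) a = tsat K (k' + j) a" "tsat K (k + j) b = tsat K (k' + j) b" for j
    by (rule Until.IH; use Until.prems worlds_shift[OF wf, of k k' j] in simp)+
  then show ?case by (simp add: tsat_simps)
next
  case (Release a b)
  have "tsat K (k + j) a = tsat K (k' + j) a" "tsat K (k + j) b = tsat K (k' + j) b" for j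
    by (rule Release.IH; use Release.prems worlds_shift[OF wf, of k k' j] in simp)+
  then show ?case by (simp add: tsat_simps)
next
  case (And a b)
  have "tsat K k a = tsat K k' a" "tsat K k b = tsat K k' b"
    by (rule And.IH; use And.prems in simp)+
  then show ?case by (simp add: tsat_simps)
qed (simp_all add: tsat_Prop)

section \<open>Correctness of the decision procedure\<close>


lemma set_enc_ltl: "set (enc_ltl \<phi>) \<subseteq> {1..12}"
proof -
  have "set (enc_nat p) \<subseteq> {1..12}" for p using set_enc_nat[of p] by auto
  then show ?thesis by (induction \<phi>) auto
qed

lemma enc_ltl_Cons: "\<exists>x xs. enc_ltl \<phi> = x # xs \<and> \<not> is_digit x"
  by (cases \<phi>) (auto simp: is_digit_def)

lemma is_digit_enc_nat: "d \<in> set (enc_nat n) \<Longrightarrow> is_digit d"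
  using set_enc_nat[of n] by (auto simp: is_digit_def)

section \<open>Reading the formula off the stack\<close>

definition stack_at :: "nat set \<Rightarrow> nat list \<Rightarrow> nat \<Rightarrow> nat \<Rightarrow> nat \<Rightarrow> nat \<Rightarrow> nat" where
  "stack_at A w S V r i = stack A w S V r (length w - i)"

lemma stack_at_step:
  assumes "i < length w"
  shows "stack_at A w S V r i = stack_step A w S V r i (stack_at A w S V r (Suc i))"
proof -
  have "length w - i = Suc (length w - Suc i)" "length w - Suc (length w - Suc i) = i"
    using assms by simp_all
  then show ?thesis by (simp add: stack_at_def stack_def)
qed

lemma drop_eq_Cons:
  assumes "drop i w = x # xs"
  shows "i < length w" "letter w i = x" "drop (Suc i) w = xs"
proof -
  show i: "i < length w" using assms by (cases "i < length w") auto
  show "letter w i = x" "drop (Suc i) w = xs" using drop_letter[OF i] assms by simp_all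
qed

lemma stack_at_digits:
  assumes "drop i w = ds @ rest" "\<forall>d\<in>set ds. is_digit d"
  shows "stack_at A w S V r i = stack_at A w S V r (i + length ds)"
  using assms
proof (induction ds arbitrary: i)
  case (Cons d ds)
  note d = drop_eq_Cons[of i w d "ds @ rest"]
  have "drop i w = d # ds @ rest" using Cons.prems by simp
  then have "stack_at A w S V r i = stack_at A w S V r (Suc i)"
    using d Cons.prems by (simp add: stack_at_step stack_step_def)
  also have "\<dots> = stack_at A w S V r (Suc i + length ds)"
    using d Cons.prems by (intro Cons.IH) simp_all
  finally show ?case by simp
qed simp

lemma takeWhile_append_nondigit:
  assumes "\<forall>d\<in>set ds. is_digit d" "takeWhile is_digit xs = []"
  shows "takeWhile is_digit (ds @ xs) = ds"
  using assms by (simp add: takeWhile_append2)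

lemma takeWhile_drop_letter:
  assumes "\<not> is_digit (letter w j)"
  shows "takeWhile is_digit (drop j w) = []"
  using assms drop_letter[of j w] by (cases "j < length w") auto

text \<open>Soundness of the syntax check. A nonzero stack holds one entry for each completed
  formula in \<open>fs\<close> above its leading digit 1, while \<open>ds\<close> are digits read
  but not yet claimed by an atom.\<close>

lemma parse_stack:
  assumes m: "letter w m = 13" "\<forall>i<m. letter w i \<noteq> 13" and "i \<le> m"
  shows "stack_at A w S V r i \<noteq> 0 \<Longrightarrow>
    \<exists>ds fs. drop i w = ds @ concat (map enc_ltl fs) @ drop m w \<and> (\<forall>d\<in>set ds. is_digit d) \<and>
      (\<forall>f\<in>set fs. disj_free f \<and> atoms f \<subseteq> A) \<and> stack_at A w S V r i div 2 ^ length fs = 1"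
  using assms(3)
proof (induction rule: inc_induct)
  case base
  have "m < length w" using m(1) by (auto simp: letter_def split: if_splits)
  then have "stack_at A w S V r m = 1"
    using m(1) by (simp add: stack_at_step stack_step_def is_digit_def)
  then show ?case by (intro exI[of _ "[]"]) simp
next
  case (step n)
  have mL: "m < length w" using m(1) by (auto simp: letter_def split: if_splits)
  then have n: "n < length w" using step.hyps by simp
  define x where "x = letter w n"
  define y where "y = stack_at A w S V r (Suc n)"
  have eq: "stack_at A w S V r n = stack_step A w S V r n y"
    by (simp add: y_def stack_at_step[OF n])
  have x13: "x \<noteq> 13" using m(2) step.hyps by (simp add: x_def)
  have dn: "drop n w = x # drop (Suc n) w" unfolding x_def by (rule drop_letter[OF n])
  have nz: "stack_step A w S V r n y \<noteq> 0" using step.prems eq by simp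
  then have y0: "y \<noteq> 0" using x13 unfolding stack_step_def x_def by (auto split: if_splits)
  with step.IH obtain ds fs where IH: "drop (Suc n) w = ds @ concat (map enc_ltl fs) @ drop m w"
    "\<forall>d\<in>set ds. is_digit d" "\<forall>f\<in>set fs. disj_free f \<and> atoms f \<subseteq> A" "y div 2 ^ length fs = 1"
    unfolding y_def by blast
  have rest: "takeWhile is_digit (concat (map enc_ltl fs) @ drop m w) = []"
  proof (cases fs)
    case Nil
    then show ?thesis using takeWhile_drop_letter[of w m] m(1) by (simp add: is_digit_def)
  next
    case (Cons f fs')
    then show ?thesis using enc_ltl_Cons[of f] by auto
  qed
  \<comment> \<open>Covers all cases in which a formula \<open>f\<close> is completed and its
    arguments are replaced by one entry.\<close>
  have fin: ?case
    if "stack_step A w S V r n y = 2 * z + of_bool b" "z div 2 ^ length fs' = 1"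
      "drop n w = enc_ltl f @ concat (map enc_ltl fs') @ drop m w"
      "disj_free f" "atoms f \<subseteq> A" "set fs' \<subseteq> set fs" for z b f fs'
  proof -
    have "(2 * z + of_bool b) div 2 = z" by (cases b) simp_all
    then have "(2 * z + of_bool b) div 2 ^ length (f # fs') = 1"
      using that(2) by (simp only: length_Cons power_Suc div_mult2_eq)
    then show ?thesis
      using that IH(3) by (intro exI[of _ "[]"] exI[of _ "f # fs'"]) (auto simp: eq)
  qed
  show ?case
  proof (cases "is_digit x")
    case True
    then have "stack_at A w S V r n = y" by (simp add: eq stack_step_def x_def)
    then show ?thesis
      using IH True dn by (intro exI[of _ "x # ds"] exI[of _ fs]) simp
  next
    case nd: False
    show ?thesis
    proof (cases "x = 4 \<or> x = 5")
      case True
      then have "atom_at A w n"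
        using nz nd x13 y0 unfolding stack_step_def x_def by (auto split: if_splits)
      then obtain p j where p: "p \<in> A" "num_at w (Suc n) p j" "\<not> is_digit (letter w j)"
        by (auto simp: atom_at_def)
      have d: "drop (Suc n) w = enc_nat p @ drop j w" by (rule num_atD(1)[OF p(2)])
      \<comment> \<open>Both \<open>enc_nat p\<close> and \<open>ds\<close> are the maximal run of
        digits after the atom.\<close>
      have "takeWhile is_digit (drop (Suc n) w) = enc_nat p"
        unfolding d by (intro takeWhile_append_nondigit takeWhile_drop_letter p) (auto intro: is_digit_enc_nat)
      moreover have "takeWhile is_digit (drop (Suc n) w) = ds"
        unfolding IH(1) by (rule takeWhile_append_nondigit[OF IH(2) rest])
      ultimately have ds: "ds = enc_nat p" by simp
      from True show ?thesis
      proof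
        assume "x = 4"
        then show ?thesis
          using nd x13 y0 \<open>atom_at A w n\<close> p(1) IH ds dn
          by (intro fin[of y "atom_pos w S n" fs "Prop p"]) (auto simp: stack_step_def x_def)
      next
        assume "x = 5"
        then show ?thesis
          using nd x13 y0 \<open>atom_at A w n\<close> p(1) IH ds dn
          by (intro fin[of y "atom_neg w S n" fs "NProp p"]) (auto simp: stack_step_def x_def)
      qed
    next
      case na: False
      have nd': "\<not> is_digit (letter w (Suc n))" "2 \<le> y"
        using nz nd x13 y0 na unfolding stack_step_def x_def by (auto split: if_splits)
      \<comment> \<open>Operators demand a nondigit next, so no unclaimed digits stand in front of
        an argument.\<close>
      have ds: "ds = []"
      proof (cases ds)
        case (Cons d ds')
        then have "letter w (Suc n) = d" using drop_eq_Cons(2)[of "Suc n" w d] IH(1) by simp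
        then show ?thesis using nd' IH(2) Cons by simp
      qed simp
      obtain f fs1 where fs: "fs = f # fs1" using IH(4) nd'(2) by (cases fs) auto
      have f: "disj_free f" "atoms f \<subseteq> A" using IH(3) fs by auto
      have y2: "y div 2 div 2 ^ length fs1 = 1" using IH(4) by (simp add: fs div_mult2_eq)
      show ?thesis
      proof (cases "x \<in> {8, 9, 10}")
        case True
        from True consider "x = 8" | "x = 9" | "x = 10" by auto
        then show ?thesis
        proof cases
          case 1
          have b: "stack_step A w S V r n y = 2 * (y div 2) + of_bool (bit V (Suc n))"
            using nd' y0 unfolding stack_step_def x_def[symmetric] 1 by (simp add: is_digit_def)
          show ?thesis using f dn IH(1) ds fs 1 by (intro fin[OF b y2, of "Next f"]) auto
        next
          case 2
          have b: "stack_step A w S V r n y = 2 * (y div 2) + of_bool (odd y \<or> active w r n \<and> bit V n)"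
            using nd' y0 unfolding stack_step_def x_def[symmetric] 2 by (simp add: is_digit_def)
          show ?thesis using f dn IH(1) ds fs 2 by (intro fin[OF b y2, of "Fin f"]) auto
        next
          case 3
          have b: "stack_step A w S V r n y = 2 * (y div 2) + of_bool (odd y \<and> (active w r n \<longrightarrow> bit V n))"
            using nd' y0 unfolding stack_step_def x_def[symmetric] 3 by (simp add: is_digit_def)
          show ?thesis using f dn IH(1) ds fs 3 by (intro fin[OF b y2, of "Glob f"]) auto
        qed
      next
        case False
        then have y4: "4 \<le> y" "x \<in> {6, 11, 12}"
          using nz nd x13 y0 na nd' unfolding stack_step_def x_def by (auto split: if_splits)
        obtain g fs2 where fs1: "fs1 = g # fs2" using y2 y4(1) by (cases fs1) auto
        have g: "disj_free g" "atoms g \<subseteq> A" using IH(3) fs fs1 by auto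
        have y3: "y div 2 div 2 div 2 ^ length fs2 = 1"
          using y2 unfolding fs1 length_Cons power_Suc div_mult2_eq .
        from y4(2) consider "x = 6" | "x = 11" | "x = 12" by auto
        then show ?thesis
        proof cases
          case 1
          have b: "stack_step A w S V r n y = 2 * (y div 2 div 2) + of_bool (odd y \<and> odd (y div 2))"
            using nd' y0 y4(1) unfolding stack_step_def x_def[symmetric] 1 by (simp add: is_digit_def)
          show ?thesis using f g dn IH(1) ds fs fs1 1 by (intro fin[OF b y3, of "And f g"]) auto
        next
          case 2
          have b: "stack_step A w S V r n y = 2 * (y div 2 div 2) + of_bool (odd (y div 2) \<or> odd y \<and> active w r n \<and> bit V n)"
            using nd' y0 y4(1) unfolding stack_step_def x_def[symmetric] 2 by (simp add: is_digit_def)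
          show ?thesis using f g dn IH(1) ds fs fs1 2 by (intro fin[OF b y3, of "Until f g"]) auto
        next
          case 3
          have b: "stack_step A w S V r n y = 2 * (y div 2 div 2) + of_bool (odd (y div 2) \<and> (odd y \<or> (active w r n \<longrightarrow> bit V n)))"
            using nd' y0 y4(1) unfolding stack_step_def x_def[symmetric] 3 by (simp add: is_digit_def)
          show ?thesis using f g dn IH(1) ds fs fs1 3 by (intro fin[OF b y3, of "Release f g"]) auto
        qed
      qed
    qed
  qed
qed

text \<open>Unrolling the recursion: it starts at \<open>r0\<close> with \<open>b\<close> alone, and
  each further step into the past admits witnesses one instant farther away.\<close>

lemma backward_until:
  fixes r0 M d :: nat
  assumes "\<And>r. r0 \<le> r \<Longrightarrow> r \<le> M \<Longrightarrow> f r \<longleftrightarrow> b (M - r) \<or> a (M - r) \<and> r0 < r \<and> f (r - 1)"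
  shows "r0 + d \<le> M \<Longrightarrow> f (r0 + d) \<longleftrightarrow>
    (\<exists>j\<le>d. b (M - (r0 + d) + j) \<and> (\<forall>j'<j. a (M - (r0 + d) + j')))"
proof (induction d)
  case 0
  then show ?case using assms[of r0] by simp
next
  case (Suc d)
  define k where "k = M - (r0 + Suc d)"
  have k: "M - (r0 + d) = Suc k" using Suc.prems by (simp add: k_def)
  have "f (r0 + Suc d) \<longleftrightarrow> b k \<or> a k \<and> f (r0 + d)"
    using assms[of "r0 + Suc d"] Suc.prems by (simp add: k_def)
  also have "f (r0 + d) \<longleftrightarrow> (\<exists>j\<le>d. b (Suc k + j) \<and> (\<forall>j'<j. a (Suc k + j')))"
    using Suc by (simp add: k)
  also have "b k \<or> a k \<and> (\<exists>j\<le>d. b (Suc k + j) \<and> (\<forall>j'<j. a (Suc k + j'))) \<longleftrightarrow>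
    (\<exists>j\<le>Suc d. b (k + j) \<and> (\<forall>j'<j. a (k + j')))" (is "?l \<longleftrightarrow> ?r")
  proof
    assume ?l
    then show ?r
    proof
      assume "b k"
      then show ?r by (intro exI[of _ 0]) simp
    next
      assume "a k \<and> (\<exists>j\<le>d. b (Suc k + j) \<and> (\<forall>j'<j. a (Suc k + j')))"
      then obtain j where "a k" "j \<le> d" "b (Suc k + j)" "\<forall>j'<j. a (Suc k + j')" by blast
      then show ?r by (intro exI[of _ "Suc j"]) (auto simp: All_less_Suc2)
    qed
  next
    assume ?r
    then obtain j where j: "j \<le> Suc d" "b (k + j)" "\<forall>j'<j. a (k + j')" by blast
    show ?l
    proof (cases j)
      case 0
      then show ?thesis using j by simp
    next
      case (Suc j')
      then show ?thesis using j by (auto simp: All_less_Suc2)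
    qed
  qed
  finally show ?case by (simp only: k_def)
qed

section \<open>Values of subformulas on a genuine encoding of a structure\<close>

locale instance_word =
  fixes A :: "nat set" and K :: kripke and F w :: "nat list"
  assumes wf: "wf_kripke A K" and F: "set F \<subseteq> {1..12}" and w: "w = F @ enc_kripke K"
begin

lemma w_parts: "w = kripke_word F (ks_init K) (ks_edges K) (ks_lab K)"
  using wf by (simp add: w kripke_word_def enc_kripke_def wf_kripke_def)

lemma parts: "wf_parts A (ks_init K) (ks_edges K) (ks_lab K)"
  using wf by (auto simp: wf_parts_def wf_kripke_def)

lemma kripke_at: "kripke_at A w (length F) (ks_init K)"
  unfolding w_parts by (rule kripke_at_kripke_word[OF F parts])

lemma edge_in: "edge_in w a b \<longleftrightarrow> (a, b) \<in> set (ks_edges K)"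
  unfolding w_parts by (rule edge_in_kripke_word[OF F])

lemma label_in: "label_in w v p \<longleftrightarrow> v < ks_n K \<and> p \<in> set (ks_lab K ! v)"
  unfolding w_parts using label_in_kripke_word[OF F] wf by (simp add: wf_kripke_def)

lemma ks_n_le: "ks_n K \<le> length w"
proof -
  have "seps w (length w) = ks_n K"
    using seps_kripke_word[OF F, of "ks_init K" "ks_edges K" "ks_lab K"] wf
    by (simp add: w_parts wf_kripke_def)
  moreover have "seps w (length w) \<le> (\<Sum>x<length w. 1)"
    unfolding seps_def by (intro sum_mono) simp
  ultimately show ?thesis by simp
qed

lemma worlds_less: "v \<in> worlds K k \<Longrightarrow> v < ks_n K"
  using worlds_subset[OF wf] by blast

lemma bit_reach: "bit (reach w (ks_init K) k) v \<longleftrightarrow> v \<in> worlds K k"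
proof (induction k arbitrary: v)
  case 0
  have "ks_init K < length w" using wf ks_n_le by (simp add: wf_kripke_def)
  then show ?case by (auto simp: reach_def bit_bitset worlds_0[OF wf])
next
  case (Suc k)
  have "bit (reach w (ks_init K) (Suc k)) v \<longleftrightarrow>
      v < length w \<and> (\<exists>a<length w. bit (reach w (ks_init K) k) a \<and> edge_in w a v)"
    by (simp add: reach_def bit_bitset)
  also have "\<dots> \<longleftrightarrow> v \<in> worlds K (Suc k)"
    using worlds_less[of _ k] worlds_less[of _ "Suc k"] ks_n_le
    by (auto simp: Suc edge_in worlds_Suc[OF wf] intro: less_le_trans)
  finally show ?case .
qed

lemma holds_tsat:
  "holds_pos w (reach w (ks_init K) k) p \<longleftrightarrow> tsat K k (Prop p)"
  "holds_neg w (reach w (ks_init K) k) p \<longleftrightarrow> tsat K k (NProp p)"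
  using worlds_less[of _ k] ks_n_le
  by (auto simp: holds_pos_def holds_neg_def bit_reach label_in tsat_Prop intro: less_le_trans)

definition Y :: "nat \<Rightarrow> nat \<Rightarrow> nat" where
  "Y r i = stack_at A w (reach w (ks_init K) (horizon w - r)) (truth_vec A w (ks_init K) (r - 1)) r i"

lemmas Y_step = stack_at_step[of _ w A "reach w (ks_init K) (horizon w - r)"
  "truth_vec A w (ks_init K) (r - 1)" r for r, folded Y_def]

lemmas Y_digits = stack_at_digits[of _ w _ _ A "reach w (ks_init K) (horizon w - r)"
  "truth_vec A w (ks_init K) (r - 1)" r for r, folded Y_def]

lemma bit_truth_vec:
  assumes "0 < r"
  shows "bit (truth_vec A w (ks_init K) r) i \<longleftrightarrow> i < length w \<and> odd (Y r i)"
proof (cases r)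
  case (Suc r')
  then show ?thesis by (simp add: truth_vec_def bit_bitset Y_def stack_at_def)
qed (use assms in simp)

definition reliable :: "nat \<Rightarrow> nat \<Rightarrow> bool" where
  "reliable i r \<longleftrightarrow> (length w - i) * 2 ^ length w + 2 ^ length w \<le> r \<and> r \<le> horizon w"

text \<open>A later position starts one block earlier and needs one block of its own, so arguments
  become reliable at the very moment at which the operator at \<open>i\<close> is started.\<close>

lemma reliable_Suc:
  assumes "i < length w"
  shows "reliable (Suc i) r \<longleftrightarrow> (length w - i) * 2 ^ length w \<le> r \<and> r \<le> horizon w"
proof -
  have "(length w - i) * 2 ^ length w = (length w - Suc i) * 2 ^ length w + 2 ^ length w"
    using assms by (subst Suc_diff_Suc[symmetric]) simp_all
  then show ?thesis by (simp add: reliable_def)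
qed

lemma active_pos:
  assumes "i < length w" "active w r i"
  shows "(length w - i) * 2 ^ length w \<le> r - 1" "0 < r - 1"
proof -
  have "1 \<le> (length w - i) * 2 ^ length w" using assms(1) by (simp add: Suc_le_eq)
  then show "(length w - i) * 2 ^ length w \<le> r - 1" "0 < r - 1"
    using assms(2) unfolding active_def by linarith+
qed

text \<open>The common core of the iterating operators: \<open>Fin\<close> is the case of a trivial
  \<open>a\<close>, and \<open>Glob\<close> and \<open>Release\<close> are treated through their
  negations.\<close>

lemma reliable_until:
  assumes i: "i < length w" and r: "reliable i r"
    and f: "\<And>r. reliable (Suc i) r \<Longrightarrow> f r \<longleftrightarrow> b (horizon w - r) \<or> a (horizon w - r) \<and> active w r i \<and> f (r - 1)"
    and b: "\<And>k k'. worlds K k = worlds K k' \<Longrightarrow> b k \<longleftrightarrow> b k'"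
  shows "f r \<longleftrightarrow> (\<exists>j. b (horizon w - r + j) \<and> (\<forall>j'<j. a (horizon w - r + j')))"
proof -
  define r0 where "r0 = (length w - i) * 2 ^ length w"
  obtain d where d: "r = r0 + d" "2 ^ length w \<le> d" "r0 + d \<le> horizon w"
    using r unfolding reliable_def r0_def by (metis add_le_cancel_left le_add1 le_iff_add le_trans)
  let ?k = "horizon w - r"
  have "f (r0 + d) \<longleftrightarrow> (\<exists>j\<le>d. b (horizon w - (r0 + d) + j) \<and> (\<forall>j'<j. a (horizon w - (r0 + d) + j')))"
    using f d(3) by (intro backward_until) (auto simp: reliable_Suc[OF i] r0_def active_def)
  also have "\<dots> \<longleftrightarrow> (\<exists>j. b (?k + j) \<and> (\<forall>j'<j. a (?k + j')))"
  proof
    assume "\<exists>j. b (?k + j) \<and> (\<forall>j'<j. a (?k + j'))"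
    then obtain j where j: "b (?k + j)" "\<forall>j'<j. a (?k + j')" by blast
    \<comment> \<open>The witness is replaced by one within the operator's own block:
      \<open>j0\<close> satisfies \<open>b\<close> because its set of worlds is the same, and being
      at most \<open>j\<close> it keeps the condition on \<open>a\<close>.\<close>
    obtain j0 where j0: "j0 < 2 ^ length w" "j0 \<le> j" "worlds K (?k + j) = worlds K (?k + j0)"
      using worlds_horizon[OF wf ks_n_le] by blast
    have "b (?k + j0)" using j(1) b[OF j0(3)] by simp
    moreover have "j0 \<le> d" using j0(1) d(2) by linarith
    moreover have "\<forall>j'<j0. a (?k + j')" using j(2) j0(2) by simp
    ultimately show "\<exists>j\<le>d. b (horizon w - (r0 + d) + j) \<and> (\<forall>j'<j. a (horizon w - (r0 + d) + j'))"
      unfolding d(1) by blast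
  qed (use d(1) in blast)
  finally show ?thesis by (simp add: d(1))
qed

lemma num_at_unique: "num_at w i p j \<Longrightarrow> num_at w i p' j' \<Longrightarrow> p = p'"
  by (metis enc_nat_append_inject num_atD(1))

lemma atom_at_iff:
  assumes "num_at w (Suc i) p j"
  shows "atom_pos w S i \<longleftrightarrow> holds_pos w S p" "atom_neg w S i \<longleftrightarrow> holds_neg w S p"
proof -
  have "p < 2 ^ length w" "j < Suc (length w)" using num_atD(3,4)[OF assms] by simp_all
  then show "atom_pos w S i \<longleftrightarrow> holds_pos w S p" "atom_neg w S i \<longleftrightarrow> holds_neg w S p"
    unfolding atom_pos_def atom_neg_def using assms num_at_unique[OF assms] by metis+
qed

lemma head_enc_ltl:
  assumes "drop i w = enc_ltl \<phi> @ xs"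
  shows "i < length w" "\<not> is_digit (letter w i)"
proof -
  obtain x ys where x: "enc_ltl \<phi> = x # ys" "\<not> is_digit x" using enc_ltl_Cons by blast
  then have "drop i w = x # ys @ xs" using assms by simp
  from drop_eq_Cons[OF this] x(2) show "i < length w" "\<not> is_digit (letter w i)" by simp_all
qed

lemma active_truth_vec:
  assumes "i < length w" "active w r i"
  shows "bit (truth_vec A w (ks_init K) (r - 1)) i \<longleftrightarrow> odd (Y (r - 1) i)"
  using bit_truth_vec[OF active_pos(2)[OF assms]] assms(1) by simp

lemma reliable_mono:
  assumes "reliable i r" "i \<le> j"
  shows "reliable j r"
proof -
  have "(length w - j) * 2 ^ length w \<le> (length w - i) * 2 ^ length w"
    using assms(2) by (intro mult_right_mono) auto
  then show ?thesis using assms(1) unfolding reliable_def by linarith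
qed

text \<open>The last conjunct excludes a syntax error in the rest of the word, the one before it a
  digit that would prolong the number of an atom.\<close>

definition placed :: "ltl \<Rightarrow> nat \<Rightarrow> nat \<Rightarrow> bool" where
  "placed \<phi> i j \<longleftrightarrow> drop i w = enc_ltl \<phi> @ drop j w \<and> j = i + length (enc_ltl \<phi>) \<and>
    \<not> is_digit (letter w j) \<and> (\<forall>r. Y r j \<noteq> 0)"

definition evaluated :: "ltl \<Rightarrow> nat \<Rightarrow> nat \<Rightarrow> bool" where
  "evaluated \<phi> i j \<longleftrightarrow> (\<forall>r. Y r i div 2 = Y r j) \<and>
    (\<forall>r. reliable i r \<longrightarrow> (odd (Y r i) \<longleftrightarrow> tsat K (horizon w - r) \<phi>))"

lemma placed_nonzero: "placed \<phi> i j \<Longrightarrow> Y r j \<noteq> 0"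
  unfolding placed_def by blast

lemma evaluatedI:
  assumes "\<And>r. Y r i = 2 * Y r j + of_bool (P r)"
    "\<And>r. reliable i r \<Longrightarrow> P r \<longleftrightarrow> tsat K (horizon w - r) \<phi>"
  shows "evaluated \<phi> i j"
  using assms by (simp add: evaluated_def)

lemma unary_argument:
  assumes "placed \<phi> i j" "enc_ltl \<phi> = x # enc_ltl a"
    and IH: "\<forall>i j. placed a i j \<longrightarrow> evaluated a i j"
  shows "i < length w" "letter w i = x" "\<not> is_digit (letter w (Suc i))" "Suc i < length w"
    "Y r (Suc i) div 2 = Y r j" "2 \<le> Y r (Suc i)" "Y r j \<noteq> 0"
    "reliable (Suc i) r \<Longrightarrow> odd (Y r (Suc i)) \<longleftrightarrow> tsat K (horizon w - r) a"
proof -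
  have "drop i w = x # enc_ltl a @ drop j w" using assms(1,2) by (simp add: placed_def)
  note d = drop_eq_Cons[OF this]
  have "placed a (Suc i) j" using assms(1,2) d(3) by (auto simp: placed_def)
  then have e: "evaluated a (Suc i) j" using IH by blast
  show "i < length w" "letter w i = x" by (fact d(1,2))+
  show "Suc i < length w" "\<not> is_digit (letter w (Suc i))" using head_enc_ltl[OF d(3)] by simp_all
  show *: "Y r j \<noteq> 0" "Y r (Suc i) div 2 = Y r j"
    using e placed_nonzero[OF assms(1)] unfolding evaluated_def by blast+
  show "2 \<le> Y r (Suc i)" by (rule ccontr) (use * in simp)
  show "odd (Y r (Suc i)) \<longleftrightarrow> tsat K (horizon w - r) a" if "reliable (Suc i) r"
    using e that by (simp add: evaluated_def)
qed

text \<open>Reading from right to left pushes \<open>b\<close> before \<open>a\<close>, so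
  \<open>a\<close> is the lowest binary digit and \<open>b\<close> the next. The start of
  \<open>b\<close> lies to the right of \<open>Suc i\<close>, so reliability passes to it by
  \<open>reliable_mono\<close>.\<close>

lemma binary_arguments:
  assumes "placed \<phi> i j" "enc_ltl \<phi> = x # enc_ltl a @ enc_ltl b"
    and IH: "\<forall>i j. placed a i j \<longrightarrow> evaluated a i j" "\<forall>i j. placed b i j \<longrightarrow> evaluated b i j"
  shows "i < length w" "letter w i = x" "\<not> is_digit (letter w (Suc i))"
    "Y r (Suc i) div 2 div 2 = Y r j" "4 \<le> Y r (Suc i)" "Y r j \<noteq> 0"
    "reliable (Suc i) r \<Longrightarrow> odd (Y r (Suc i)) \<longleftrightarrow> tsat K (horizon w - r) a"
    "reliable (Suc i) r \<Longrightarrow> odd (Y r (Suc i) div 2) \<longleftrightarrow> tsat K (horizon w - r) b"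
proof -
  have "drop i w = x # enc_ltl a @ enc_ltl b @ drop j w" using assms(1,2) by (simp add: placed_def)
  note d = drop_eq_Cons[OF this]
  define l where "l = Suc i + length (enc_ltl a)"
  have "drop l w = drop (length (enc_ltl a)) (drop (Suc i) w)" by (simp add: l_def add.commute)
  then have dl: "drop l w = enc_ltl b @ drop j w" by (simp add: d(3))
  have "placed b l j" using assms(1,2) dl by (auto simp: placed_def l_def)
  then have b: "evaluated b l j" using IH by blast
  have "Y r l \<noteq> 0" for r using b placed_nonzero[OF assms(1)] unfolding evaluated_def by (metis div_0)
  then have "placed a (Suc i) l"
    using d(3) dl head_enc_ltl(2)[OF dl] by (simp add: placed_def l_def)
  then have a: "evaluated a (Suc i) l" using IH by blast
  show "i < length w" "letter w i = x" by (fact d(1,2))+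
  show "\<not> is_digit (letter w (Suc i))" using head_enc_ltl[OF d(3)] by simp_all
  show *: "Y r j \<noteq> 0" by (rule placed_nonzero[OF assms(1)])
  show **: "Y r (Suc i) div 2 div 2 = Y r j" using a b by (simp add: evaluated_def)
  show "4 \<le> Y r (Suc i)"
  proof (rule ccontr)
    assume "\<not> ?thesis"
    then have "Y r (Suc i) div 2 div 2 = 0" by presburger
    with * ** show False by simp
  qed
  assume r: "reliable (Suc i) r"
  show "odd (Y r (Suc i)) \<longleftrightarrow> tsat K (horizon w - r) a" using a r by (simp add: evaluated_def)
  have "reliable l r" using r by (rule reliable_mono) (simp add: l_def)
  then show "odd (Y r (Suc i) div 2) \<longleftrightarrow> tsat K (horizon w - r) b"
    using a b by (simp add: evaluated_def)
qed

lemma atom_value: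
  assumes "placed \<phi> i j" "enc_ltl \<phi> = x # enc_nat p" "p \<in> A"
  shows "i < length w" "letter w i = x" "atom_at A w i" "Y r (Suc i) = Y r j" "Y r j \<noteq> 0"
    "num_at w (Suc i) p j"
proof -
  have "drop i w = x # enc_nat p @ drop j w" using assms(1,2) by (simp add: placed_def)
  note d = drop_eq_Cons[OF this]
  show "i < length w" "letter w i = x" by (fact d(1,2))+
  have j: "j = Suc i + length (enc_nat p)" using assms(1,2) by (simp add: placed_def)
  show num: "num_at w (Suc i) p j" using d(3) j by (auto simp: num_at_iff)
  show "atom_at A w i"
    unfolding atom_at_def using num num_atD(3,4)[OF num] assms(1,3) by (auto simp: less_Suc_eq_le placed_def)
  show "Y r (Suc i) = Y r j"
    using Y_digits[OF d(3), of r] j is_digit_enc_nat by simp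
  show "Y r j \<noteq> 0" using assms(1) unfolding placed_def by blast
qed

lemma placed_evaluated:
  "disj_free \<phi> \<Longrightarrow> atoms \<phi> \<subseteq> A \<Longrightarrow> placed \<phi> i j \<Longrightarrow> evaluated \<phi> i j"
proof (induction \<phi> arbitrary: i j)
  case (Prop p)
  then have "p \<in> A" by simp
  note v = atom_value[OF Prop.prems(3) enc_ltl.simps(1) this]
  show ?case
  proof (rule evaluatedI)
    show "Y r i = 2 * Y r j + of_bool (tsat K (horizon w - r) (Prop p))" for r
      using v(2,3) v(4,5)[of r]
      by (simp add: Y_step[OF v(1), of r] stack_step_def is_digit_def atom_at_iff[OF v(6)] holds_tsat)
  qed simp
next
  case (NProp p)
  then have "p \<in> A" by simp
  note v = atom_value[OF NProp.prems(3) enc_ltl.simps(2) this]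
  show ?case
  proof (rule evaluatedI)
    show "Y r i = 2 * Y r j + of_bool (tsat K (horizon w - r) (NProp p))" for r
      using v(2,3) v(4,5)[of r]
      by (simp add: Y_step[OF v(1), of r] stack_step_def is_digit_def atom_at_iff[OF v(6)] holds_tsat)
  qed simp
next
  case (Or a b)
  then show ?case by simp
next
  case (Next a)
  have IH: "\<forall>i j. placed a i j \<longrightarrow> evaluated a i j" using Next by simp
  note u = unary_argument[OF Next.prems(3) enc_ltl.simps(5) IH]
  show ?case
  proof (rule evaluatedI)
    show "Y r i = 2 * Y r j + of_bool (bit (truth_vec A w (ks_init K) (r - 1)) (Suc i))" for r
      using u(2,3) u(5-7)[of r] by (simp add: Y_step[OF u(1)] stack_step_def is_digit_def)
    fix r assume r: "reliable i r"
    \<comment> \<open>\<open>Next\<close> reads its argument at \<open>r - 1\<close>, where it is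
      still reliable because the block of position \<open>i\<close> has at least one step.\<close>
    have "1 \<le> (length w - i) * 2 ^ length w" using u(1) by (simp add: Suc_le_eq)
    moreover have "(1::nat) \<le> 2 ^ length w" by simp
    moreover have "(length w - i) * 2 ^ length w + 2 ^ length w \<le> r" "r \<le> horizon w"
      using r unfolding reliable_def by blast+
    ultimately have r1: "(length w - i) * 2 ^ length w \<le> r - 1" "0 < r - 1" "r \<le> horizon w"
      by linarith+
    have r2: "reliable (Suc i) (r - 1)"
      unfolding reliable_Suc[OF u(1)] using r1 by linarith
    have "bit (truth_vec A w (ks_init K) (r - 1)) (Suc i) \<longleftrightarrow> odd (Y (r - 1) (Suc i))"
      using bit_truth_vec[OF r1(2)] u(4) by simp
    also have "\<dots> \<longleftrightarrow> tsat K (horizon w - (r - 1)) a" by (rule u(8)[OF r2])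
    also have "horizon w - (r - 1) = Suc (horizon w - r)" using r1(2,3) by linarith
    finally show "bit (truth_vec A w (ks_init K) (r - 1)) (Suc i) \<longleftrightarrow> tsat K (horizon w - r) (Next a)"
      by (simp add: tsat_simps)
  qed
next
  case (Fin a)
  have IH: "\<forall>i j. placed a i j \<longrightarrow> evaluated a i j" using Fin by simp
  note u = unary_argument[OF Fin.prems(3) enc_ltl.simps(6) IH]
  \<comment> \<open>The bit of the previous vector is the parity of the stack at
    \<open>r - 1\<close>, which turns the evaluation step into a recursion in
    \<open>r\<close>.\<close>
  have eq: "Y r i = 2 * Y r j + of_bool (odd (Y r (Suc i)) \<or> active w r i \<and> odd (Y (r - 1) i))" for r
    using u(2,3) u(5-7)[of r] active_truth_vec[OF u(1), of r]
    by (auto simp: Y_step[OF u(1), of r] stack_step_def is_digit_def)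
  show ?case
  proof (rule evaluatedI[of i j "\<lambda>r. odd (Y r i)"])
    show "Y r i = 2 * Y r j + of_bool (odd (Y r i))" for r by (simp add: eq[of r])
    fix r assume "reliable i r"
    then have "odd (Y r i) \<longleftrightarrow> (\<exists>k. tsat K (horizon w - r + k) a \<and> (\<forall>k'<k. True))"
    proof (rule reliable_until[OF u(1)])
      show "worlds K k = worlds K k' \<Longrightarrow> tsat K k a \<longleftrightarrow> tsat K k' a" for k k'
        using Fin.prems(1) by (intro tsat_worlds[OF wf]) simp_all
      show "odd (Y r i) \<longleftrightarrow> tsat K (horizon w - r) a \<or> True \<and> active w r i \<and> odd (Y (r - 1) i)"
        if "reliable (Suc i) r" for r
        using u(8)[OF that] by (auto simp: eq[of r])
    qed
    then show "odd (Y r i) \<longleftrightarrow> tsat K (horizon w - r) (Fin a)" by (simp add: tsat_simps)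
  qed
next
  case (Glob a)
  have IH: "\<forall>i j. placed a i j \<longrightarrow> evaluated a i j" using Glob by simp
  note u = unary_argument[OF Glob.prems(3) enc_ltl.simps(7) IH]
  have eq: "Y r i = 2 * Y r j + of_bool (odd (Y r (Suc i)) \<and> (active w r i \<longrightarrow> odd (Y (r - 1) i)))" for r
    using u(2,3) u(5-7)[of r] active_truth_vec[OF u(1), of r]
    by (auto simp: Y_step[OF u(1), of r] stack_step_def is_digit_def)
  show ?case
  proof (rule evaluatedI[of i j "\<lambda>r. odd (Y r i)"])
    show "Y r i = 2 * Y r j + of_bool (odd (Y r i))" for r by (simp add: eq[of r])
    fix r assume "reliable i r"
    \<comment> \<open>A counterexample to \<open>Glob\<close> is an until for the negated
      argument.\<close>
    then have "\<not> odd (Y r i) \<longleftrightarrow> (\<exists>k. \<not> tsat K (horizon w - r + k) a \<and> (\<forall>k'<k. True))"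
    proof (rule reliable_until[OF u(1)])
      show "worlds K k = worlds K k' \<Longrightarrow> \<not> tsat K k a \<longleftrightarrow> \<not> tsat K k' a" for k k'
        using tsat_worlds[OF wf, of a k k'] Glob.prems(1) by simp
      show "\<not> odd (Y r i) \<longleftrightarrow> \<not> tsat K (horizon w - r) a \<or> True \<and> active w r i \<and> \<not> odd (Y (r - 1) i)"
        if "reliable (Suc i) r" for r
        using u(8)[OF that] by (auto simp: eq[of r])
    qed
    then show "odd (Y r i) \<longleftrightarrow> tsat K (horizon w - r) (Glob a)" by (simp add: tsat_simps)
  qed
next
  case (And a b)
  have IH: "\<forall>i j. placed a i j \<longrightarrow> evaluated a i j" "\<forall>i j. placed b i j \<longrightarrow> evaluated b i j"
    using And by simp_all
  note u = binary_arguments[OF And.prems(3) enc_ltl.simps(3) IH]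
  show ?case
  proof (rule evaluatedI)
    show "Y r i = 2 * Y r j + of_bool (odd (Y r (Suc i)) \<and> odd (Y r (Suc i) div 2))" for r
      using u(2,3) u(4-6)[of r] by (simp add: Y_step[OF u(1), of r] stack_step_def is_digit_def)
    fix r assume "reliable i r"
    then have "reliable (Suc i) r" by (rule reliable_mono) simp
    then show "odd (Y r (Suc i)) \<and> odd (Y r (Suc i) div 2) \<longleftrightarrow> tsat K (horizon w - r) (And a b)"
      using u(7,8) by (simp add: tsat_simps)
  qed
next
  case (Until a b)
  have IH: "\<forall>i j. placed a i j \<longrightarrow> evaluated a i j" "\<forall>i j. placed b i j \<longrightarrow> evaluated b i j"
    using Until by simp_all
  note u = binary_arguments[OF Until.prems(3) enc_ltl.simps(8) IH]
  have eq: "Y r i = 2 * Y r j + of_bool (odd (Y r (Suc i) div 2) \<or>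
      odd (Y r (Suc i)) \<and> active w r i \<and> odd (Y (r - 1) i))" for r
    using u(2,3) u(4-6)[of r] active_truth_vec[OF u(1), of r]
    by (auto simp: Y_step[OF u(1), of r] stack_step_def is_digit_def)
  show ?case
  proof (rule evaluatedI[of i j "\<lambda>r. odd (Y r i)"])
    show "Y r i = 2 * Y r j + of_bool (odd (Y r i))" for r by (simp add: eq[of r])
    fix r assume "reliable i r"
    then have "odd (Y r i) \<longleftrightarrow> (\<exists>k. tsat K (horizon w - r + k) b \<and> (\<forall>k'<k. tsat K (horizon w - r + k') a))"
    proof (rule reliable_until[OF u(1)])
      show "worlds K k = worlds K k' \<Longrightarrow> tsat K k b \<longleftrightarrow> tsat K k' b" for k k'
        using Until.prems(1) by (intro tsat_worlds[OF wf]) simp_all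
      show "odd (Y r i) \<longleftrightarrow> tsat K (horizon w - r) b \<or>
          tsat K (horizon w - r) a \<and> active w r i \<and> odd (Y (r - 1) i)"
        if "reliable (Suc i) r" for r
        using u(7,8)[OF that] by (auto simp: eq[of r])
    qed
    then show "odd (Y r i) \<longleftrightarrow> tsat K (horizon w - r) (Until a b)" by (simp add: tsat_simps)
  qed
next
  case (Release a b)
  have IH: "\<forall>i j. placed a i j \<longrightarrow> evaluated a i j" "\<forall>i j. placed b i j \<longrightarrow> evaluated b i j"
    using Release by simp_all
  note u = binary_arguments[OF Release.prems(3) enc_ltl.simps(9) IH]
  have eq: "Y r i = 2 * Y r j + of_bool (odd (Y r (Suc i) div 2) \<and>
      (odd (Y r (Suc i)) \<or> (active w r i \<longrightarrow> odd (Y (r - 1) i))))" for r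
    using u(2,3) u(4-6)[of r] active_truth_vec[OF u(1), of r]
    by (auto simp: Y_step[OF u(1), of r] stack_step_def is_digit_def)
  show ?case
  proof (rule evaluatedI[of i j "\<lambda>r. odd (Y r i)"])
    show "Y r i = 2 * Y r j + of_bool (odd (Y r i))" for r by (simp add: eq[of r])
    fix r assume "reliable i r"
    then have "\<not> odd (Y r i) \<longleftrightarrow>
        (\<exists>k. \<not> tsat K (horizon w - r + k) b \<and> (\<forall>k'<k. \<not> tsat K (horizon w - r + k') a))"
    proof (rule reliable_until[OF u(1)])
      show "worlds K k = worlds K k' \<Longrightarrow> \<not> tsat K k b \<longleftrightarrow> \<not> tsat K k' b" for k k'
        using tsat_worlds[OF wf, of b k k'] Release.prems(1) by simp
      show "\<not> odd (Y r i) \<longleftrightarrow> \<not> tsat K (horizon w - r) b \<or>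
          \<not> tsat K (horizon w - r) a \<and> active w r i \<and> \<not> odd (Y (r - 1) i)"
        if "reliable (Suc i) r" for r
        using u(7,8)[OF that] by (auto simp: eq[of r])
    qed
    then show "odd (Y r i) \<longleftrightarrow> tsat K (horizon w - r) (Release a b)" by (simp add: tsat_simps)
  qed
qed

lemma accepts_formula:
  assumes "F = enc_ltl \<phi>" "disj_free \<phi>" "atoms \<phi> \<subseteq> A"
  shows "Y (horizon w) 0 = 3 \<longleftrightarrow> sat_s (traces K) \<phi>"
proof -
  have dF: "drop (length F) w = enc_kripke K" by (simp add: w)
  have 13: "length F < length w" "letter w (length F) = 13"
    using drop_eq_Cons[OF dF[unfolded enc_kripke_def]] by simp_all
  have one: "Y r (length F) = 1" for r
    using 13(2) by (simp add: Y_step[OF 13(1)] stack_step_def is_digit_def)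
  have "placed \<phi> 0 (length F)"
    unfolding placed_def
  proof (intro conjI allI)
    show "drop 0 w = enc_ltl \<phi> @ drop (length F) w" unfolding dF assms(1)[symmetric] by (simp add: w)
    show "length F = 0 + length (enc_ltl \<phi>)" by (simp add: assms(1))
    show "\<not> is_digit (letter w (length F))" by (simp add: 13(2) is_digit_def)
    show "Y r (length F) \<noteq> 0" for r by (simp add: one)
  qed
  then have "evaluated \<phi> 0 (length F)" by (rule placed_evaluated[OF assms(2,3)])
  \<comment> \<open>The horizon is exactly the value of \<open>r\<close> from which position 0 is
    reliable.\<close>
  moreover have "reliable 0 (horizon w)" by (simp add: reliable_def horizon_def)
  ultimately have "Y (horizon w) 0 div 2 = 1" "odd (Y (horizon w) 0) \<longleftrightarrow> tsat K 0 \<phi>"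
    using one by (simp_all add: evaluated_def)
  moreover have "tsat K 0 \<phi> \<longleftrightarrow> sat_s (traces K) \<phi>"
    by (simp add: tsat_def team_suffix_def suffix_def)
  moreover have "y div 2 = 1 \<Longrightarrow> y = 3 \<longleftrightarrow> odd y" for y :: nat by presburger
  ultimately show ?thesis by metis
qed

end

lemma stack_at_0: "stack_at A w S V r 0 = stack A w S V r (length w - 0)"
  by (simp add: stack_at_def)

lemma accepts_iff: "accepts A w \<longleftrightarrow> w \<in> TMC_s_disjfree A"
proof
  assume "w \<in> TMC_s_disjfree A"
  then obtain \<phi> K where \<phi>: "w = enc_instance \<phi> K" "disj_free \<phi>" "atoms \<phi> \<subseteq> A" "wf_kripke A K"
    "sat_s (traces K) \<phi>"
    by (auto simp: TMC_s_disjfree_def)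
  interpret instance_word A K "enc_ltl \<phi>" w
    by unfold_locales (use \<phi> set_enc_ltl in \<open>auto simp: enc_instance_def\<close>)
  have "Y (horizon w) 0 = 3" using accepts_formula[OF refl] \<phi> by simp
  moreover have "length (enc_ltl \<phi>) < length w" by (simp add: \<phi>(1) enc_instance_def enc_kripke_def)
  moreover have "ks_init K < length w" using wf ks_n_le by (simp add: wf_kripke_def)
  moreover have "\<not> is_digit (letter w 0)"
    using head_enc_ltl(2)[of 0 \<phi> "enc_kripke K"] by (simp add: \<phi>(1) enc_instance_def)
  ultimately show "accepts A w"
    unfolding accepts_def using kripke_at by (auto simp: Y_def stack_at_def)
next
  assume "accepts A w"
  then obtain m ini where m: "m < length w" "kripke_at A w m ini" "\<not> is_digit (letter w 0)"
    and st: "stack_at A w (reach w ini 0) (truth_vec A w ini (horizon w - 1)) (horizon w) 0 = 3"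
    unfolding accepts_def stack_at_0 by blast
  have 13: "letter w m = 13" "\<forall>i<m. letter w i \<noteq> 13" using m(2) by (auto simp: kripke_at_def)
  obtain ds fs where p: "drop 0 w = ds @ concat (map enc_ltl fs) @ drop m w" "\<forall>d\<in>set ds. is_digit d"
    "\<forall>f\<in>set fs. disj_free f \<and> atoms f \<subseteq> A" "(3::nat) div 2 ^ length fs = 1"
    using parse_stack[OF 13, of 0 A "reach w ini 0" "truth_vec A w ini (horizon w - 1)" "horizon w"] st
    by auto
  have ds: "ds = []"
  proof (cases ds)
    case (Cons d ds')
    then have "drop 0 w = d # ds' @ concat (map enc_ltl fs) @ drop m w" using p(1) by simp
    then have "letter w 0 = d" by (rule drop_eq_Cons(2))
    then show ?thesis using m(3) p(2) Cons by simp
  qed simp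
  \<comment> \<open>3 has two binary digits, so removing one per formula leaves the bottom 1 only
    for a single formula.\<close>
  have "length fs = 1"
  proof (rule ccontr)
    assume "length fs \<noteq> 1"
    then consider "length fs = 0" | "2 \<le> length fs" by linarith
    then show False
    proof cases
      case 2
      then have "(2::nat) ^ 2 \<le> 2 ^ length fs" by (intro power_increasing) auto
      then show ?thesis using p(4) by simp
    qed (use p(4) in simp)
  qed
  then obtain \<phi> where fs: "fs = [\<phi>]" by (cases fs) auto
  have w: "w = enc_ltl \<phi> @ drop m w" using p(1) ds fs by simp
  from arg_cong[OF this, of length] m(1) have lm: "length (enc_ltl \<phi>) = m" by simp
  have tm: "take m w = enc_ltl \<phi>" by (subst w) (simp add: lm)
  from kripke_at_parse[OF m(2)] obtain es ls where
    k: "w = kripke_word (enc_ltl \<phi>) ini es ls" "wf_parts A ini es ls"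
    using set_enc_ltl[of \<phi>] unfolding tm by blast
  define K :: kripke where "K = \<lparr>ks_n = length ls, ks_edges = es, ks_lab = ls, ks_init = ini\<rparr>"
  have wfK: "wf_kripke A K" using k(2) by (auto simp: K_def wf_kripke_def wf_parts_def)
  have wK: "w = enc_ltl \<phi> @ enc_kripke K" by (subst k(1)) (simp add: kripke_word_def enc_kripke_def K_def)
  interpret instance_word A K "enc_ltl \<phi>" w
    by unfold_locales (use wfK wK set_enc_ltl in auto)
  have "ks_init K = ini" by (simp add: K_def)
  then have "Y (horizon w) 0 = 3" using st by (simp add: Y_def)
  then have "sat_s (traces K) \<phi>" using accepts_formula[OF refl] p(3) fs by simp
  then show "w \<in> TMC_s_disjfree A"
    unfolding TMC_s_disjfree_def enc_instance_def using wK wfK p(3) fs by auto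
qed

theorem mainTheorem8:
  fixes AP :: "nat set"
  assumes "finite AP"
  shows "in_PSPACE instance_alphabet (TMC_s_disjfree AP)"
  using PSPACE_of_psdec psdec_accepts[OF assms] unfolding accepts_iff instance_alphabet_def by blast

end
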